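(* Let $n\geq 3$ be an integer and let $2<k<n$. Let $V\in PM^{n-2}$ and $u_0\in PM^{k}$, and set $C_{n-2,k}=\frac{K(2,n-k,n)}{4\pi^{2}}$. (i) (Existence and uniqueness) If $$\|V\|_{PM^{n-2}}<\frac{1}{C_{n-2,k}},$$ then the functional equation $u(t)=G(t)u_0+L_V(u)(t)$, $t\ge 0$, has a unique solution $u$ in $X_k$. (ii) (Hardy potential) For $V(x)=\frac{\lambda}{|x|^{2}}$ with $\lambda\in\mathbb{R}$, the condition $\|V\|_{PM^{n-2}}<1/C_{n-2,k}$ is equivalent to $|\lambda|<(k-2)(n-k)$. The maximum of $(k-2)(n-k)$ over $2<k<n$ is $\lambda_\ast=\frac{(n-2)^2}{4}$, attained at $k=\frac{n+2}{2}$. Consequently, for every $u_0\in PM^{1+\frac n2}$ and every $\lambda$ with $0\le|\lambda|<\lambda_\ast$, the functional equation $u(t)=G(t)u_0+L_V(u)(t)$ with $V(x)=\lambda|x|^{-2}$ has a (unique) solution $u\in X_{1+\frac n2}$. (iii) (Continuous dependence) The data-solution map $(u_0,V)\mapsto u$ is Lipschitz continuous from $PM^k\times PM^{n-2}$ to $X_k$ in the following precise sense: if $u_0,v_0\in PM^k$, if $V,W\in PM^{n-2}$ satisfy $\|V\|_{PM^{n-2}}<1/C_{n-2,k}$ and $\|W\|_{PM^{n-2}}<1/C_{n-2,k}$, and if $u,v\in X_k$ are the solutions from (i) corresponding to $(u_0,V)$ and $(v_0,W)$, respectively, then $$\|u-v\|_{X_k}\le\frac{1}{1-C_{n-2,k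}\|V\|_{PM^{n-2}}}\left(\|u_0-v_0\|_{PM^k}+\frac{C_{n-2,k}\|v_0\|_{PM^k}}{1-C_{n-2,k}\|W\|_{PM^{n-2}}}\|V-W\|_{PM^{n-2}}\right).$$
   Context: The Fourier transform is $\hat f(\xi)=\int_{\mathbb{R}^n}f(x)e^{-2\pi i\xi\cdot x}\,dx$ on $\mathcal{S}(\mathbb{R}^n)$, extended to $\mathcal{S}'(\mathbb{R}^n)$. For $k\ge 0$, $PM^k$ is the Banach space of $u\in\mathcal{S}'(\mathbb{R}^n)$ such that $\hat u\in L^1_{loc}(\mathbb{R}^n)$ and $\|u\|_{PM^k}:=\operatorname{ess\,sup}_{\xi\in\mathbb{R}^n}|\xi|^k|\hat u(\xi)|<\infty$. $X_k=BC_w([0,\infty);PM^k)$ is the space of bounded functions $u:[0,\infty)\to PM^k$ which are continuous in time, at each $t\ge 0$, in the weak sense of $\mathcal{S}'(\mathbb{R}^n)$, with norm $\|u\|_{X_k}=\sup_{t>0}\|u(\cdot,t)\|_{PM^k}$. The operators $G(t)$ and $L_V$ are defined via the Fourier transform by $$\widehat{G(t)u_0}(\xi)=e^{-4\pi^2|\xi|^2t}\,\hat u_0(\xi),\qquad \widehat{L_V(u)}(\xi,t)=\int_0^t e^{-4\pi^2|\xi|^2(t-s)}\big(\hat V\ast\hat u(\cdot,s)\big)(\xi)\,ds,$$ where $\ast$ is convolution in $\mathbb{R}^n$ and the time integral is understood weakly (tested against functions of $\mathcal{S}(\mathbb{R}^n)$). The functional equation $u(t)=G(t)u_0+L_V(u)(t)$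 is the integral formulation of the Cauchy problem $u_t-\Delta u-V(x)u=0$ in $\mathbb{R}^n$, $u(x,0)=u_0(x)$. $K(\theta_1,\theta_2,n)=\dfrac{\nu_{\theta_1}\nu_{\theta_2}\nu_{n-\theta_1-\theta_2}}{\nu_{\theta_1+\theta_2}\nu_{n-\theta_1}\nu_{n-\theta_2}}$, where $\nu_\theta=\pi^{-\theta/2}\Gamma(\theta/2)$ and $\Gamma$ is the Gamma function. *)

theory Defs
  imports "HOL-Probability.Essential_Supremum" "HOL-Library.Function_Algebras"
begin

section \<open>Schwartz functions and tempered distributions\<close>

definition partial :: "'n::finite \<Rightarrow> (real^'n \<Rightarrow> complex) \<Rightarrow> (real^'n \<Rightarrow> complex)" where
  "partial i f = (\<lambda>x. frechet_derivative f (at x) (axis i 1))"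

definition partials :: "'n::finite list \<Rightarrow> (real^'n \<Rightarrow> complex) \<Rightarrow> (real^'n \<Rightarrow> complex)" where
  "partials \<alpha> f = foldr partial \<alpha> f"

definition schwartz :: "(real^'n::finite \<Rightarrow> complex) set" where
  "schwartz = {\<phi>. \<forall>\<alpha>. (\<forall>x. partials \<alpha> \<phi> differentiable at x) \<and>
                    (\<forall>m::nat. bounded (range (\<lambda>x. (1 + norm x) ^ m *\<^sub>R partials \<alpha> \<phi> x)))}"

definition schwartz_seminorm :: "nat \<Rightarrow> (real^'n::finite \<Rightarrow> complex) \<Rightarrow> real" where
  "schwartz_seminorm N \<phi> =
     (SUP (\<alpha>, x) \<in> {\<alpha>. length \<alpha> \<le> N} \<times> UNIV. (1 + norm x) ^ N * norm (partials \<alpha> \<phi> x))"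

type_synonym 'n dist = "(real^'n \<Rightarrow> complex) \<Rightarrow> complex"

text \<open>A tempered distribution is a continuous complex-linear functional on the Schwartz space. It is
  stored as a total function which is 0 outside the Schwartz space, so that equality
  and the pointwise \<open>+\<close>, \<open>-\<close>, \<open>0\<close> of function types are those of the space of tempered
  distributions.\<close>

definition tempered :: "'n::finite dist set" where
  "tempered = {T.
     (\<forall>\<phi>\<in>schwartz. \<forall>\<psi>\<in>schwartz. T (\<lambda>x. \<phi> x + \<psi> x) = T \<phi> + T \<psi>) \<and>
     (\<forall>c. \<forall>\<phi>\<in>schwartz. T (\<lambda>x. c * \<phi> x) = c * T \<phi>) \<and>
     (\<exists>C N. \<forall>\<phi>\<in>schwartz. norm (T \<phi>) \<le> C * schwartz_seminorm N \<phi>) \<and>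
     (\<forall>\<phi>. \<phi> \<notin> schwartz \<longrightarrow> T \<phi> = 0)}"


section \<open>Fourier transform\<close>

definition fourier :: "(real^'n::finite \<Rightarrow> complex) \<Rightarrow> (real^'n \<Rightarrow> complex)" where
  "fourier f = (\<lambda>\<xi>. LINT x|lborel. f x * exp (- (2 * of_real pi * \<i> * of_real (\<xi> \<bullet> x))))"

definition fourier_inv :: "(real^'n::finite \<Rightarrow> complex) \<Rightarrow> (real^'n \<Rightarrow> complex)" where
  "fourier_inv f = (\<lambda>x. LINT \<xi>|lborel. f \<xi> * exp (2 * of_real pi * \<i> * of_real (\<xi> \<bullet> x)))"

definition dist_fourier :: "'n::finite dist \<Rightarrow> 'n dist" where
  "dist_fourier T = (\<lambda>\<phi>. if \<phi> \<in> schwartz then T (fourier \<phi>) else 0)"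

definition dist_fourier_inv :: "'n::finite dist \<Rightarrow> 'n dist" where
  "dist_fourier_inv T = (\<lambda>\<phi>. if \<phi> \<in> schwartz then T (fourier_inv \<phi>) else 0)"

definition dist_mult :: "(real^'n::finite \<Rightarrow> complex) \<Rightarrow> 'n dist \<Rightarrow> 'n dist" where
  "dist_mult m T = (\<lambda>\<phi>. if \<phi> \<in> schwartz then T (\<lambda>\<xi>. m \<xi> * \<phi> \<xi>) else 0)"


section \<open>The spaces $PM^k$ and $X_k$\<close>

definition locally_integrable :: "(real^'n::finite \<Rightarrow> complex) \<Rightarrow> bool" where
  "locally_integrable g \<longleftrightarrow> (\<forall>K. compact K \<longrightarrow> set_integrable lborel K g)"

text \<open>The tempered distribution \<open>T\<close> is the function \<open>g\<close>. The pairing is required for all Schwartz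
  functions; if \<open>|\<xi>|^k |g|\<close> is essentially bounded for some \<open>k \<ge> 0\<close>, as in $PM^k$, the
  integrability is automatic and, by density, testing with compactly supported smooth functions
  gives the same notion.\<close>

definition represents :: "(real^'n::finite \<Rightarrow> complex) \<Rightarrow> 'n dist \<Rightarrow> bool" where
  "represents g T \<longleftrightarrow> locally_integrable g \<and>
     (\<forall>\<phi>\<in>schwartz. integrable lborel (\<lambda>\<xi>. g \<xi> * \<phi> \<xi>) \<and> T \<phi> = (LINT \<xi>|lborel. g \<xi> * \<phi> \<xi>))"

text \<open>The Fourier transform of \<open>u\<close> as a function; the representative is unique only almost
  everywhere, and all uses below are insensitive to null sets.\<close>

definition hat :: "'n::finite dist \<Rightarrow> (real^'n \<Rightarrow> complex)" where
  "hat u = (SOME g. represents g (dist_fourier u))"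

definition PM_esssup :: "real \<Rightarrow> 'n::finite dist \<Rightarrow> ereal" where
  "PM_esssup k u = esssup lborel (\<lambda>\<xi>. ereal (norm \<xi> powr k * norm (hat u \<xi>)))"

definition PM :: "real \<Rightarrow> 'n::finite dist set" where
  "PM k = {u \<in> tempered. (\<exists>g. represents g (dist_fourier u)) \<and> PM_esssup k u < \<infinity>}"

definition PM_norm :: "real \<Rightarrow> 'n::finite dist \<Rightarrow> real" where
  "PM_norm k u = real_of_ereal (PM_esssup k u)"

text \<open>Functions on $[0,\infty)$ are total functions extended by \<open>0\<close> to negative times, so that
  equality in \<open>X_space k\<close> is equality on $[0,\infty)$.\<close>

definition X_space :: "real \<Rightarrow> (real \<Rightarrow> 'n::finite dist) set" where
  "X_space k = {u.
     (\<forall>t\<ge>0. u t \<in> PM k) \<and>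
     (\<exists>B. \<forall>t\<ge>0. PM_norm k (u t) \<le> B) \<and>
     (\<forall>\<phi>\<in>schwartz. continuous_on {0..} (\<lambda>t. u t \<phi>)) \<and>
     (\<forall>t<0. u t = 0)}"

definition X_norm :: "real \<Rightarrow> (real \<Rightarrow> 'n::finite dist) \<Rightarrow> real" where
  "X_norm k u = (SUP t\<in>{0<..}. PM_norm k (u t))"


section \<open>The functional equation\<close>

definition heat_symbol :: "real \<Rightarrow> real^'n::finite \<Rightarrow> complex" where
  "heat_symbol t \<xi> = of_real (exp (- 4 * pi\<^sup>2 * (norm \<xi>)\<^sup>2 * t))"

definition heat_op :: "real \<Rightarrow> 'n::finite dist \<Rightarrow> 'n dist" where
  "heat_op t u\<^sub>0 = dist_fourier_inv (dist_mult (heat_symbol t) (dist_fourier u\<^sub>0))"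

definition convolution ::
  "(real^'n::finite \<Rightarrow> complex) \<Rightarrow> (real^'n \<Rightarrow> complex) \<Rightarrow> (real^'n \<Rightarrow> complex)" where
  "convolution f g = (\<lambda>\<xi>. LINT \<eta>|lborel. f (\<xi> - \<eta>) * g \<eta>)"

definition L_hat :: "'n::finite dist \<Rightarrow> (real \<Rightarrow> 'n dist) \<Rightarrow> real \<Rightarrow> 'n dist" where
  "L_hat V u t = (\<lambda>\<psi>. if \<psi> \<in> schwartz then
     (LINT s:{0..t}|lborel.
        (LINT \<xi>|lborel. heat_symbol (t - s) \<xi> * convolution (hat V) (hat (u s)) \<xi> * \<psi> \<xi>))
     else 0)"

definition L_op :: "'n::finite dist \<Rightarrow> (real \<Rightarrow> 'n dist) \<Rightarrow> real \<Rightarrow> 'n dist" where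
  "L_op V u t = dist_fourier_inv (L_hat V u t)"

definition solves :: "'n::finite dist \<Rightarrow> 'n dist \<Rightarrow> (real \<Rightarrow> 'n dist) \<Rightarrow> bool" where
  "solves u\<^sub>0 V u \<longleftrightarrow> (\<forall>t\<ge>0. u t = heat_op t u\<^sub>0 + L_op V u t)"


section \<open>Constants and the Hardy potential\<close>

definition nu :: "real \<Rightarrow> real" where
  "nu \<theta> = pi powr (- \<theta> / 2) * Gamma (\<theta> / 2)"

definition K_const :: "real \<Rightarrow> real \<Rightarrow> real \<Rightarrow> real" where
  "K_const \<theta>\<^sub>1 \<theta>\<^sub>2 n = (nu \<theta>\<^sub>1 * nu \<theta>\<^sub>2 * nu (n - \<theta>\<^sub>1 - \<theta>\<^sub>2)) /
                (nu (\<theta>\<^sub>1 + \<theta>\<^sub>2) * nu (n - \<theta>\<^sub>1) * nu (n - \<theta>\<^sub>2))"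

text \<open>$C_{n-2,k}$\<close>

definition C_const :: "real \<Rightarrow> real \<Rightarrow> real" where
  "C_const n k = K_const 2 (n - k) n / (4 * pi\<^sup>2)"

definition hardy :: "real \<Rightarrow> 'n::finite dist" where
  "hardy c = (\<lambda>\<phi>. if \<phi> \<in> schwartz
     then (LINT x|lborel. of_real (c / (norm x)\<^sup>2) * \<phi> x) else 0)"

end

theory Submission
  imports Defs "HOL-Probability.Characteristic_Functions" "HOL-Probability.Sinc_Integral"
begin

text \<open>On the Fourier side, $PM^k$ consists of the measurable functions bounded by a multiple of
  $|\xi|^{-k}$. Writing the Riesz kernels as superpositions of heat kernels gives
  $|\cdot|^{-(n-2)} * |\cdot|^{-k} = K(2,n-k,n)\,|\cdot|^{-(k-2)}$, and the heat symbol integrates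
  in time to at most $1/(4\pi^2|\xi|^2)$; hence $L_V$ has norm at most $C_{n-2,k}\|V\|$ on $X_k$.
  A solution is obtained as a Neumann series of jointly measurable functions of $(t,\xi)$. The
  Fourier transform of an arbitrary element of $X_k$ need not be jointly measurable, so uniqueness
  and the Lipschitz estimate are proved by duality: the difference of two solutions is tested
  against Schwartz functions, which are dense in the $L^1$ space with weight $|\xi|^{-k}$. The
  same superposition of heat kernels yields the Fourier transform of $|x|^{-2}$.\<close>

section \<open>Translation and reflection of Lebesgue measure\<close>

text \<open>The estimates therefore bound the \<xi>-integrand at each fixed s by an explicit kernel
  and apply Tonelli to that kernel only. For existence the solution is one function of both
  variables; the representatives chosen by \<open>hat\<close> differ from it on null sets at each
  time, which the convolution does not see. In the Riesz convolution, k > 2 gives convergence at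
  infinity and k < n at the origin. It turns the weight |\<xi>|^(-k) into |\<xi>|^(-(k-2)), and the
  missing factor |\<xi>|^(-2) is returned by the time integral of the heat symbol. The number
  (k-2)(n-k) appears because 1/C_{n-2,k} and the norm of \<lambda>|x|^(-2) share the factor pi times
  \<open>nu (n - 2)\<close>. Finally, the norm of X_k ignores time zero, so the estimates assume
  bounds at positive times only and recover time zero from the equation.\<close>

lemma distr_lborel_affine:
  fixes t :: "'a::euclidean_space"
  assumes "\<bar>c\<bar> = 1"
  shows "distr lborel borel (\<lambda>x. t + c *\<^sub>R x) = lborel"
  using lborel_affine[of c t] assms by (auto simp: density_1 one_ennreal_def[symmetric])

lemma distr_lborel_reflect:
  fixes t :: "'a::euclidean_space"
  shows "distr lborel borel (\<lambda>x. t - x) = lborel"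
  using distr_lborel_affine[of "-1" t] by simp

lemma distr_lborel_shift:
  fixes t :: "'a::euclidean_space"
  shows "distr lborel borel (\<lambda>x. x + t) = lborel"
  using distr_lborel_affine[of 1 t] by (simp add: add.commute)

lemma nn_integral_lborel_shift:
  fixes f :: "'a::euclidean_space \<Rightarrow> ennreal"
  assumes [measurable]: "f \<in> borel_measurable borel"
  shows "(\<integral>\<^sup>+x. f (x + t) \<partial>lborel) = (\<integral>\<^sup>+x. f x \<partial>lborel)"
  by (subst (2) distr_lborel_shift[of t, symmetric]) (simp add: nn_integral_distr)

lemma integral_lborel_reflect:
  fixes f :: "'a::euclidean_space \<Rightarrow> 'b::{banach, second_countable_topology}"
  assumes [measurable]: "f \<in> borel_measurable borel"
  shows "(LINT x|lborel. f (t - x)) = (LINT x|lborel. f x)"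
  by (subst (2) distr_lborel_reflect[of t, symmetric]) (simp add: integral_distr)

lemma integrable_lborel_shift:
  fixes f :: "'a::euclidean_space \<Rightarrow> 'b::{banach, second_countable_topology}"
  assumes "integrable lborel f"
  shows "integrable lborel (\<lambda>x. f (x + t))"
proof -
  have [measurable]: "f \<in> borel_measurable borel" using assms by auto
  show ?thesis
    using assms by (subst (asm) distr_lborel_shift[of t, symmetric]) (simp add: integrable_distr_eq)
qed

lemma integral_lborel_shift:
  fixes f :: "'a::euclidean_space \<Rightarrow> 'b::{banach, second_countable_topology}"
  assumes [measurable]: "f \<in> borel_measurable borel"
  shows "(LINT x|lborel. f (x + t)) = (LINT x|lborel. f x)"
  by (subst (2) distr_lborel_shift[of t, symmetric]) (simp add: integral_distr)

text \<open>Transfers an almost everywhere bound on a potential V to the function \<eta> \<mapsto>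
  V(\<xi> - \<eta>) for each fixed \<xi>, so that convolutions can be bounded at every point and not
  merely at almost every one.\<close>

lemma AE_lborel_reflect:
  fixes t :: "'a::euclidean_space"
  assumes "AE x in lborel. P x"
  shows "AE x in lborel. P (t - x)"
proof -
  have "AE x in distr lborel borel (\<lambda>x. t - x). P x" using assms by (simp only: distr_lborel_reflect)
  then show ?thesis by (rule AE_distrD[rotated]) simp
qed

section \<open>Product integrals\<close>

text \<open>\<open>lborel\<close> on vectors is the image of a product measure indexed by
  \<open>Basis\<close>; the statement transports the product integral along the bijection i
  \<mapsto> \<open>axis i 1\<close>. It serves Gaussians, which factor over coordinates, and the
  product majorant of an inverse power of 1 + |x|.\<close>

lemma
  fixes f :: "'n::finite \<Rightarrow> real \<Rightarrow> 'b::{real_normed_field, banach, second_countable_topology}"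
  assumes "\<And>i. integrable lborel (f i)"
  shows integrable_lborel_prod_vec: "integrable lborel (\<lambda>x::real^'n. \<Prod>i\<in>UNIV. f i (x $ i))"
    and integral_lborel_prod_vec:
      "(LINT x|lborel. (\<Prod>i\<in>UNIV. f i ((x::real^'n) $ i))) = (\<Prod>i\<in>UNIV. (LINT y|lborel. f i y))"
proof -
  interpret product_sigma_finite "\<lambda>_::real^'n. lborel::real measure" by standard
  have [measurable]: "\<And>i. f i \<in> borel_measurable borel" using assms by auto
  \<comment> \<open>The inverse of i \<mapsto> \<open>axis i 1\<close>, used to index the factors by
    basis vectors.\<close>
  define ix where "ix = (\<lambda>b::real^'n. THE i. b = axis i 1)"
  have ix: "ix (axis i 1) = i" for i by (auto simp: ix_def axis_eq_axis)
  define F where "F = (\<lambda>b. f (ix b))"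
  have B: "(Basis::(real^'n) set) = (\<lambda>i. axis i 1) ` UNIV" by (auto simp: Basis_vec_def)
  have inj: "inj (\<lambda>i. axis i (1::real)::real^'n)" by (auto simp: inj_on_def axis_eq_axis)
  have eq: "(\<Prod>b\<in>Basis. F b (x \<bullet> b)) = (\<Prod>i\<in>UNIV. f i (x $ i))" for x :: "real^'n"
    unfolding B by (subst prod.reindex[OF inj]) (simp add: F_def ix inner_axis)
  have L: "(lborel::(real^'n) measure) = distr (\<Pi>\<^sub>M b\<in>Basis. lborel) borel (\<lambda>f. \<Sum>b\<in>Basis. f b *\<^sub>R b)"
    by (rule lborel_eq)
  have c: "(\<Sum>b'\<in>Basis. y b' *\<^sub>R b') \<bullet> b = y b" if "b \<in> Basis" for b :: "real^'n" and y
    using that by (simp add: inner_sum_left inner_Basis if_distrib cong: if_cong)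
  have m[measurable]: "(\<lambda>x::real^'n. \<Prod>b\<in>Basis. F b (x \<bullet> b)) \<in> borel_measurable borel"
    unfolding F_def by measurable
  have iF: "\<And>b. integrable lborel (F b)" using assms by (simp add: F_def)
  have ms[measurable]: "(\<lambda>f. \<Sum>b\<in>Basis. f b *\<^sub>R b) \<in> (\<Pi>\<^sub>M b\<in>(Basis::(real^'n) set). (lborel::real measure)) \<rightarrow>\<^sub>M borel"
    by measurable
  have 1: "integrable (\<Pi>\<^sub>M b\<in>Basis. lborel) (\<lambda>y. \<Prod>b\<in>(Basis::(real^'n) set). F b (y b))"
    by (rule product_integrable_prod) (auto simp: iF)
  have "integrable lborel (\<lambda>x::real^'n. \<Prod>b\<in>Basis. F b (x \<bullet> b))"
    by (subst L, subst integrable_distr_eq) (use 1 in \<open>auto simp: c cong: prod.cong\<close>)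
  then show "integrable lborel (\<lambda>x::real^'n. \<Prod>i\<in>UNIV. f i (x $ i))" by (simp add: eq)
  have "(LINT x|lborel. (\<Prod>b\<in>Basis. F b ((x::real^'n) \<bullet> b))) = (\<Prod>b\<in>(Basis::(real^'n) set). (LINT y|lborel. F b y))"
    by (subst L, subst integral_distr) (use product_integral_prod[of "Basis::(real^'n) set" F] in \<open>auto simp: c iF cong: prod.cong\<close>)
  also have "\<dots> = (\<Prod>i\<in>UNIV. (LINT y|lborel. f i y))"
    unfolding B by (subst prod.reindex[OF inj]) (simp add: F_def ix)
  finally show "(LINT x|lborel. (\<Prod>i\<in>UNIV. f i ((x::real^'n) $ i))) = (\<Prod>i\<in>UNIV. (LINT y|lborel. f i y))"
    by (simp add: eq)
qed

section \<open>Gaussian kernels\<close>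

text \<open>One family for three purposes: the heat symbol at time t is
  \<open>gauss (4 * pi * t)\<close>, small c regularises Fourier inversion, and fixed c gives
  Gaussian majorants.\<close>

definition gauss :: "real \<Rightarrow> real^'n::finite \<Rightarrow> real" where
  "gauss c x = exp (- pi * c * (norm x)\<^sup>2)"

text \<open>The Fourier transform of \<open>gauss r\<close>. In this normalisation the mass is 1 and
  r is additive under convolution; the usual heat kernel at time t is the case r = 4 pi t.\<close>

definition heat_kernel :: "real \<Rightarrow> real^'n::finite \<Rightarrow> real" where
  "heat_kernel r x = r powr (- real CARD('n) / 2) * exp (- pi * (norm x)\<^sup>2 / r)"

lemma gauss_measurable [measurable]: "gauss c \<in> borel_measurable borel"
  unfolding gauss_def by measurable

lemma heat_kernel_measurable [measurable]: "(\<lambda>(r, x). heat_kernel r x) \<in> borel_measurable (borel \<Otimes>\<^sub>M borel)"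
  unfolding heat_kernel_def by measurable

lemma heat_kernel_measurable' [measurable]: "heat_kernel r \<in> borel_measurable borel"
  unfolding heat_kernel_def by measurable

lemma heat_kernel_nonneg [simp]: "0 \<le> heat_kernel r x" by (simp add: heat_kernel_def)

lemma norm_power2_vec: "(norm (x::real^'n::finite))\<^sup>2 = (\<Sum>i\<in>UNIV. (x $ i)\<^sup>2)"
  by (simp add: norm_vec_def L2_set_def real_sqrt_pow2 sum_nonneg)

text \<open>After rescaling the variable, this is the characteristic function of the standard normal
  distribution.\<close>

lemma char_gauss_real:
  fixes c t :: real
  assumes "c > 0"
  shows "integrable lborel (\<lambda>x. of_real (exp (- pi * c * x\<^sup>2)) * exp (- (2 * of_real pi * \<i> * of_real (t * x))))" (is ?I)
    and "(LINT x|lborel. of_real (exp (- pi * c * x\<^sup>2)) * exp (- (2 * of_real pi * \<i> * of_real (t * x))))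
      = of_real (c powr (- 1 / 2) * exp (- pi * t\<^sup>2 / c))" (is ?E)
proof -
  \<comment> \<open>Chosen so that (a x)^2 / 2 = pi c x^2; the frequency \<open>\<tau>\<close> below
    then satisfies \<tau> a x = -2 pi t x.\<close>
  define a where "a = sqrt (2 * pi * c)"
  have a: "a > 0" "a\<^sup>2 = 2 * pi * c" using assms by (auto simp: a_def)
  define \<tau> where "\<tau> = - (2 * pi * t / a)"
  define h where "h = (\<lambda>x::real. iexp (\<tau> * x) * complex_of_real (std_normal_density x))"
  have E: "(LINT x|lborel. h x) = complex_of_real (exp (- \<tau>\<^sup>2 / 2))"
  proof -
    have "char std_normal_distribution \<tau> = (LINT x|lborel. std_normal_density x *\<^sub>R iexp (\<tau> * x))"
      unfolding char_def by (subst integral_density) (auto simp: )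
    then show ?thesis using char_std_normal_distribution by (simp add: h_def scaleR_conv_of_real mult.commute fun_eq_iff)
  qed
  have ih: "integrable lborel h"
    unfolding h_def
    by (rule Bochner_Integration.integrable_bound[OF integrable_std_normal_moment[of 0]])
       (auto simp: norm_mult)
  have h': "h (0 + a * x) * of_real (sqrt (2*pi)) = of_real (exp (- pi * c * x\<^sup>2)) * exp (- (2 * of_real pi * \<i> * of_real (t * x)))" for x
  proof -
    have "\<tau> * (a * x) = - (2 * pi * (t * x))" using a by (simp add: \<tau>_def)
    moreover have "std_normal_density (a * x) * sqrt (2*pi) = exp (- pi * c * x\<^sup>2)"
      using a by (simp add: std_normal_density_def power_mult_distrib real_sqrt_mult field_simps)
    ultimately show ?thesis
      by (simp add: h_def mult.assoc of_real_mult[symmetric] del: of_real_mult) (simp add: mult_ac)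
  qed
  show ?I
    using lborel_integrable_real_affine[OF ih, of a 0] a
    unfolding h'[symmetric] by (intro integrable_mult_left) auto
  have "(LINT x|lborel. h (0 + a * x)) = of_real (exp (- \<tau>\<^sup>2 / 2) / a)"
    using lborel_integral_real_affine[of a h 0] E a by (simp add: scaleR_conv_of_real field_simps)
  then have "(LINT x|lborel. h (0 + a * x) * of_real (sqrt (2*pi))) = of_real (exp (- \<tau>\<^sup>2 / 2) / a) * of_real (sqrt (2*pi))"
    by (metis integral_mult_left_zero)
  moreover have "exp (- \<tau>\<^sup>2 / 2) / a * sqrt (2*pi) = c powr (- 1 / 2) * exp (- pi * t\<^sup>2 / c)"
  proof -
    have "- \<tau>\<^sup>2 / 2 = - pi * t\<^sup>2 / c"
      using a assms by (simp add: \<tau>_def power_divide power_mult_distrib power2_eq_square field_simps)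
    moreover have "sqrt (2*pi) / a = c powr (-1/2)"
      using assms by (simp add: a_def real_sqrt_mult powr_minus powr_half_sqrt field_simps)
    moreover have "exp (- \<tau>\<^sup>2 / 2) / a * sqrt (2*pi) = sqrt (2*pi) / a * exp (- \<tau>\<^sup>2 / 2)" by simp
    ultimately show ?thesis by simp
  qed
  ultimately have "(LINT x|lborel. h (0 + a * x) * of_real (sqrt (2*pi))) = of_real (c powr (- 1 / 2) * exp (- pi * t\<^sup>2 / c))"
    by (simp only: of_real_mult[symmetric])
  then show ?E unfolding h' .
qed

lemma gauss_char_prod:
  "of_real (gauss c x) * exp (- (2 * of_real pi * \<i> * of_real (\<xi> \<bullet> x)))
    = (\<Prod>i\<in>UNIV. of_real (exp (- pi * c * (x $ i)\<^sup>2)) * exp (- (2 * of_real pi * \<i> * of_real (\<xi> $ i * x $ i))))"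
  for x \<xi> :: "real^'n::finite"
proof -
  have "gauss c x = (\<Prod>i\<in>UNIV. exp (- pi * c * (x $ i)\<^sup>2))"
    by (simp add: gauss_def norm_power2_vec exp_sum[symmetric] sum_distrib_left sum_negf)
  moreover have "exp (- (2 * of_real pi * \<i> * of_real (\<xi> \<bullet> x))) = (\<Prod>i\<in>UNIV. exp (- (2 * of_real pi * \<i> * of_real (\<xi> $ i * x $ i))))"
    by (simp add: inner_vec_def exp_sum[symmetric] sum_distrib_left sum_negf)
  ultimately show ?thesis unfolding prod.distrib by (simp only: of_real_prod)
qed

lemma fourier_gauss:
  assumes "c > 0"
  shows "fourier (\<lambda>x::real^'n::finite. of_real (gauss c x)) = (\<lambda>\<xi>. of_real (heat_kernel c \<xi>))"
proof
  fix \<xi> :: "real^'n"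
  have "fourier (\<lambda>x::real^'n::finite. of_real (gauss c x)) \<xi>
    = (\<Prod>i\<in>UNIV. of_real (c powr (- 1 / 2) * exp (- pi * (\<xi> $ i)\<^sup>2 / c)))"
    unfolding fourier_def gauss_char_prod
    by (subst integral_lborel_prod_vec) (intro char_gauss_real assms, simp only: char_gauss_real[OF assms])
  also have "\<dots> = of_real ((\<Prod>i\<in>(UNIV::'n set). c powr (- 1 / 2)) * (\<Prod>i\<in>UNIV. exp (- pi * (\<xi> $ i)\<^sup>2 / c)))"
    by (simp add: prod.distrib)
  also have "(\<Prod>i\<in>(UNIV::'n set). c powr (- 1 / 2)) = c powr (- real CARD('n) / 2)"
    using assms by (simp add: powr_power)
  also have "(\<Prod>i\<in>UNIV. exp (- pi * (\<xi> $ i)\<^sup>2 / c)) = exp (- pi * (norm \<xi>)\<^sup>2 / c)"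
    by (simp add: exp_sum[symmetric] norm_power2_vec sum_distrib_left sum_negf sum_divide_distrib)
  finally show "fourier (\<lambda>x::real^'n::finite. of_real (gauss c x)) \<xi> = of_real (heat_kernel c \<xi>)"
    by (simp add: heat_kernel_def)
qed

lemma gauss_integrable:
  assumes "c > 0"
  shows "integrable lborel (gauss c :: real^'n::finite \<Rightarrow> real)"
    and "(LINT x|lborel. gauss c (x::real^'n::finite)) = c powr (- real CARD('n) / 2)"
proof -
  have "integrable lborel (\<lambda>x::real^'n. complex_of_real (gauss c x) * exp (- (2 * of_real pi * \<i> * of_real ((0::real^'n) \<bullet> x))))"
    unfolding gauss_char_prod by (intro integrable_lborel_prod_vec char_gauss_real assms)
  then show "integrable lborel (gauss c :: real^'n \<Rightarrow> real)" by (simp add: complex_of_real_integrable_eq)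
  have "complex_of_real (LINT x|lborel. gauss c (x::real^'n)) = fourier (\<lambda>x::real^'n. of_real (gauss c x)) 0"
    unfolding fourier_def by simp
  also have "\<dots> = complex_of_real (c powr (- real CARD('n) / 2))"
    unfolding fourier_gauss[OF assms] by (simp add: heat_kernel_def)
  finally show "(LINT x|lborel. gauss c (x::real^'n)) = c powr (- real CARD('n) / 2)"
    by (simp only: of_real_eq_iff)
qed

lemma heat_kernel_gauss: "heat_kernel r x = r powr (- real CARD('n) / 2) * gauss (1 / r) x" for x :: "real^'n::finite"
  by (simp add: heat_kernel_def gauss_def)

lemma heat_kernel_integrable:
  assumes "r > 0"
  shows "integrable lborel (heat_kernel r :: real^'n::finite \<Rightarrow> real)"
    and "(LINT x|lborel. heat_kernel r (x::real^'n::finite)) = 1"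
proof -
  have "r powr (- real CARD('n) / 2) * (1 / r) powr (- real CARD('n) / 2) = 1"
    using assms by (simp add: powr_mult[symmetric])
  then show "integrable lborel (heat_kernel r :: real^'n \<Rightarrow> real)" "(LINT x|lborel. heat_kernel r (x::real^'n)) = 1"
    using gauss_integrable[of "1/r", where 'n='n] assms by (simp_all add: heat_kernel_gauss[abs_def])
qed

lemma nn_integral_heat_kernel: "r > 0 \<Longrightarrow> (\<integral>\<^sup>+x. ennreal (heat_kernel r (x::real^'n::finite)) \<partial>lborel) = 1"
  using heat_kernel_integrable[of r, where 'n='n] by (subst nn_integral_eq_integral) auto

text \<open>Completing the square in y: the product is again Gaussian in y, centred at (t / (s + t))
  x, and the constant term left over is a Gaussian in x with parameter s + t.\<close>

lemma heat_kernel_mult: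
  fixes x y :: "real^'n::finite"
  assumes "s > 0" "t > 0"
  shows "heat_kernel s (x - y) * heat_kernel t y = heat_kernel (s + t) x * heat_kernel (s * t / (s + t)) (y - (t / (s + t)) *\<^sub>R x)"
proof -
  define u where "u = s + t"
  have u: "u > 0" "u = s + t" using assms by (auto simp: u_def)
  have "(norm (x - y))\<^sup>2 / s + (norm y)\<^sup>2 / t = (norm x)\<^sup>2 / u + (norm (y - (t / u) *\<^sub>R x))\<^sup>2 / (s * t / u)"
  proof -
    define A B C where "A = x \<bullet> x" and "B = x \<bullet> y" and "C = y \<bullet> y"
    have alg: "(A - 2 * B + C) / s + C / t = A / u + (C - 2 * (t / u) * B + (t / u)\<^sup>2 * A) / (s * t / u)"
    proof -
      have "u \<noteq> 0" "t \<noteq> 0" "s \<noteq> 0" using assms u by auto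
      then have "A / u + (C - 2 * (t / u) * B + (t / u)\<^sup>2 * A) / (s * t / u) = (A * s * t + C * u * u - 2 * t * u * B + t * t * A) / (s * t * u)"
        by (simp add: field_simps power2_eq_square)
      also have "A * s * t + C * u * u - 2 * t * u * B + t * t * A = ((A - 2 * B + C) * t + C * s) * u"
        by (simp add: u(2) algebra_simps)
      also have "((A - 2 * B + C) * t + C * s) * u / (s * t * u) = (A - 2 * B + C) / s + C / t"
        using \<open>u \<noteq> 0\<close> \<open>t \<noteq> 0\<close> \<open>s \<noteq> 0\<close> by (simp add: field_simps)
      finally show ?thesis by simp
    qed
    have eqs: "(norm (x - y))\<^sup>2 = A - 2 * B + C" "(norm y)\<^sup>2 = C" "(norm x)\<^sup>2 = A"
      "(norm (y - (t / u) *\<^sub>R x))\<^sup>2 = C - 2 * (t / u) * B + (t / u)\<^sup>2 * A"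
      by (simp_all only: A_def B_def C_def power2_norm_eq_inner inner_diff_left inner_diff_right inner_scaleR_left
            inner_scaleR_right) (simp_all add: inner_commute power2_eq_square algebra_simps)
    show ?thesis unfolding eqs by (rule alg)
  qed
  then have "exp (- pi * (norm (x - y))\<^sup>2 / s) * exp (- pi * (norm y)\<^sup>2 / t)
      = exp (- pi * (norm x)\<^sup>2 / u) * exp (- pi * (norm (y - (t / u) *\<^sub>R x))\<^sup>2 / (s * t / u))"
    unfolding exp_add[symmetric] by (simp only: times_divide_eq_right[symmetric] distrib_left[symmetric])
  moreover have "s powr p * t powr p = u powr p * (s * t / u) powr p" for p
    using assms u(1) by (simp add: powr_divide powr_mult)
  ultimately show ?thesis unfolding heat_kernel_def u_def[symmetric] by (simp add: mult_ac)
qed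

lemma heat_kernel_semigroup:
  fixes x :: "real^'n::finite"
  assumes "s > 0" "t > 0"
  shows "(\<integral>\<^sup>+y. ennreal (heat_kernel s (x - y) * heat_kernel t y) \<partial>lborel) = ennreal (heat_kernel (s + t) x)"
proof -
  have "(\<integral>\<^sup>+y. ennreal (heat_kernel s (x - y) * heat_kernel t y) \<partial>lborel)
    = ennreal (heat_kernel (s + t) x) * (\<integral>\<^sup>+y. ennreal (heat_kernel (s * t / (s + t)) (y + (- (t / (s + t)) *\<^sub>R x))) \<partial>lborel)"
    using assms by (subst nn_integral_cmult[symmetric]) (auto simp: heat_kernel_mult ennreal_mult)
  also have "\<dots> = ennreal (heat_kernel (s + t) x)"
    using assms by (subst nn_integral_lborel_shift) (auto simp: nn_integral_heat_kernel)
  finally show ?thesis .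
qed

section \<open>Riesz potentials\<close>

lemma nu_pos: "\<theta> > 0 \<Longrightarrow> nu \<theta> > 0"
  by (simp add: nu_def Gamma_real_pos)

lemma nu_2: "nu 2 = 1 / pi"
  by (simp add: nu_def powr_minus field_simps)

text \<open>The functional equation of the Gamma function. At \<theta> = n - k and \<theta> = k - 2
  it removes all values of \<open>nu\<close> except \<open>nu (n - 2)\<close> from the constant of
  the estimate.\<close>

lemma nu_plus_2: "\<theta> > 0 \<Longrightarrow> nu (\<theta> + 2) = nu \<theta> * \<theta> / (2 * pi)"
proof -
  assume t: "\<theta> > 0"
  have "Gamma ((\<theta> + 2) / 2) = \<theta> / 2 * Gamma (\<theta> / 2)"
    using Gamma_plus1[of "\<theta>/2"] t by (auto simp: add_divide_distrib nonpos_Ints_def)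
  moreover have "pi powr (- (\<theta> + 2) / 2) = pi powr (- \<theta> / 2) / pi"
    by (simp add: add_divide_distrib diff_divide_distrib powr_diff)
  ultimately show ?thesis unfolding nu_def by (simp only:) (simp add: mult_ac)
qed

text \<open>The substitution t = c / r turns the Gamma integral into this one.\<close>

lemma nn_integral_inverse_gamma:
  assumes b: "b > 0" and c: "c > 0"
  shows "(\<integral>\<^sup>+r. ennreal (indicator {0<..} r * (r powr (- b - 1) * exp (- c / r))) \<partial>lborel)
    = ennreal (Gamma b * c powr (- b))"
proof -
  define f where "f = (\<lambda>t::real. t powr (b - 1) / exp t)"
  have "(f has_integral Gamma b) {0<..}"
    using Gamma_integral_real[OF b] unfolding f_def
    by (subst has_integral_spike_set_eq[where T="{0..}"]) (auto intro: negligible_subset[of "{0}"])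
  then have f: "f absolutely_integrable_on {0<..}" "integral {0<..} f = Gamma b"
    by (auto intro!: nonnegative_absolutely_integrable_1 simp: f_def integrable_on_def integral_unique)
  have img: "(\<lambda>r. c / r) ` {0<..} = {0<..}"
  proof -
    have "x \<in> (\<lambda>r. c / r) ` {0<..}" if "x > 0" for x
      using that c by (intro image_eqI[of _ _ "c / x"]) auto
    then show ?thesis using c by auto
  qed
  have "(\<lambda>r. \<bar>- c / r\<^sup>2\<bar> * f (c / r)) absolutely_integrable_on {0<..} \<and>
      integral {0<..} (\<lambda>r. \<bar>- c / r\<^sup>2\<bar> * f (c / r)) = Gamma b"
  proof (subst has_absolute_integral_change_of_variables_1'[where g="\<lambda>r. c / r"])
    show "((\<lambda>r. c / r) has_field_derivative - c / x\<^sup>2) (at x within {0<..})" if "x \<in> {0<..}" for x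
      using that by (auto intro!: derivative_eq_intros simp: power2_eq_square)
    show "inj_on (\<lambda>r. c / r) {0<..}" using c by (auto simp: inj_on_def field_simps)
  qed (use f img in auto)
  then have hi: "((\<lambda>r. \<bar>- c / r\<^sup>2\<bar> * f (c / r)) has_integral Gamma b) {0<..}"
    by (auto simp: has_integral_iff intro: set_lebesgue_integral_eq_integral(1))
  have "(\<integral>\<^sup>+r. ennreal (indicator {0<..} r * (\<bar>- c / r\<^sup>2\<bar> * f (c / r))) \<partial>lborel) = ennreal (Gamma b)"
    by (rule nn_integral_has_integral_lebesgue[OF _ hi]) (auto simp: f_def)
  moreover have "indicator {0<..} r * (\<bar>- c / r\<^sup>2\<bar> * f (c / r))
      = c powr b * (indicator {0<..} r * (r powr (- b - 1) * exp (- c / r)))" for r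
  proof (cases "r > 0")
    case True
    have "c / r\<^sup>2 * (c / r) powr (b - 1) = (c * c powr (b - 1)) * ((1 / r\<^sup>2) * (1 / r powr (b - 1)))"
      using c True by (simp add: powr_divide)
    also have "c * c powr (b - 1) = c powr b"
      using c by (simp add: powr_mult_base)
    also have "(1 / r\<^sup>2) * (1 / r powr (b - 1)) = r powr (- 2) * r powr (- (b - 1))"
      using True powr_minus_divide[of r "b - 1"] powr_minus_divide[of r 2] by simp
    also have "\<dots> = r powr (- b - 1)" unfolding powr_add[symmetric] by (rule arg_cong[where f="(powr) r"]) simp
    finally show ?thesis using True c by (simp add: f_def exp_minus divide_inverse mult_ac)
  qed auto
  ultimately have *: "(\<integral>\<^sup>+r. ennreal (c powr b * (indicator {0<..} r * (r powr (- b - 1) * exp (- c / r)))) \<partial>lborel) = ennreal (Gamma b)"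
    by (simp only:)
  \<comment> \<open>The factor \<open>c powr b\<close> is removed by multiplying with
    \<open>c powr (- b)\<close>; both are finite, so their product is 1 also in the extended
    nonnegative reals.\<close>
  define J where "J = (\<integral>\<^sup>+r. ennreal (indicator {0<..} r * (r powr (- b - 1) * exp (- c / r))) \<partial>lborel)"
  have "ennreal (c powr b) * J = ennreal (Gamma b)"
    unfolding J_def *[symmetric] by (subst nn_integral_cmult[symmetric]) (auto simp: ennreal_mult')
  then have "ennreal (c powr (-b)) * ennreal (c powr b) * J = ennreal (c powr (-b)) * ennreal (Gamma b)"
    by (simp only: mult.assoc)
  moreover have "ennreal (c powr (-b)) * ennreal (c powr b) = 1"
    using c by (simp add: ennreal_mult'[symmetric] powr_add[symmetric])
  ultimately have "J = ennreal (c powr (-b)) * ennreal (Gamma b)" by simp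
  then show ?thesis using b by (simp add: J_def ennreal_mult'[symmetric] mult.commute)
qed

text \<open>The weight is chosen so that, together with the factor r^(-n/2) of the kernel, the power
  r^(-a/2 - 1) remains. The inverse Gamma integral with b = a/2 and c = pi |x|^2 then applies, and
  Gamma(a/2) pi^(-a/2) is exactly \<open>nu a\<close>.\<close>

lemma riesz_heat_kernel:
  fixes x :: "real^'n::finite"
  assumes "a > 0" "x \<noteq> 0"
  shows "(\<integral>\<^sup>+r. ennreal (indicator {0<..} r * r powr ((real CARD('n) - a) / 2 - 1) * heat_kernel r x) \<partial>lborel)
    = ennreal (nu a * norm x powr (- a))"
proof -
  have "indicator {0<..} r * r powr ((real CARD('n) - a) / 2 - 1) * heat_kernel r x
      = indicator {0<..} r * (r powr (- (a/2) - 1) * exp (- (pi * (norm x)\<^sup>2) / r))" for r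
  proof -
    have "(real CARD('n) - a) / 2 - 1 + (- real CARD('n) / 2) = - (a/2) - 1" by (simp add: field_simps)
    then have "r powr ((real CARD('n) - a) / 2 - 1) * r powr (- real CARD('n) / 2) = r powr (- (a/2) - 1)"
      by (simp only: powr_add[symmetric])
    then show ?thesis by (simp add: heat_kernel_def indicator_def)
  qed
  then have "(\<integral>\<^sup>+r. ennreal (indicator {0<..} r * r powr ((real CARD('n) - a) / 2 - 1) * heat_kernel r x) \<partial>lborel)
      = ennreal (Gamma (a/2) * (pi * (norm x)\<^sup>2) powr (- (a/2)))"
    using assms by (simp only:) (rule nn_integral_inverse_gamma, auto)
  also have "Gamma (a/2) * (pi * (norm x)\<^sup>2) powr (- (a/2)) = nu a * norm x powr (- a)"
  proof -
    have "((norm x)\<^sup>2) powr (- (a/2)) = (norm x powr 2) powr (- (a/2))"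
      using assms by simp
    also have "\<dots> = norm x powr (- a)" unfolding powr_powr by simp
    finally show ?thesis using assms by (simp add: nu_def powr_mult)
  qed
  finally show ?thesis .
qed

text \<open>The form in which the heat kernel computation delivers the constant: 2 / (n - k) is the
  value of a Beta integral, and each \<open>nu\<close> normalises one Riesz kernel.\<close>

lemma K_const_eq:
  assumes "2 < k" "k < n"
  shows "K_const 2 (n - k) n = 2 / (n - k) * nu (k - 2) / (nu (n - 2) * nu k)"
proof -
  have "nu (n - k) > 0" "nu (k - 2) > 0" "nu (n - 2) > 0" "nu k > 0" using assms by (auto intro!: nu_pos)
  moreover have "nu (2 + (n - k)) = nu (n - k) * (n - k) / (2 * pi)"
    using nu_plus_2[of "n - k"] assms by (simp add: add.commute)
  moreover have "n - 2 - (n - k) = k - 2" "n - (n - k) = k" by auto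
  ultimately show ?thesis using assms unfolding K_const_def nu_2 by (simp only:) (simp add: divide_simps)
qed

text \<open>An elementary Beta integral: t is the share of the total parameter r carried by the
  second heat kernel, and the first share r - t enters with exponent zero.\<close>

lemma nn_integral_powr_0:
  assumes "\<beta> > 0"
  shows "(\<integral>\<^sup>+t. ennreal (indicator {0<..} t * indicator {0<..} (r - t) * t powr (\<beta> - 1)) \<partial>lborel)
     = ennreal (indicator {0<..} r * (r powr \<beta> / \<beta>))"
proof (cases "r > 0")
  case True
  have "((\<lambda>t. t powr (\<beta> - 1)) has_integral (r powr \<beta> / \<beta>)) {0..r}"
    using has_integral_powr_from_0[of "\<beta> - 1" r] assms True by simp
  then have "(\<integral>\<^sup>+t. ennreal (indicator {0..r} t * t powr (\<beta> - 1)) \<partial>lborel) = ennreal (r powr \<beta> / \<beta>)"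
    by (intro nn_integral_has_integral_lebesgue) auto
  moreover have "(\<integral>\<^sup>+t. ennreal (indicator {0<..} t * indicator {0<..} (r - t) * t powr (\<beta> - 1)) \<partial>lborel)
     = (\<integral>\<^sup>+t. ennreal (indicator {0..r} t * t powr (\<beta> - 1)) \<partial>lborel)"
    using AE_lborel_singleton[of 0] AE_lborel_singleton[of r]
    by (intro nn_integral_cong_AE, eventually_elim) (auto simp: indicator_def)
  ultimately show ?thesis using True by simp
next
  case False
  then have "indicator {0<..} t * indicator {0<..} (r - t) * t powr (\<beta> - 1) = 0" for t :: real
    by (auto simp: indicator_def)
  then show ?thesis using False by (simp only:) simp
qed

text \<open>Expanding both powers into heat kernels leaves, by the semigroup law, one kernel with
  parameter r = s + t. The integral over the splitting of r multiplies it by r^\<beta> / \<beta>,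
  which is the weight of the Riesz kernel with exponent k - 2. All integrands are nonnegative, so
  every exchange is Tonelli and finiteness is part of the result.\<close>

lemma riesz_convolution:
  fixes x :: "real^'n::finite"
  assumes n: "n = real CARD('n)" and k: "2 < k" "k < n" and x: "x \<noteq> 0"
  shows "(\<integral>\<^sup>+y. ennreal (norm (x - y) powr (- (n - 2)) * norm y powr (- k)) \<partial>lborel)
     = ennreal (K_const 2 (n - k) n * norm x powr (- (k - 2)))"
proof -
  \<comment> \<open>\<open>t powr (\<beta> - 1)\<close> is the weight that represents
    |y|^(-k).\<close>
  define \<beta> where "\<beta> = (n - k) / 2"
  have \<beta>: "\<beta> > 0" using k by (simp add: \<beta>_def)
  have pos: "nu (n - 2) > 0" "nu k > 0" "nu (k - 2) > 0" using k by (auto intro!: nu_pos)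
  \<comment> \<open>No power of s is present: the weight for the exponent n - 2 is s^((n - (n -
    2))/2 - 1) = 1. This is why the Beta integral below is elementary.\<close>
  define F where "F = (\<lambda>s (z::real^'n). indicator {0<..} s * heat_kernel s z :: real)"
  define G where "G = (\<lambda>t (z::real^'n). indicator {0<..} t * t powr (\<beta> - 1) * heat_kernel t z :: real)"
  have [measurable]: "(\<lambda>(s, z). F s z) \<in> borel_measurable (borel \<Otimes>\<^sub>M borel)"
     "(\<lambda>(s, z). G s z) \<in> borel_measurable (borel \<Otimes>\<^sub>M borel)" unfolding F_def G_def by measurable
  have [simp]: "F s z \<ge> 0" "G s z \<ge> 0" for s z by (auto simp: F_def G_def)
  have F: "(\<integral>\<^sup>+s. F s z \<partial>lborel) = ennreal (nu (n - 2) * norm z powr (- (n - 2)))" if "z \<noteq> 0" for z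
  proof -
    have "F s z = indicator {0<..} s * s powr ((real CARD('n) - (n - 2)) / 2 - 1) * heat_kernel s z" for s
      by (simp add: F_def n indicator_def)
    moreover have "0 < n - 2" using k by simp
    ultimately show ?thesis using riesz_heat_kernel[of "n - 2" z] that by (simp only:) simp
  qed
  have G: "(\<integral>\<^sup>+t. G t z \<partial>lborel) = ennreal (nu k * norm z powr (- k))" if "z \<noteq> 0" for z
  proof -
    have "0 < k" using k by simp
    from riesz_heat_kernel[OF this that] show ?thesis unfolding G_def \<beta>_def n .
  qed
  have "ennreal (nu (n - 2) * nu k) * (\<integral>\<^sup>+y. ennreal (norm (x - y) powr (- (n - 2)) * norm y powr (- k)) \<partial>lborel)
     = (\<integral>\<^sup>+y. ennreal (nu (n - 2) * nu k) * ennreal (norm (x - y) powr (- (n - 2)) * norm y powr (- k)) \<partial>lborel)"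
    by (rule nn_integral_cmult[symmetric]) measurable
  also have "\<dots> = (\<integral>\<^sup>+y. (\<integral>\<^sup>+t. (\<integral>\<^sup>+s. ennreal (F s (x - y)) * ennreal (G t y) \<partial>lborel) \<partial>lborel) \<partial>lborel)"
    using AE_lborel_singleton[of "0::real^'n"] AE_lborel_singleton[of x]
  proof (intro nn_integral_cong_AE, eventually_elim)
    fix y :: "real^'n" assume "y \<noteq> 0" "y \<noteq> x"
    have "(\<integral>\<^sup>+t. (\<integral>\<^sup>+s. ennreal (F s (x - y)) * ennreal (G t y) \<partial>lborel) \<partial>lborel) =
       (\<integral>\<^sup>+s. ennreal (F s (x - y)) \<partial>lborel) * (\<integral>\<^sup>+t. ennreal (G t y) \<partial>lborel)"
      by (simp add: nn_integral_multc nn_integral_cmult)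
    also have "\<dots> = ennreal (nu (n - 2) * norm (x - y) powr (- (n - 2))) * ennreal (nu k * norm y powr (- k))"
      using \<open>y \<noteq> 0\<close> \<open>y \<noteq> x\<close> by (subst F, simp, subst G, simp_all)
    finally show "ennreal (nu (n - 2) * nu k) * ennreal (norm (x - y) powr (- (n - 2)) * norm y powr (- k))
       = (\<integral>\<^sup>+t. (\<integral>\<^sup>+s. ennreal (F s (x - y)) * ennreal (G t y) \<partial>lborel) \<partial>lborel)"
      using pos by (simp add: ennreal_mult'[symmetric] mult_ac)
  qed
  also have "\<dots> = (\<integral>\<^sup>+t. (\<integral>\<^sup>+y. (\<integral>\<^sup>+s. ennreal (F s (x - y)) * ennreal (G t y) \<partial>lborel) \<partial>lborel) \<partial>lborel)"
    by (rule lborel_pair.Fubini') measurable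
  also have "\<dots> = (\<integral>\<^sup>+t. (\<integral>\<^sup>+s. (\<integral>\<^sup>+y. ennreal (F s (x - y)) * ennreal (G t y) \<partial>lborel) \<partial>lborel) \<partial>lborel)"
    by (intro nn_integral_cong lborel_pair.Fubini') measurable
  also have "\<dots> = (\<integral>\<^sup>+t. (\<integral>\<^sup>+s. ennreal (indicator {0<..} t * indicator {0<..} s * t powr (\<beta> - 1) * heat_kernel (s + t) x) \<partial>lborel) \<partial>lborel)"
  proof (intro nn_integral_cong)
    fix s t :: real
    show "(\<integral>\<^sup>+y. ennreal (F s (x - y)) * ennreal (G t y) \<partial>lborel)
        = ennreal (indicator {0<..} t * indicator {0<..} s * t powr (\<beta> - 1) * heat_kernel (s + t) x)"
    proof (cases "s > 0 \<and> t > 0")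
      case True
      have "(\<integral>\<^sup>+y. ennreal (F s (x - y)) * ennreal (G t y) \<partial>lborel)
        = (\<integral>\<^sup>+y. ennreal (t powr (\<beta> - 1)) * ennreal (heat_kernel s (x - y) * heat_kernel t y) \<partial>lborel)"
        using True by (intro nn_integral_cong) (simp add: F_def G_def ennreal_mult'[symmetric] mult_ac)
      also have "\<dots> = ennreal (t powr (\<beta> - 1)) * ennreal (heat_kernel (s + t) x)"
        using True by (subst nn_integral_cmult) (auto simp: heat_kernel_semigroup)
      finally show ?thesis using True by (simp add: ennreal_mult')
    next
      case False
      then show ?thesis by (auto simp: F_def G_def)
    qed
  qed
  \<comment> \<open>Substitution r = s + t in the inner integral; the condition s > 0 becomes r - t
    > 0.\<close>
  also have "\<dots> = (\<integral>\<^sup>+t. (\<integral>\<^sup>+r. ennreal (indicator {0<..} t * indicator {0<..} (r - t) * t powr (\<beta> - 1) * heat_kernel r x) \<partial>lborel) \<partial>lborel)"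
  proof (rule nn_integral_cong)
    fix t :: real
    show "(\<integral>\<^sup>+s. ennreal (indicator {0<..} t * indicator {0<..} s * t powr (\<beta> - 1) * heat_kernel (s + t) x) \<partial>lborel)
        = (\<integral>\<^sup>+r. ennreal (indicator {0<..} t * indicator {0<..} (r - t) * t powr (\<beta> - 1) * heat_kernel r x) \<partial>lborel)"
      by (subst (2) nn_integral_lborel_shift[where t=t, symmetric])
         (auto intro!: nn_integral_cong simp: indicator_def)
  qed
  also have "\<dots> = (\<integral>\<^sup>+r. (\<integral>\<^sup>+t. ennreal (indicator {0<..} t * indicator {0<..} (r - t) * t powr (\<beta> - 1) * heat_kernel r x) \<partial>lborel) \<partial>lborel)"
    by (rule lborel_pair.Fubini') measurable
  also have "\<dots> = (\<integral>\<^sup>+r. ennreal (1 / \<beta>) * ennreal (indicator {0<..} r * r powr ((real CARD('n) - (k - 2)) / 2 - 1) * heat_kernel r x) \<partial>lborel)"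
  proof (intro nn_integral_cong)
    fix r :: real
    have "(\<integral>\<^sup>+t. ennreal (indicator {0<..} t * indicator {0<..} (r - t) * t powr (\<beta> - 1) * heat_kernel r x) \<partial>lborel)
      = ennreal (indicator {0<..} r * (r powr \<beta> / \<beta>)) * ennreal (heat_kernel r x)"
      by (subst nn_integral_powr_0[OF \<beta>, symmetric], subst nn_integral_multc[symmetric]) (auto simp: ennreal_mult'')
    moreover have "(real CARD('n) - (k - 2)) / 2 - 1 = \<beta>" by (simp add: \<beta>_def n field_simps)
    ultimately show "(\<integral>\<^sup>+t. ennreal (indicator {0<..} t * indicator {0<..} (r - t) * t powr (\<beta> - 1) * heat_kernel r x) \<partial>lborel) =
       ennreal (1 / \<beta>) * ennreal (indicator {0<..} r * r powr ((real CARD('n) - (k - 2)) / 2 - 1) * heat_kernel r x)"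
      using \<beta> by (simp add: ennreal_mult''[symmetric] mult_ac)
  qed
  also have "\<dots> = ennreal (1 / \<beta>) * ennreal (nu (k - 2) * norm x powr (- (k - 2)))"
    using k x by (subst nn_integral_cmult, measurable) (subst riesz_heat_kernel, auto)
  finally have *: "ennreal (nu (n - 2) * nu k) * (\<integral>\<^sup>+y. ennreal (norm (x - y) powr (- (n - 2)) * norm y powr (- k)) \<partial>lborel)
    = ennreal (nu (n - 2) * nu k) * ennreal (K_const 2 (n - k) n * norm x powr (- (k - 2)))"
    using pos \<beta> k by (simp add: ennreal_mult'[symmetric] K_const_eq) (simp add: \<beta>_def)
  \<comment> \<open>Cancellation in the extended nonnegative reals requires the common factor to be
    neither 0 nor infinite.\<close>
  have "ennreal (nu (n - 2) * nu k) \<noteq> 0" "ennreal (nu (n - 2) * nu k) \<noteq> top" using pos by auto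
  then show ?thesis
    using * by (auto simp only: ennreal_mult_cancel_left)
qed

section \<open>Integrability of powers\<close>

text \<open>Read off from the Riesz convolution evaluated at a unit vector x, which is finite: for
  |y| \<le> 1 one has |x - y| \<le> 2, so the factor |x - y|^(-(n-2)) is bounded below. No polar
  coordinates are involved.\<close>

lemma integrable_powr_unit_ball:
  assumes "0 \<le> a" "a < real CARD('n)" "CARD('n) \<ge> 3"
  shows "integrable lborel (\<lambda>y::real^'n::finite. indicator (cball 0 1) y * norm y powr (- a))"
proof -
  define n where "n = real CARD('n)"
  \<comment> \<open>The midpoint lies strictly between 2 and n, as the Riesz convolution demands,
    and is at least a.\<close>
  define k where "k = (max a 2 + n) / 2"
  have k: "2 < k" "k < n" "a \<le> k" using assms by (auto simp: k_def n_def)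
  \<comment> \<open>Merely picks a coordinate, to have some unit vector.\<close>
  obtain i :: 'n where True by auto
  define x where "x = (axis i 1 :: real^'n)"
  have x: "norm x = 1" "x \<noteq> 0" by (auto simp: x_def)
  have "(\<integral>\<^sup>+y. ennreal (indicator (cball 0 1) y * norm (y::real^'n) powr (- a)) \<partial>lborel)
     \<le> (\<integral>\<^sup>+y. ennreal (2 powr (n - 2)) * ennreal (norm (x - y) powr (- (n - 2)) * norm y powr (- k)) \<partial>lborel)"
    using AE_lborel_singleton[of "0::real^'n"] AE_lborel_singleton[of x]
  proof (intro nn_integral_mono_AE, eventually_elim)
    fix y :: "real^'n" assume y: "y \<noteq> 0" "y \<noteq> x"
    show "ennreal (indicator (cball 0 1) y * norm y powr (- a))
       \<le> ennreal (2 powr (n - 2)) * ennreal (norm (x - y) powr (- (n - 2)) * norm y powr (- k))"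
    proof (cases "norm y \<le> 1")
      case True
      have "norm (x - y) \<le> 2" using norm_triangle_ineq4[of x y] x True by simp
      then have "2 powr (- (n - 2)) \<le> norm (x - y) powr (- (n - 2))"
        using y k by (intro powr_mono2') auto
      then have "2 powr (n - 2) * 2 powr (- (n - 2)) \<le> 2 powr (n - 2) * norm (x - y) powr (- (n - 2))"
        by (intro mult_left_mono) auto
      moreover have "2 powr (n - 2) * 2 powr (- (n - 2)) = (1::real)"
        unfolding powr_add[symmetric] by simp
      ultimately have 1: "1 \<le> 2 powr (n - 2) * norm (x - y) powr (- (n - 2))" by metis
      have 2: "norm y powr (- a) \<le> norm y powr (- k)"
        using y True k by (intro powr_mono') auto
      have "1 * norm y powr (- a) \<le> (2 powr (n - 2) * norm (x - y) powr (- (n - 2))) * norm y powr (- k)"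
        by (rule mult_mono[OF 1 2]) auto
      then show ?thesis using True by (simp add: ennreal_mult'[symmetric] mult.assoc indicator_def)
    qed (auto simp: indicator_def)
  qed
  also have "\<dots> = ennreal (2 powr (n - 2)) * ennreal (K_const 2 (n - k) n * norm x powr (- (k - 2)))"
    by (subst nn_integral_cmult, measurable) (use riesz_convolution[OF n_def k(1,2) x(2)] in simp)
  also have "\<dots> < \<infinity>" by (simp add: ennreal_mult_less_top)
  finally have fin: "(\<integral>\<^sup>+y. ennreal (indicator (cball 0 1) y * norm (y::real^'n) powr (- a)) \<partial>lborel) < \<infinity>" .
  have [measurable]: "cball (0::real^'n) 1 \<in> sets borel" by simp
  show ?thesis
    by (rule integrableI_bounded, measurable) (use fin in simp)
qed

text \<open>(1 + |x|)^(2n) dominates the product of the n factors 1 + x_i^2, whose reciprocals are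
  integrable on the line.\<close>

lemma integrable_inverse_power_norm:
  assumes "N \<ge> 2 * CARD('n)"
  shows "integrable lborel (\<lambda>x::real^'n::finite. 1 / (1 + norm x) ^ N)"
proof -
  have "integrable lborel (\<lambda>y::real. inverse (1 + y\<^sup>2))"
    using integrable_inverse_1_plus_square by (simp add: set_integrable_def einterval_def)
  then have i: "integrable lborel (\<lambda>x::real^'n. \<Prod>i\<in>UNIV. inverse (1 + (x $ i)\<^sup>2))"
    by (intro integrable_lborel_prod_vec)
  show ?thesis
  proof (rule Bochner_Integration.integrable_bound[OF i], measurable, intro AE_I2)
    fix x :: "real^'n"
    have "(\<Prod>i\<in>(UNIV::'n set). 1 + (x $ i)\<^sup>2) \<le> (\<Prod>i\<in>(UNIV::'n set). (1 + norm x)\<^sup>2)"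
    proof (intro prod_mono conjI)
      fix i
      have "(x $ i)\<^sup>2 \<le> (norm x)\<^sup>2" using component_le_norm_cart[of x i] by (metis abs_ge_zero power2_abs power_mono)
      then show "1 + (x $ i)\<^sup>2 \<le> (1 + norm x)\<^sup>2" by (simp add: power2_sum) (use norm_ge_zero[of x] in linarith)
    qed simp
    also have "\<dots> = (1 + norm x) ^ (2 * CARD('n))" by (simp add: power_mult)
    also have "\<dots> \<le> (1 + norm x) ^ N" using assms by (intro power_increasing) auto
    finally have "inverse ((1 + norm x) ^ N) \<le> inverse (\<Prod>i\<in>(UNIV::'n set). 1 + (x $ i)\<^sup>2)"
      by (intro le_imp_inverse_le prod_pos) (auto simp: add_pos_nonneg)
    then show "norm (1 / (1 + norm x) ^ N) \<le> norm (\<Prod>i\<in>UNIV. inverse (1 + (x $ i)\<^sup>2))"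
      by (simp add: prod_inversef[symmetric] divide_inverse o_def abs_prod prod_nonneg)
  qed
qed

lemma integrable_powr_inverse_power:
  assumes "0 \<le> a" "a < real CARD('n)" "CARD('n) \<ge> 3" "N \<ge> 2 * CARD('n)"
  shows "integrable lborel (\<lambda>x::real^'n::finite. norm x powr (- a) / (1 + norm x) ^ N)"
proof (rule Bochner_Integration.integrable_bound)
  show "integrable lborel (\<lambda>x::real^'n. indicator (cball 0 1) x * norm x powr (- a) + 1 / (1 + norm x) ^ N)"
    by (intro Bochner_Integration.integrable_add integrable_powr_unit_ball integrable_inverse_power_norm assms)
  have "norm x powr (- a) / (1 + norm x) ^ N \<le> indicator (cball 0 1) x * norm x powr (- a) + 1 / (1 + norm x) ^ N"
    for x :: "real^'n"
  proof (cases "norm x \<le> 1")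
    case True
    have "norm x powr (- a) / (1 + norm x) ^ N \<le> norm x powr (- a) / 1"
      by (intro divide_left_mono) (auto intro!: add_pos_nonneg zero_less_power)
    then show ?thesis using True by (simp add: add_increasing2)
  next
    case False
    then have "norm x powr (- a) \<le> 1" using assms by (simp add: powr_minus inverse_le_1_iff ge_one_powr_ge_zero)
    then show ?thesis using False by (simp add: divide_right_mono)
  qed
  then show "AE x in lborel. norm (norm x powr (- a) / (1 + norm x) ^ N)
      \<le> norm (indicator (cball 0 1) x * norm x powr (- a) + 1 / (1 + norm (x::real^'n)) ^ N)"
    by (intro AE_I2) (simp add: abs_of_nonneg)
qed measurable

section \<open>Schwartz functions and multipliers\<close>

lemma partials_Nil [simp]: "partials [] f = f"
  by (simp add: partials_def)

lemma partials_Cons [simp]: "partials (i # \<alpha>) f = partial i (partials \<alpha> f)"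
  by (simp add: partials_def)

lemma partials_snoc: "partials (\<alpha> @ [i]) f = partials \<alpha> (partial i f)"
  by (simp add: partials_def)

lemma partial_eqI:
  assumes "\<And>x. (f has_derivative D x) (at x)"
  shows "partial i f = (\<lambda>x. D x (axis i 1))"
  unfolding partial_def using frechet_derivative_at[OF assms] by (auto simp: fun_eq_iff)

lemma has_derivative_frechet: "f differentiable at x \<Longrightarrow> (f has_derivative frechet_derivative f (at x)) (at x)"
  by (simp add: frechet_derivative_works)

lemma partial_add:
  assumes "\<And>x. f differentiable at x" "\<And>x. g differentiable at x"
  shows "partial i (\<lambda>x. f x + g x) = (\<lambda>x. partial i f x + partial i g x)"
  by (subst partial_eqI[OF has_derivative_add[OF has_derivative_frechet has_derivative_frechet], OF assms])
     (simp add: partial_def)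

lemma partial_mult:
  assumes "\<And>x. f differentiable at x" "\<And>x. g differentiable at x"
  shows "partial i (\<lambda>x. f x * g x) = (\<lambda>x. f x * partial i g x + partial i f x * g x)"
  by (subst partial_eqI[OF has_derivative_mult[OF has_derivative_frechet has_derivative_frechet], OF assms])
     (simp add: partial_def)

text \<open>Every closure property below is reduced to naming a family that is stable under single
  partial derivatives. Formulas for iterated derivatives of products or compositions never
  arise.\<close>

lemma schwartz_coinduct:
  fixes A :: "(real^'n::finite \<Rightarrow> complex) set"
  assumes "\<phi> \<in> A"
    and der: "\<And>f i. f \<in> A \<Longrightarrow> partial i f \<in> A"
    and diff: "\<And>f x. f \<in> A \<Longrightarrow> f differentiable at x"
    and bd: "\<And>f m. f \<in> A \<Longrightarrow> \<exists>C. \<forall>x. (1 + norm x) ^ m * norm (f x) \<le> C"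
  shows "\<phi> \<in> schwartz"
proof -
  have A: "partials \<alpha> \<phi> \<in> A" for \<alpha>
    by (induction \<alpha>) (use assms in auto)
  have "bounded (range (\<lambda>x. (1 + norm x) ^ m *\<^sub>R partials \<alpha> \<phi> x))" for m \<alpha>
    using bd[OF A[of \<alpha>], of m] by (fastforce simp: bounded_iff)
  then show ?thesis using diff[OF A] by (simp add: schwartz_def)
qed

lemma schwartz_differentiable: "\<phi> \<in> schwartz \<Longrightarrow> \<phi> differentiable at x"
  unfolding schwartz_def using partials_Nil by (metis (mono_tags, lifting) mem_Collect_eq)

lemma schwartz_partial: "\<phi> \<in> schwartz \<Longrightarrow> partial i \<phi> \<in> schwartz"
  by (auto simp: schwartz_def partials_snoc[symmetric])

lemma schwartz_bound_ex:
  assumes "\<phi> \<in> schwartz"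
  shows "\<exists>C. \<forall>x. (1 + norm x) ^ m * norm (partials \<alpha> \<phi> x) \<le> C"
proof -
  have "bounded (range (\<lambda>x. (1 + norm x) ^ m *\<^sub>R partials \<alpha> \<phi> x))"
    using assms by (auto simp: schwartz_def)
  then obtain C where "\<forall>x. norm ((1 + norm x) ^ m *\<^sub>R partials \<alpha> \<phi> x) \<le> C"
    by (auto simp: bounded_iff)
  then show ?thesis by auto
qed

lemma schwartz_bound:
  assumes "\<phi> \<in> schwartz"
  obtains C where "C \<ge> 0" "\<And>x. norm (\<phi> x) \<le> C / (1 + norm x) ^ m"
proof -
  obtain C where C: "\<And>x. (1 + norm x) ^ m * norm (\<phi> x) \<le> C"
    using schwartz_bound_ex[OF assms, of m "[]"] by auto
  show ?thesis
  proof
    show "C \<ge> 0" by (rule order_trans[OF _ C[of 0]]) simp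
    show "norm (\<phi> x) \<le> C / (1 + norm x) ^ m" for x
      using C[of x] by (subst pos_le_divide_eq) (auto intro!: zero_less_power add_pos_nonneg simp: mult.commute)
  qed
qed

lemma schwartz_continuous: "\<phi> \<in> schwartz \<Longrightarrow> continuous_on UNIV \<phi>"
  by (metis differentiable_imp_continuous_on differentiable_on_def schwartz_differentiable differentiable_at_withinI)

lemma schwartz_measurable: "\<phi> \<in> schwartz \<Longrightarrow> \<phi> \<in> borel_measurable borel"
  by (intro borel_measurable_continuous_onI schwartz_continuous)

lemma schwartz_integrable:
  assumes "\<phi> \<in> schwartz"
  shows "integrable lborel (\<lambda>x::real^'n::finite. (1 + norm x) ^ m *\<^sub>R \<phi> x)"
proof -
  define N where "N = 2 * CARD('n)"
  obtain C where C: "C \<ge> 0" "\<And>x. norm (\<phi> x) \<le> C / (1 + norm x) ^ (m + N)"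
    by (rule schwartz_bound[OF assms, of "m + N"]) (rule that)
  have [measurable]: "\<phi> \<in> borel_measurable borel" by (rule schwartz_measurable[OF assms])
  have i: "integrable lborel (\<lambda>x::real^'n. C * (1 / (1 + norm x) ^ N))"
    by (intro integrable_mult_right integrable_inverse_power_norm) (simp add: N_def)
  show ?thesis
  proof (rule Bochner_Integration.integrable_bound[OF i], measurable, intro AE_I2)
    fix x :: "real^'n"
    have p: "1 + norm x \<noteq> 0" using norm_ge_zero[of x] by linarith
    have "norm ((1 + norm x) ^ m *\<^sub>R \<phi> x) = (1 + norm x) ^ m * norm (\<phi> x)" by simp
    also have "\<dots> \<le> (1 + norm x) ^ m * (C / (1 + norm x) ^ (m + N))" using C by (intro mult_left_mono) auto
    also have "\<dots> = C * (1 / (1 + norm x) ^ N)" using p by (simp add: power_add)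
    finally show "norm ((1 + norm x) ^ m *\<^sub>R \<phi> x) \<le> norm (C * (1 / (1 + norm x) ^ N))" using C(1) by simp
  qed
qed

lemma schwartz_integrable0: "\<phi> \<in> schwartz \<Longrightarrow> integrable lborel \<phi>"
  using schwartz_integrable[of \<phi> 0] by simp

section \<open>Schwartz seminorms\<close>

lemma schwartz_seminorm_bdd:
  assumes "\<phi> \<in> schwartz"
  shows "bdd_above ((\<lambda>(\<alpha>, x). (1 + norm x) ^ N * norm (partials \<alpha> \<phi> x)) ` ({\<alpha>. length \<alpha> \<le> N} \<times> UNIV))"
proof -
  obtain C where C: "\<And>\<alpha> x. (1 + norm x) ^ N * norm (partials \<alpha> \<phi> x) \<le> C \<alpha>"
    using schwartz_bound_ex[OF assms, of N] by metis
  \<comment> \<open>The coordinate type is finite, so only finitely many multi-indices have length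
    at most N; the individual bounds C \<alpha> can be summed into one.\<close>
  have fin: "finite {\<alpha>::'a list. length \<alpha> \<le> N}" using finite_lists_length_le[of "UNIV::'a set" N] by simp
  show ?thesis
  proof (intro bdd_aboveI2[where M="\<Sum>\<alpha>\<in>{\<alpha>. length \<alpha> \<le> N}. \<bar>C \<alpha>\<bar>"], clarify)
    fix \<alpha> :: "'a list" and x assume a: "length \<alpha> \<le> N"
    have "(1 + norm x) ^ N * norm (partials \<alpha> \<phi> x) \<le> \<bar>C \<alpha>\<bar>" using C[of x \<alpha>] by linarith
    also have "\<dots> \<le> (\<Sum>\<alpha>\<in>{\<alpha>. length \<alpha> \<le> N}. \<bar>C \<alpha>\<bar>)" by (rule member_le_sum) (use a fin in auto)
    finally show "(1 + norm x) ^ N * norm (partials \<alpha> \<phi> x) \<le> (\<Sum>\<alpha>\<in>{\<alpha>. length \<alpha> \<le> N}. \<bar>C \<alpha>\<bar>)" .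
  qed
qed

lemma schwartz_seminorm_upper:
  assumes "\<phi> \<in> schwartz" "length \<alpha> \<le> N"
  shows "(1 + norm x) ^ N * norm (partials \<alpha> \<phi> x) \<le> schwartz_seminorm N \<phi>"
  unfolding schwartz_seminorm_def
  using cSUP_upper[OF _ schwartz_seminorm_bdd[OF assms(1), of N], of "(\<alpha>, x)"] assms by auto

lemma schwartz_seminorm_least:
  assumes "\<And>\<alpha> x. length \<alpha> \<le> N \<Longrightarrow> (1 + norm x) ^ N * norm (partials \<alpha> \<phi> x) \<le> C"
  shows "schwartz_seminorm N \<phi> \<le> C"
proof -
  have "{\<alpha>::'a list. length \<alpha> \<le> N} \<noteq> {}" by (auto intro: exI[of _ "[]"])
  then show ?thesis unfolding schwartz_seminorm_def by (intro cSUP_least) (use assms in auto)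
qed

lemma power_Suc_norm_mono: "(1 + norm x) ^ N * norm y \<le> (1 + norm x) ^ Suc N * norm y"
  by (intro mult_right_mono power_increasing) auto

lemma schwartz_seminorm_partial:
  assumes "\<phi> \<in> schwartz"
  shows "schwartz_seminorm N (partial i \<phi>) \<le> schwartz_seminorm (Suc N) \<phi>"
proof (rule schwartz_seminorm_least)
  fix \<alpha> :: "'a list" and x assume "length \<alpha> \<le> N"
  then show "(1 + norm x) ^ N * norm (partials \<alpha> (partial i \<phi>) x) \<le> schwartz_seminorm (Suc N) \<phi>"
    using schwartz_seminorm_upper[OF assms, of "\<alpha> @ [i]" "Suc N" x]
      power_Suc_norm_mono[of x N "partials \<alpha> (partial i \<phi>) x"]
    by (simp only: partials_snoc length_append) (auto simp: )
qed

lemma schwartz_seminorm_Suc: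
  assumes "\<phi> \<in> schwartz"
  shows "schwartz_seminorm N \<phi> \<le> schwartz_seminorm (Suc N) \<phi>"
proof (rule schwartz_seminorm_least)
  fix \<alpha> :: "'a list" and x assume "length \<alpha> \<le> N"
  then show "(1 + norm x) ^ N * norm (partials \<alpha> \<phi> x) \<le> schwartz_seminorm (Suc N) \<phi>"
    using schwartz_seminorm_upper[OF assms, of \<alpha> "Suc N" x] power_Suc_norm_mono[of x N "partials \<alpha> \<phi> x"]
    by linarith
qed

text \<open>The multiplier algebra of the Schwartz space, often written O_M. The growth exponent may
  depend on the derivative.\<close>

definition slowly_growing :: "(real^'n::finite \<Rightarrow> complex) set" where
  "slowly_growing = {m. \<forall>\<alpha>. (\<forall>x. partials \<alpha> m differentiable at x) \<and>
              (\<exists>N C. \<forall>x. norm (partials \<alpha> m x) \<le> C * (1 + norm x) ^ N)}"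

lemma slowly_growing_coinduct:
  fixes A :: "(real^'n::finite \<Rightarrow> complex) set"
  assumes "\<phi> \<in> A"
    and der: "\<And>f i. f \<in> A \<Longrightarrow> partial i f \<in> A"
    and diff: "\<And>f x. f \<in> A \<Longrightarrow> f differentiable at x"
    and bd: "\<And>f. f \<in> A \<Longrightarrow> \<exists>N C. \<forall>x. norm (f x) \<le> C * (1 + norm x) ^ N"
  shows "\<phi> \<in> slowly_growing"
proof -
  have A: "partials \<alpha> \<phi> \<in> A" for \<alpha>
    by (induction \<alpha>) (use assms in auto)
  then show ?thesis using diff[OF A] bd[OF A] by (simp add: slowly_growing_def)
qed

lemma slowly_growing_differentiable: "\<phi> \<in> slowly_growing \<Longrightarrow> \<phi> differentiable at x"
  unfolding slowly_growing_def using partials_Nil by (metis (mono_tags, lifting) mem_Collect_eq)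

lemma slowly_growing_partial: "\<phi> \<in> slowly_growing \<Longrightarrow> partial i \<phi> \<in> slowly_growing"
  by (auto simp: slowly_growing_def partials_snoc[symmetric])

lemma slowly_growing_bound: "\<phi> \<in> slowly_growing \<Longrightarrow> \<exists>N C. \<forall>x. norm (\<phi> x) \<le> C * (1 + norm x) ^ N"
proof -
  assume "\<phi> \<in> slowly_growing"
  then have "\<exists>N C. \<forall>x. norm (partials [] \<phi> x) \<le> C * (1 + norm x) ^ N" unfolding slowly_growing_def by blast
  then show ?thesis by simp
qed

lemma add_decay:
  fixes f g :: "'a::real_normed_vector \<Rightarrow> complex"
  assumes "\<exists>C. \<forall>x. (1 + norm x) ^ m * norm (f x) \<le> C" "\<exists>C. \<forall>x. (1 + norm x) ^ m * norm (g x) \<le> C"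
  shows "\<exists>C. \<forall>x. (1 + norm x) ^ m * norm (f x + g x) \<le> C"
proof -
  obtain C D where CD: "\<And>x. (1 + norm x) ^ m * norm (f x) \<le> C" "\<And>x. (1 + norm x) ^ m * norm (g x) \<le> D"
    using assms by auto
  have "(1 + norm x) ^ m * norm (f x + g x) \<le> C + D" for x
  proof -
    have "(1 + norm x) ^ m * norm (f x + g x) \<le> (1 + norm x) ^ m * (norm (f x) + norm (g x))"
      by (intro mult_left_mono norm_triangle_ineq) auto
    then show ?thesis using CD[of x] by (simp add: distrib_left)
  qed
  then show ?thesis by blast
qed

text \<open>Closed under sums because the product rule turns one product into two; this makes the
  set stable under partial derivatives.\<close>

inductive_set slowly_growing_times_schwartz :: "(real^'n::finite \<Rightarrow> complex) set" where
  mult: "m \<in> slowly_growing \<Longrightarrow> \<phi> \<in> schwartz \<Longrightarrow> (\<lambda>x. m x * \<phi> x) \<in> slowly_growing_times_schwartz"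
| add: "f \<in> slowly_growing_times_schwartz \<Longrightarrow> g \<in> slowly_growing_times_schwartz \<Longrightarrow> (\<lambda>x. f x + g x) \<in> slowly_growing_times_schwartz"

lemma slowly_growing_times_schwartz_aux:
  assumes "f \<in> slowly_growing_times_schwartz"
  shows "(\<forall>x. f differentiable at x) \<and> partial i f \<in> slowly_growing_times_schwartz \<and>
    (\<exists>C. \<forall>x. (1 + norm x) ^ k * norm (f x) \<le> C)"
  using assms
proof induction
  case (mult m \<phi>)
  note d = slowly_growing_differentiable[OF mult(1)] schwartz_differentiable[OF mult(2)]
  obtain N C where C: "\<And>x. norm (m x) \<le> C * (1 + norm x) ^ N" using slowly_growing_bound[OF mult(1)] by auto
  have C0: "C \<ge> 0" using C[of 0] norm_ge_zero[of "m 0"] by (simp del: norm_ge_zero)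
  obtain D where D: "\<And>x. (1 + norm x) ^ (k + N) * norm (\<phi> x) \<le> D"
    using schwartz_bound_ex[OF mult(2), of "k + N" "[]"] by auto
  have "(1 + norm x) ^ k * norm (m x * \<phi> x) \<le> C * D" for x
  proof -
    have "(1 + norm x) ^ k * norm (m x * \<phi> x) \<le> (1 + norm x) ^ k * ((C * (1 + norm x) ^ N) * norm (\<phi> x))"
      unfolding norm_mult by (intro mult_left_mono mult_right_mono C) auto
    also have "\<dots> = C * ((1 + norm x) ^ (k + N) * norm (\<phi> x))" by (simp add: power_add mult_ac)
    also have "\<dots> \<le> C * D" by (intro mult_left_mono D C0)
    finally show ?thesis .
  qed
  then show ?case
    using d by (auto simp: partial_mult intro!: differentiable_mult slowly_growing_times_schwartz.intros slowly_growing_partial schwartz_partial mult)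
next
  case (add f g)
  then show ?case
    by (auto simp: partial_add intro!: differentiable_add slowly_growing_times_schwartz.intros add_decay)
qed

lemma slowly_growing_mult_schwartz:
  assumes "m \<in> slowly_growing" "\<phi> \<in> schwartz"
  shows "(\<lambda>x. m x * \<phi> x) \<in> schwartz"
proof (rule schwartz_coinduct)
  show "(\<lambda>x. m x * \<phi> x) \<in> slowly_growing_times_schwartz" using assms by (rule slowly_growing_times_schwartz.mult)
qed (use slowly_growing_times_schwartz_aux in blast)+

lemma schwartz_add:
  assumes "\<phi> \<in> schwartz" "\<psi> \<in> schwartz"
  shows "(\<lambda>x. \<phi> x + \<psi> x) \<in> schwartz"
proof (rule schwartz_coinduct[where A="{(\<lambda>x. f x + g x) | f g. f \<in> schwartz \<and> g \<in> schwartz}"])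
  show "f differentiable at x" if "f \<in> {(\<lambda>x. f x + g x) | f g. f \<in> schwartz \<and> g \<in> schwartz}" for f :: "real^'a \<Rightarrow> complex" and x
    using that schwartz_differentiable by (auto intro!: differentiable_add)
  show "\<exists>C. \<forall>x. (1 + norm x) ^ m * norm (f x) \<le> C"
    if "f \<in> {(\<lambda>x. f x + g x) | f g. f \<in> schwartz \<and> g \<in> schwartz}" for f :: "real^'a \<Rightarrow> complex" and m
    using that schwartz_bound_ex[of _ m "[]"] by (auto intro!: add_decay)
  show "partial i f \<in> {(\<lambda>x. f x + g x) | f g. f \<in> schwartz \<and> g \<in> schwartz}"
    if f: "f \<in> {(\<lambda>x. f x + g x) | f g. f \<in> schwartz \<and> g \<in> schwartz}" for f :: "real^'a \<Rightarrow> complex" and i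
  proof -
    obtain g h where gh: "f = (\<lambda>x. g x + h x)" "g \<in> schwartz" "h \<in> schwartz" using f by blast
    have "partial i f = (\<lambda>x. partial i g x + partial i h x)"
      unfolding gh(1) by (rule partial_add) (use gh schwartz_differentiable in auto)
    then show ?thesis using schwartz_partial gh(2,3) by blast
  qed
qed (use assms in auto)

lemma slowly_growing_const: "(\<lambda>x. c) \<in> slowly_growing"
proof (rule slowly_growing_coinduct[where A="range (\<lambda>c x. c)"])
  have p: "partial i (\<lambda>x. c) = (\<lambda>x. 0)" for c :: complex and i :: 'a
    by (subst partial_eqI[OF has_derivative_const]) simp
  show "partial i f \<in> range (\<lambda>c x. c)" if "f \<in> range (\<lambda>c x. c)" for f :: "real^'a \<Rightarrow> complex" and i
    using that p by auto
  show "\<exists>N C. \<forall>x. norm (f x) \<le> C * (1 + norm x) ^ N" if "f \<in> range (\<lambda>c x. c)" for f :: "real^'a \<Rightarrow> complex"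
    using that by (auto intro!: exI[of _ "0::nat"])
qed auto

lemma schwartz_cmult: "\<phi> \<in> schwartz \<Longrightarrow> (\<lambda>x. c * \<phi> x) \<in> schwartz"
  by (rule slowly_growing_mult_schwartz[OF slowly_growing_const])

lemma schwartz_uminus: "\<phi> \<in> schwartz \<Longrightarrow> (\<lambda>x. - \<phi> x) \<in> schwartz"
  using schwartz_cmult[of \<phi> "-1"] by simp

lemma has_derivative_coord:
  "((\<lambda>x::real^'n::finite. complex_of_real (x $ i) * c + d) has_derivative (\<lambda>h. complex_of_real (h $ i) * c)) (at x)"
proof -
  have "bounded_linear (\<lambda>x::real^'n. complex_of_real (x $ i) * c)"
    by (intro bounded_linear_compose[OF bounded_linear_mult_left]
        bounded_linear_compose[OF bounded_linear_of_real bounded_linear_vec_nth])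
  then show ?thesis by (intro has_derivative_add_const bounded_linear_imp_has_derivative)
qed

lemma slowly_growing_coord: "(\<lambda>x. of_real (x $ i)) \<in> slowly_growing"
proof (rule slowly_growing_coinduct[where A="{(\<lambda>x::real^'a. complex_of_real (x $ i) * c + d) | c d. True}"])
  show "(\<lambda>x::real^'a. complex_of_real (x $ i)) \<in> {(\<lambda>x::real^'a. complex_of_real (x $ i) * c + d) | c d. True}"
    by (rule CollectI, rule exI[of _ 1], rule exI[of _ 0]) simp
  show "partial j f \<in> {(\<lambda>x::real^'a. complex_of_real (x $ i) * c + d) | c d. True}"
    if f: "f \<in> {(\<lambda>x::real^'a. complex_of_real (x $ i) * c + d) | c d. True}" for f j
  proof -
    obtain c d where f: "f = (\<lambda>x::real^'a. of_real (x $ i) * c + d)" using f by auto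
    have "partial j f = (\<lambda>x. of_real (x $ i) * 0 + of_real (axis j 1 $ i) * c)"
      unfolding f by (subst partial_eqI[OF has_derivative_coord]) simp
    then show ?thesis by blast
  qed
  show "f differentiable at x"
    if "f \<in> {(\<lambda>x::real^'a. complex_of_real (x $ i) * c + d) | c d. True}" for f x
    using that has_derivative_coord unfolding differentiable_def by blast
  show "\<exists>N C. \<forall>x. norm (f x) \<le> C * (1 + norm x) ^ N"
    if f: "f \<in> {(\<lambda>x::real^'a. complex_of_real (x $ i) * c + d) | c d. True}" for f
  proof -
    obtain c d where f: "f = (\<lambda>x::real^'a. of_real (x $ i) * c + d)" using f by auto
    have "norm (f x) \<le> (norm c + norm d) * (1 + norm x) ^ 1" for x
    proof -
      have "norm (f x) \<le> \<bar>x $ i\<bar> * norm c + norm d" unfolding f by (metis norm_triangle_ineq norm_mult norm_of_real)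
      also have "\<dots> \<le> (1 + norm x) * norm c + (1 + norm x) * norm d"
      proof (intro add_mono mult_right_mono)
        show "\<bar>x $ i\<bar> \<le> 1 + norm x" using component_le_norm_cart[of x i] by simp
        show "norm d \<le> (1 + norm x) * norm d" by (simp add: distrib_right)
      qed auto
      finally show ?thesis by (simp add: algebra_simps)
    qed
    then show ?thesis by blast
  qed
qed

text \<open>The polynomial multiples of one Gaussian, generated by exactly the operations that
  differentiation produces.\<close>

inductive_set gauss_span :: "real \<Rightarrow> (real^'n::finite \<Rightarrow> complex) set" for c where
  gauss: "(\<lambda>x. of_real (gauss c x)) \<in> gauss_span c"
| coord: "f \<in> gauss_span c \<Longrightarrow> (\<lambda>x. of_real (x $ i) * f x) \<in> gauss_span c"
| scale: "f \<in> gauss_span c \<Longrightarrow> (\<lambda>x. a * f x) \<in> gauss_span c"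
| add: "f \<in> gauss_span c \<Longrightarrow> g \<in> gauss_span c \<Longrightarrow> (\<lambda>x. f x + g x) \<in> gauss_span c"

lemma has_derivative_gauss:
  "((\<lambda>x::real^'n::finite. complex_of_real (gauss c x)) has_derivative
     (\<lambda>h. of_real (- 2 * pi * c) * (of_real (x \<bullet> h) * of_real (gauss c x)))) (at x)"
  unfolding gauss_def power2_norm_eq_inner
  by (auto intro!: derivative_eq_intros simp: inner_commute algebra_simps)

text \<open>The bound keeps the factor \<open>gauss c x\<close> and does not refer to the sign of c.
  Boundedness of that factor gives multipliers for c \<ge> 0, and its decay gives Schwartz functions
  for c > 0.\<close>

lemma gauss_span_aux:
  assumes "f \<in> gauss_span c"
  shows "(\<forall>x. f differentiable at x) \<and> partial i f \<in> gauss_span c \<and>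
    (\<exists>N C. \<forall>x. norm (f x) \<le> C * (1 + norm x) ^ N * gauss c x)"
  using assms
proof induction
  case gauss
  have "partial i (\<lambda>x::real^'a. of_real (gauss c x)) = (\<lambda>x. of_real (- 2 * pi * c) * (of_real (x $ i) * of_real (gauss c x)))"
    by (subst partial_eqI[OF has_derivative_gauss]) (simp add: inner_axis)
  moreover have "(\<lambda>x::real^'a. complex_of_real (gauss c x)) differentiable at x" for x
    using has_derivative_gauss unfolding differentiable_def by blast
  moreover have "\<forall>x::real^'a. norm (complex_of_real (gauss c x)) \<le> 1 * (1 + norm x) ^ 0 * gauss c x"
    by (simp add: gauss_def)
  ultimately show ?case by (auto intro!: gauss_span.scale gauss_span.coord gauss_span.gauss simp only:)
next
  case (coord f j)
  have d: "(\<lambda>x::real^'a. complex_of_real (x $ j)) differentiable at x" for x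
    by (rule slowly_growing_differentiable[OF slowly_growing_coord])
  have "partial i (\<lambda>x::real^'a. complex_of_real (x $ j)) = (\<lambda>x. of_real (axis i 1 $ j))"
    using partial_eqI[OF has_derivative_coord[of j 1 0], of i] by simp
  then have p: "partial i (\<lambda>x. of_real (x $ j) * f x) = (\<lambda>x. of_real (x $ j) * partial i f x + of_real (axis i 1 $ j) * f x)"
    using coord d by (subst partial_mult) auto
  obtain N C where C: "\<And>x. norm (f x) \<le> C * (1 + norm x) ^ N * gauss c x" using coord by auto
  have "norm (of_real (x $ j) * f x) \<le> C * (1 + norm x) ^ (Suc N) * gauss c x" for x
  proof -
    have "norm (of_real (x $ j) * f x) \<le> (1 + norm x) * (C * (1 + norm x) ^ N * gauss c x)"
      unfolding norm_mult norm_of_real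
      by (intro mult_mono C) (use component_le_norm_cart[of x j] in auto)
    then show ?thesis by (simp add: mult_ac)
  qed
  then have "\<exists>N C. \<forall>x. norm (of_real (x $ j) * f x) \<le> C * (1 + norm x) ^ N * gauss c x" by blast
  then show ?case
    using coord d unfolding p by (auto intro!: gauss_span.intros differentiable_mult)
next
  case (scale f a)
  have p: "partial i (\<lambda>x. a * f x) = (\<lambda>x. a * partial i f x)"
    using scale partial_mult[of "\<lambda>x. a" f i] partial_eqI[OF has_derivative_const, of i a] by simp
  obtain N C where C: "\<And>x. norm (f x) \<le> C * (1 + norm x) ^ N * gauss c x" using scale by auto
  have "norm (a * f x) \<le> norm a * C * (1 + norm x) ^ N * gauss c x" for x
    using mult_left_mono[OF C[of x], of "norm a"] by (simp add: norm_mult mult_ac)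
  then have "\<exists>N C. \<forall>x. norm (a * f x) \<le> C * (1 + norm x) ^ N * gauss c x" by blast
  then show ?case
    using scale unfolding p by (auto intro!: gauss_span.intros differentiable_mult)
next
  case (add f g)
  obtain N C where C: "\<And>x. norm (f x) \<le> C * (1 + norm x) ^ N * gauss c x" using add by auto
  obtain M D where D: "\<And>x. norm (g x) \<le> D * (1 + norm x) ^ M * gauss c x" using add by auto
  have "norm (f x + g x) \<le> (\<bar>C\<bar> + \<bar>D\<bar>) * (1 + norm x) ^ (N + M) * gauss c x" for x
  proof -
    have "norm (f x) \<le> \<bar>C\<bar> * (1 + norm x) ^ (N + M) * gauss c x"
      by (rule order_trans[OF C]) (intro mult_mono power_increasing, auto simp: gauss_def)
    moreover have "norm (g x) \<le> \<bar>D\<bar> * (1 + norm x) ^ (N + M) * gauss c x"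
      by (rule order_trans[OF D]) (intro mult_mono power_increasing, auto simp: gauss_def)
    ultimately show ?thesis using norm_triangle_ineq[of "f x" "g x"] by (simp add: distrib_right)
  qed
  then have "\<exists>N C. \<forall>x. norm (f x + g x) \<le> C * (1 + norm x) ^ N * gauss c x" by blast
  then show ?case
    using add by (auto simp: partial_add intro!: gauss_span.intros differentiable_add)
qed

text \<open>The borderline c = 0 is included because the heat symbol at time zero is the constant
  1.\<close>

lemma gauss_slowly_growing:
  assumes "c \<ge> 0"
  shows "(\<lambda>x. of_real (gauss c x)) \<in> slowly_growing"
proof (rule slowly_growing_coinduct[where A="gauss_span c"])
  show "\<exists>N C. \<forall>x. norm (f x) \<le> C * (1 + norm x) ^ N" if f: "f \<in> gauss_span c" for f :: "real^'a \<Rightarrow> complex"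
  proof -
    obtain N C where C: "\<And>x. norm (f x) \<le> C * (1 + norm x) ^ N * gauss c x"
      using gauss_span_aux[OF f] by blast
    have "norm (f x) \<le> \<bar>C\<bar> * (1 + norm x) ^ N" for x
    proof -
      have "norm (f x) \<le> \<bar>C\<bar> * (1 + norm x) ^ N * 1"
        by (rule order_trans[OF C]) (intro mult_mono, use assms in \<open>auto simp: gauss_def\<close>)
      then show ?thesis by simp
    qed
    then show ?thesis by blast
  qed
qed (use gauss_span_aux gauss_span.gauss in blast)+

text \<open>From 1 + r \<le> exp r; the bound is then the maximum of the exponent M r - pi c r^2,
  found by completing the square.\<close>

lemma power_gauss_bound:
  assumes "c > 0"
  shows "(1 + norm x) ^ M * gauss c x \<le> exp ((real M)\<^sup>2 / (4 * pi * c))"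
proof -
  define r where "r = norm x"
  have "1 + r \<le> exp r" by (rule exp_ge_add_one_self)
  then have "(1 + norm x) ^ M \<le> exp r ^ M" by (intro power_mono) (auto simp: r_def)
  then have "(1 + norm x) ^ M * gauss c x \<le> exp r ^ M * gauss c x" by (intro mult_right_mono) (auto simp: gauss_def)
  also have "\<dots> = exp (M * r - pi * c * r\<^sup>2)" by (simp add: gauss_def r_def exp_of_nat_mult[symmetric] exp_add[symmetric])
  also have "\<dots> \<le> exp ((real M)\<^sup>2 / (4 * pi * c))"
  proof -
    have "0 \<le> (M - 2 * pi * c * r)\<^sup>2" by simp
    then have "4 * pi * c * (M * r - pi * c * r\<^sup>2) \<le> (real M)\<^sup>2" by (simp add: power2_eq_square algebra_simps)
    then show ?thesis using assms by (simp add: field_simps)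
  qed
  finally show ?thesis .
qed

lemma gauss_schwartz:
  assumes "c > 0"
  shows "(\<lambda>x. of_real (gauss c x)) \<in> schwartz"
proof (rule schwartz_coinduct[where A="gauss_span c"])
  show "\<exists>C. \<forall>x. (1 + norm x) ^ m * norm (f x) \<le> C" if f: "f \<in> gauss_span c" for f :: "real^'a \<Rightarrow> complex" and m
  proof -
    obtain N C where C: "\<And>x. norm (f x) \<le> C * (1 + norm x) ^ N * gauss c x"
      using gauss_span_aux[OF f] by blast
    have "(1 + norm x) ^ m * norm (f x) \<le> \<bar>C\<bar> * exp ((real (m + N))\<^sup>2 / (4 * pi * c))" for x
    proof -
      have "norm (f x) \<le> \<bar>C\<bar> * (1 + norm x) ^ N * gauss c x"
        by (rule order_trans[OF C]) (intro mult_right_mono, auto simp: gauss_def)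
      then have "(1 + norm x) ^ m * norm (f x) \<le> (1 + norm x) ^ m * (\<bar>C\<bar> * (1 + norm x) ^ N * gauss c x)"
        by (intro mult_left_mono) auto
      also have "\<dots> = \<bar>C\<bar> * ((1 + norm x) ^ (m + N) * gauss c x)" by (simp add: power_add mult_ac)
      also have "\<dots> \<le> \<bar>C\<bar> * exp ((real (m + N))\<^sup>2 / (4 * pi * c))"
        by (intro mult_left_mono power_gauss_bound assms) auto
      finally show ?thesis .
    qed
    then show ?thesis by blast
  qed
qed (use gauss_span_aux gauss_span.gauss in blast)+

lemma heat_symbol_gauss: "heat_symbol t \<xi> = of_real (gauss (4 * pi * t) \<xi>)"
  by (simp add: heat_symbol_def gauss_def power2_eq_square mult_ac)

lemma heat_mult_schwartz:
  assumes "t \<ge> 0" "\<phi> \<in> schwartz"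
  shows "(\<lambda>x. heat_symbol t x * \<phi> x) \<in> schwartz"
  unfolding heat_symbol_gauss using assms by (intro slowly_growing_mult_schwartz gauss_slowly_growing) auto

text \<open>The inverse Fourier transform is the Fourier transform of the reflected function, so
  facts about \<open>fourier\<close> carry over once reflection preserves the Schwartz
  space.\<close>

lemma schwartz_reflect:
  assumes "\<phi> \<in> schwartz"
  shows "(\<lambda>x::real^'n::finite. \<phi> (- x)) \<in> schwartz"
proof (rule schwartz_coinduct[where A="{(\<lambda>x. \<phi> (- x)) | \<phi>. \<phi> \<in> schwartz}"])
  have d: "((\<lambda>x. \<phi> (- x)) has_derivative (\<lambda>h. frechet_derivative \<phi> (at (- x)) (- h))) (at x)"
    if "\<phi> \<in> schwartz" for \<phi> :: "real^'n \<Rightarrow> complex" and x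
    by (rule has_derivative_compose[where f=uminus, OF _ has_derivative_frechet])
       (auto intro!: derivative_eq_intros schwartz_differentiable that)
  show "f differentiable at x" if "f \<in> {(\<lambda>x. \<phi> (- x)) | \<phi>. \<phi> \<in> schwartz}" for f :: "real^'n \<Rightarrow> complex" and x
    using that d by (fastforce simp: differentiable_def)
  show "partial i f \<in> {(\<lambda>x. \<phi> (- x)) | \<phi>. \<phi> \<in> schwartz}"
    if f: "f \<in> {(\<lambda>x. \<phi> (- x)) | \<phi>. \<phi> \<in> schwartz}" for f :: "real^'n \<Rightarrow> complex" and i
  proof -
    obtain \<phi> where \<phi>: "f = (\<lambda>x. \<phi> (- x))" "\<phi> \<in> schwartz" using f by auto
    have "linear (frechet_derivative \<phi> (at y))" for y
      by (rule linear_frechet_derivative[OF schwartz_differentiable[OF \<phi>(2)]])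
    then have "partial i f = (\<lambda>x. (\<lambda>y. - partial i \<phi> y) (- x))"
      unfolding \<phi>(1) by (subst partial_eqI[OF d[OF \<phi>(2)]]) (simp add: partial_def linear_neg)
    then show ?thesis using schwartz_uminus[OF schwartz_partial[OF \<phi>(2), of i]]
      by (intro CollectI exI[of _ "\<lambda>x. - partial i \<phi> x"]) auto
  qed
  show "\<exists>C. \<forall>x. (1 + norm x) ^ m * norm (f x) \<le> C"
    if f: "f \<in> {(\<lambda>x. \<phi> (- x)) | \<phi>. \<phi> \<in> schwartz}" for f :: "real^'n \<Rightarrow> complex" and m
  proof -
    obtain \<phi> where \<phi>: "f = (\<lambda>x. \<phi> (- x))" "\<phi> \<in> schwartz" using f by auto
    obtain C where "\<And>x. (1 + norm x) ^ m * norm (\<phi> x) \<le> C"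
      using schwartz_bound_ex[OF \<phi>(2), of m "[]"] by auto
    from this[of "- _"] show ?thesis unfolding \<phi> by auto
  qed
qed (use assms in auto)

section \<open>The Fourier transform on Schwartz functions\<close>

definition phase :: "real \<Rightarrow> complex" where
  "phase r = exp (- (2 * of_real pi * \<i> * of_real r))"

lemma phase_iexp: "phase r = iexp (- 2 * pi * r)"
  by (simp add: phase_def mult_ac)

lemma norm_phase [simp]: "norm (phase r) = 1"
  by (simp add: phase_iexp norm_exp_eq_Re)

lemma phase_add: "phase (r + s) = phase r * phase s"
  by (simp add: phase_def exp_add[symmetric] algebra_simps)

lemma phase_0 [simp]: "phase 0 = 1"
  by (simp add: phase_def)

lemma continuous_phase: "continuous_on S phase"
  unfolding phase_def by (intro continuous_intros)

lemma phase_measurable [measurable]: "phase \<in> borel_measurable borel"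
  by (intro borel_measurable_continuous_onI continuous_phase)

lemma phase_approx1: "norm (phase r - 1 + 2 * of_real pi * \<i> * of_real r) \<le> (2 * pi * r)\<^sup>2 / 2"
proof -
  have "norm (iexp (- 2 * pi * r) - (\<Sum>k \<le> 1. (\<i> * of_real (- 2 * pi * r))^k / fact k)) \<le> \<bar>- 2 * pi * r\<bar>^(Suc 1) / fact (Suc 1)"
    by (rule iexp_approx1)
  then show ?thesis by (simp add: phase_iexp numeral_2_eq_2[symmetric] algebra_simps power2_eq_square abs_mult)
qed

lemma fourier_phase: "fourier f \<xi> = (LINT x|lborel. f x * phase (\<xi> \<bullet> x))"
  by (simp add: fourier_def phase_def)

lemma fourier_inv_fourier: "fourier_inv f x = fourier f (- x)"
  by (simp add: fourier_inv_def fourier_def inner_commute)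

lemma fourier_inv_phase: "fourier_inv f x = (LINT \<xi>|lborel. f \<xi> * phase (- (x \<bullet> \<xi>)))"
  by (simp add: fourier_inv_fourier fourier_phase)

lemma integrable_mult_phase:
  fixes f :: "real^'n::finite \<Rightarrow> complex"
  assumes "integrable lborel f"
  shows "integrable lborel (\<lambda>x. f x * phase (\<xi> \<bullet> x))" "integrable lborel (\<lambda>x. f x * phase (- (\<xi> \<bullet> x)))"
proof -
  have [measurable]: "f \<in> borel_measurable borel" using assms by auto
  show "integrable lborel (\<lambda>x. f x * phase (\<xi> \<bullet> x))" "integrable lborel (\<lambda>x. f x * phase (- (\<xi> \<bullet> x)))"
    by (rule Bochner_Integration.integrable_bound[OF assms]; simp add: norm_mult)+
qed

lemma fourier_norm_le: "norm (fourier f \<xi>) \<le> (LINT x|lborel. norm (f x))"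
  unfolding fourier_phase by (rule order_trans[OF integral_norm_bound]) (simp add: norm_mult)

lemma fourier_reflect:
  assumes [measurable]: "f \<in> borel_measurable borel"
  shows "fourier (\<lambda>x. f (- x)) \<xi> = fourier f (- \<xi>)"
proof -
  have "(LINT x|lborel. (\<lambda>y. f y * phase (- \<xi> \<bullet> y)) (0 - x)) = (LINT x|lborel. f x * phase (- \<xi> \<bullet> x))"
    by (rule integral_lborel_reflect) measurable
  then show ?thesis by (simp add: fourier_phase)
qed

text \<open>Finiteness of all absolute moments makes the Fourier transform smooth without any
  regularity of f. This generality is needed for the merely continuous functions in the density
  argument.\<close>

definition rapid :: "(real^'n::finite \<Rightarrow> complex) \<Rightarrow> bool" where
  "rapid f \<longleftrightarrow> f \<in> borel_measurable borel \<and> (\<forall>m. integrable lborel (\<lambda>x. (1 + norm x) ^ m *\<^sub>R f x))"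

lemma rapid_measurable: "rapid f \<Longrightarrow> f \<in> borel_measurable borel"
  by (simp add: rapid_def)

lemma rapid_norm_integrable: "rapid f \<Longrightarrow> integrable lborel (\<lambda>x. (1 + norm x) ^ m * norm (f x))"
proof -
  assume "rapid f"
  then have "integrable lborel (\<lambda>x. norm ((1 + norm x) ^ m *\<^sub>R f x))"
    unfolding rapid_def by (intro integrable_norm) auto
  then show ?thesis by simp
qed

lemma rapid_bound:
  fixes f :: "real^'n::finite \<Rightarrow> complex"
  assumes f: "rapid f" and [measurable]: "g \<in> borel_measurable borel"
    and le: "\<And>x. norm (g x) \<le> C * (1 + norm x) ^ N * norm (f x)"
  shows "rapid g"
  unfolding rapid_def
proof (intro conjI allI)
  fix m
  have "integrable lborel (\<lambda>x. C * ((1 + norm x) ^ (m + N) * norm (f x)))"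
    by (intro integrable_mult_right rapid_norm_integrable f)
  then show "integrable lborel (\<lambda>x. (1 + norm x) ^ m *\<^sub>R g x)"
  proof (rule Bochner_Integration.integrable_bound, measurable, intro AE_I2)
    fix x :: "real^'n"
    have "norm ((1 + norm x) ^ m *\<^sub>R g x) \<le> (1 + norm x) ^ m * (C * (1 + norm x) ^ N * norm (f x))"
      using mult_left_mono[OF le[of x], of "(1 + norm x) ^ m"] by simp
    also have "\<dots> = C * ((1 + norm x) ^ (m + N) * norm (f x))" by (simp add: power_add mult_ac)
    finally show "norm ((1 + norm x) ^ m *\<^sub>R g x) \<le> norm (C * ((1 + norm x) ^ (m + N) * norm (f x)))"
      by (simp only: real_norm_def)
  qed
qed fact

lemma schwartz_rapid: "\<phi> \<in> schwartz \<Longrightarrow> rapid \<phi>"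
  by (simp add: rapid_def schwartz_measurable schwartz_integrable)

lemma rapid_integrable: "rapid f \<Longrightarrow> integrable lborel f"
  by (auto simp: rapid_def dest: spec[of _ 0])

lemma rapid_coord:
  assumes "rapid f"
  shows "rapid (\<lambda>x. c * of_real (x $ i) * f x)"
proof (rule rapid_bound[OF assms])
  show "(\<lambda>x. c * of_real (x $ i) * f x) \<in> borel_measurable borel"
    using rapid_measurable[OF assms] by measurable
  show "norm (c * of_real (x $ i) * f x) \<le> norm c * (1 + norm x) ^ 1 * norm (f x)" for x
    unfolding norm_mult norm_of_real
    by (intro mult_right_mono mult_left_mono) (use component_le_norm_cart[of x i] in auto)
qed

text \<open>Differentiation under the integral sign with an explicit remainder: the second order
  Taylor bound of the phase gives an error of order |h|^2 times the second moment of f, so the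
  quotient by |h| is squeezed to zero.\<close>

lemma fourier_has_derivative:
  fixes f :: "real^'n::finite \<Rightarrow> complex"
  assumes f: "rapid f"
  shows "(fourier f has_derivative (\<lambda>h. LINT x|lborel. f x * phase (\<xi> \<bullet> x) * (- (2 * of_real pi * \<i> * of_real (h \<bullet> x))))) (at \<xi>)"
proof -
  note [measurable] = rapid_measurable[OF f]
  define D where "D = (\<lambda>h. LINT x|lborel. f x * phase (\<xi> \<bullet> x) * (- (2 * of_real pi * \<i> * of_real (h \<bullet> x))))"
  have ib: "integrable lborel (\<lambda>x. (1 + norm x) ^ m * norm (f x))" for m by (rule rapid_norm_integrable[OF f])
  have le1: "norm (f x * phase (\<xi> \<bullet> x) * (- (2 * of_real pi * \<i> * of_real (h \<bullet> x)))) \<le> (2 * pi * norm h) * ((1 + norm x) ^ 1 * norm (f x))" for h x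
  proof -
    have "\<bar>h \<bullet> x\<bar> \<le> norm h * (1 + norm x)"
      using Cauchy_Schwarz_ineq2[of h x] by (simp add: distrib_left) (use norm_ge_zero[of h] in linarith)
    then have "2 * pi * \<bar>h \<bullet> x\<bar> * norm (f x) \<le> 2 * pi * (norm h * (1 + norm x)) * norm (f x)"
      by (intro mult_left_mono mult_right_mono) auto
    then show ?thesis by (simp add: norm_mult mult_ac)
  qed
  have iD: "integrable lborel (\<lambda>x. f x * phase (\<xi> \<bullet> x) * (- (2 * of_real pi * \<i> * of_real (h \<bullet> x))))" for h
    by (rule Bochner_Integration.integrable_bound[OF integrable_mult_right[OF ib[of 1], of "2 * pi * norm h"]])
       (measurable, intro AE_I2, use le1[of _ h] in \<open>simp\<close>)
  have fe: "integrable lborel (\<lambda>x. f x * phase (\<eta> \<bullet> x))" for \<eta>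
    by (intro integrable_mult_phase rapid_integrable f)
  define A where "A = (LINT x|lborel. (1 + norm x) ^ 2 * norm (f x))"
  show ?thesis
    unfolding D_def[symmetric]
  proof (rule has_derivativeI_sandwich[where e=1 and H="\<lambda>y. 2 * pi\<^sup>2 * A * norm (y - \<xi>)"])
    show "bounded_linear D"
    proof (rule bounded_linear_intro[where K="2 * pi * (LINT x|lborel. (1 + norm x) ^ 1 * norm (f x))"])
      show "D (x + y) = D x + D y" for x y
        unfolding D_def by (subst Bochner_Integration.integral_add[symmetric, OF iD iD]) (simp add: inner_add_left algebra_simps)
      show "D (r *\<^sub>R x) = r *\<^sub>R D x" for r x
        unfolding D_def by (subst integral_scaleR_right[symmetric]) (simp add: scaleR_conv_of_real[where 'a=complex] mult_ac)
      show "norm (D h) \<le> norm h * (2 * pi * (LINT x|lborel. (1 + norm x) ^ 1 * norm (f x)))" for h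
      proof -
        have "norm (D h) \<le> (LINT x|lborel. (2 * pi * norm h) * ((1 + norm (x::real^'n)) ^ 1 * norm (f x)))"
          unfolding D_def by (intro Bochner_Integration.integral_norm_bound_integral iD integrable_mult_right ib le1)
        then show ?thesis unfolding integral_mult_right_zero by (simp only: mult_ac)
      qed
    qed
    show "norm (fourier f y - fourier f \<xi> - D (y - \<xi>)) / norm (y - \<xi>) \<le> 2 * pi\<^sup>2 * A * norm (y - \<xi>)"
      if "y \<noteq> \<xi>" for y
    proof -
      define h where "h = y - \<xi>"
      have "fourier f y - fourier f \<xi> - D h
        = (LINT x|lborel. f x * phase (y \<bullet> x) - f x * phase (\<xi> \<bullet> x) - f x * phase (\<xi> \<bullet> x) * (- (2 * of_real pi * \<i> * of_real (h \<bullet> x))))"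
        unfolding fourier_phase D_def by (simp only: Bochner_Integration.integral_diff Bochner_Integration.integrable_diff fe iD)
      also have "norm \<dots> \<le> (LINT x|lborel. (2 * pi\<^sup>2 * (norm h)\<^sup>2) * ((1 + norm x) ^ 2 * norm (f x)))"
      proof (intro Bochner_Integration.integral_norm_bound_integral Bochner_Integration.integrable_diff fe iD integrable_mult_right ib)
        fix x :: "real^'n"
        have "f x * phase (y \<bullet> x) - f x * phase (\<xi> \<bullet> x) - f x * phase (\<xi> \<bullet> x) * (- (2 * of_real pi * \<i> * of_real (h \<bullet> x)))
          = f x * phase (\<xi> \<bullet> x) * (phase (h \<bullet> x) - 1 + 2 * of_real pi * \<i> * of_real (h \<bullet> x))"
        proof -
          have "phase (y \<bullet> x) = phase (\<xi> \<bullet> x) * phase (h \<bullet> x)"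
            by (simp add: phase_add[symmetric] h_def inner_diff_left)
          then show ?thesis by (simp add: algebra_simps)
        qed
        also have "norm \<dots> \<le> norm (f x) * ((2 * pi * (h \<bullet> x))\<^sup>2 / 2)"
          unfolding norm_mult norm_phase mult_1_right by (intro mult_left_mono phase_approx1) auto
        also have "\<dots> \<le> norm (f x) * (2 * pi\<^sup>2 * ((norm h)\<^sup>2 * (1 + norm x)\<^sup>2))"
        proof (intro mult_left_mono)
          have "\<bar>h \<bullet> x\<bar> \<le> norm h * (1 + norm x)"
            using Cauchy_Schwarz_ineq2[of h x] by (simp add: distrib_left) (use norm_ge_zero[of h] in linarith)
          then have "\<bar>h \<bullet> x\<bar>\<^sup>2 \<le> (norm h * (1 + norm x))\<^sup>2" by (intro power_mono) auto
          then show "(2 * pi * (h \<bullet> x))\<^sup>2 / 2 \<le> 2 * pi\<^sup>2 * ((norm h)\<^sup>2 * (1 + norm x)\<^sup>2)"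
            by (simp add: power_mult_distrib)
        qed auto
        finally show "norm (f x * phase (y \<bullet> x) - f x * phase (\<xi> \<bullet> x) - f x * phase (\<xi> \<bullet> x) * (- (2 * of_real pi * \<i> * of_real (h \<bullet> x))))
            \<le> (2 * pi\<^sup>2 * (norm h)\<^sup>2) * ((1 + norm x) ^ 2 * norm (f x))" by (simp add: mult_ac)
      qed
      finally have "norm (fourier f y - fourier f \<xi> - D h) \<le> (2 * pi\<^sup>2 * A * norm h) * norm h"
        unfolding integral_mult_right_zero A_def[symmetric] by (simp add: power2_eq_square mult_ac)
      moreover have "norm h > 0" using that by (simp add: h_def)
      ultimately show ?thesis unfolding h_def[symmetric] by (simp add: pos_divide_le_eq)
    qed
    have "((\<lambda>y. 2 * pi\<^sup>2 * A * norm (y - \<xi>)) \<longlongrightarrow> 2 * pi\<^sup>2 * A * norm (\<xi> - \<xi>)) (at \<xi>)"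
      by (intro tendsto_intros)
    then show "((\<lambda>y. 2 * pi\<^sup>2 * A * norm (y - \<xi>)) \<longlongrightarrow> 0) (at \<xi>)" by simp
  qed auto
qed

lemma partial_fourier:
  assumes "rapid f"
  shows "partial i (fourier f) = fourier (\<lambda>x. - (2 * of_real pi * \<i>) * of_real (x $ i) * f x)"
  by (subst partial_eqI[OF fourier_has_derivative[OF assms]])
     (auto simp: fun_eq_iff fourier_phase inner_axis' intro!: Bochner_Integration.integral_cong)

lemma fourier_differentiable: "rapid f \<Longrightarrow> fourier f differentiable at x"
  using fourier_has_derivative unfolding differentiable_def by blast

text \<open>Each partial derivative is again the Fourier transform of a rapid function, hence
  bounded; growth exponent 0 suffices at every order.\<close>

lemma fourier_slowly_growing:
  assumes "rapid f"
  shows "fourier f \<in> slowly_growing"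
proof (rule slowly_growing_coinduct[where A="{fourier f | f. rapid f}"])
  show "partial i g \<in> {fourier f | f. rapid f}" if "g \<in> {fourier f | f. rapid f}" for g :: "real^'a \<Rightarrow> complex" and i
    using that partial_fourier rapid_coord by blast
  show "g differentiable at x" if "g \<in> {fourier f | f. rapid f}" for g :: "real^'a \<Rightarrow> complex" and x
    using that fourier_differentiable by blast
  show "\<exists>N C. \<forall>x. norm (g x) \<le> C * (1 + norm x) ^ N" if "g \<in> {fourier f | f. rapid f}" for g :: "real^'a \<Rightarrow> complex"
  proof -
    obtain f where "g = fourier f" using \<open>g \<in> {fourier f | f. rapid f}\<close> by blast
    then have "\<forall>x. norm (g x) \<le> (LINT x|lborel. norm (f x)) * (1 + norm x) ^ 0" by (simp add: fourier_norm_le)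
    then show ?thesis by blast
  qed
qed (use assms in blast)

section \<open>Fourier transforms of derivatives, and decay\<close>

lemma difference_quotient_seq:
  fixes g :: "real \<Rightarrow> complex"
  assumes "(g has_derivative (\<lambda>h. of_real h * D)) (at 0)"
  shows "(\<lambda>n. of_real (real (Suc n)) * (g (inverse (real (Suc n))) - g 0)) \<longlonglongrightarrow> D"
proof -
  have "((\<lambda>h. norm (g (0 + h) - g 0 - of_real h * D) / norm h) \<longlongrightarrow> 0) (at 0)"
    using assms unfolding has_derivative_at by simp
  moreover have "filterlim (\<lambda>n. inverse (real (Suc n))) (at 0) sequentially"
    unfolding filterlim_at using LIMSEQ_inverse_real_of_nat by auto
  ultimately have "(\<lambda>n. norm (g (0 + inverse (real (Suc n))) - g 0 - of_real (inverse (real (Suc n))) * D) / norm (inverse (real (Suc n)))) \<longlonglongrightarrow> 0"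
    by (rule filterlim_compose)
  moreover have "norm (g (0 + inverse (real (Suc n))) - g 0 - of_real (inverse (real (Suc n))) * D) / norm (inverse (real (Suc n)))
     = norm (of_real (real (Suc n)) * (g (inverse (real (Suc n))) - g 0) - D)" for n
  proof -
    define a where "a = real (Suc n)"
    have a: "a > 0" by (simp add: a_def)
    have "norm (of_real a * (g (inverse a) - g 0) - D) = norm (of_real a * (g (inverse a) - g 0 - of_real (inverse a) * D))"
      using a by (simp add: algebra_simps)
    also have "\<dots> = a * norm (g (inverse a) - g 0 - of_real (inverse a) * D)" using a by (simp add: norm_mult)
    finally show ?thesis using a unfolding a_def[symmetric] by (simp add: divide_inverse)
  qed
  ultimately have "(\<lambda>n. norm (of_real (real (Suc n)) * (g (inverse (real (Suc n))) - g 0) - D)) \<longlonglongrightarrow> 0"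
    by (simp only:)
  then show ?thesis by (subst Lim_null) (rule tendsto_norm_zero_cancel)
qed

lemma has_derivative_line:
  fixes \<phi> :: "real^'n::finite \<Rightarrow> complex"
  assumes "\<phi> \<in> schwartz"
  shows "((\<lambda>t. \<phi> (x + t *\<^sub>R axis i 1)) has_derivative (\<lambda>h. of_real h * partial i \<phi> (x + t *\<^sub>R axis i 1))) (at t)"
proof -
  have l: "linear (frechet_derivative \<phi> (at y))" for y
    by (rule linear_frechet_derivative[OF schwartz_differentiable[OF assms]])
  have "((\<lambda>t. \<phi> (x + t *\<^sub>R axis i 1)) has_derivative (\<lambda>h. frechet_derivative \<phi> (at (x + t *\<^sub>R axis i 1)) (h *\<^sub>R axis i 1))) (at t)"
    by (rule has_derivative_compose[where f="\<lambda>t. x + t *\<^sub>R axis i 1", OF _ has_derivative_frechet])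
       (auto intro!: derivative_eq_intros schwartz_differentiable assms)
  then show ?thesis by (simp add: partial_def linear_scale[OF l] scaleR_conv_of_real[where 'a=complex])
qed

text \<open>Provides an integrable majorant, uniform in h, for the difference quotients of a
  Schwartz function. The mean value theorem bounds the increment by a derivative at a point y within
  distance 1 of x, where the weight has changed by at most the factor 2^N.\<close>

lemma schwartz_increment_bound:
  fixes \<phi> :: "real^'n::finite \<Rightarrow> complex"
  assumes "\<phi> \<in> schwartz"
  obtains C where "\<And>x h. 0 < h \<Longrightarrow> h \<le> 1 \<Longrightarrow> norm (\<phi> (x + h *\<^sub>R axis i 1) - \<phi> x) \<le> h * (C / (1 + norm x) ^ N)"
proof -
  obtain C where C: "C \<ge> 0" "\<And>x. norm (partial i \<phi> x) \<le> C / (1 + norm x) ^ N"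
    by (rule schwartz_bound[OF schwartz_partial[OF assms, of i], of N]) (rule that)
  have "norm (\<phi> (x + h *\<^sub>R axis i 1) - \<phi> x) \<le> h * ((C * 2 ^ N) / (1 + norm x) ^ N)" if h: "0 < h" "h \<le> 1" for x h
  proof -
    have "\<exists>t\<in>{0<..<h}. norm (\<phi> (x + h *\<^sub>R axis i 1) - \<phi> (x + 0 *\<^sub>R axis i 1)) \<le> norm (of_real (h - 0) * partial i \<phi> (x + t *\<^sub>R axis i 1))"
    proof (rule mvt_general[OF h(1)])
      show "continuous_on {0..h} (\<lambda>t. \<phi> (x + t *\<^sub>R axis i 1))"
        by (intro continuous_at_imp_continuous_on ballI has_derivative_continuous[OF has_derivative_line[OF assms]])
    qed (rule has_derivative_line[OF assms])
    then obtain t where t: "0 < t" "t < h" "norm (\<phi> (x + h *\<^sub>R axis i 1) - \<phi> x) \<le> norm (of_real h * partial i \<phi> (x + t *\<^sub>R axis i 1))"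
      by auto
    define y where "y = x + t *\<^sub>R axis i 1"
    have "norm (y - x) \<le> 1" using t h by (simp add: y_def)
    then have "1 + norm x \<le> 2 * (1 + norm y)" using norm_triangle_sub[of x y] norm_ge_zero[of y] norm_minus_commute[of y x] by (smt (verit))
    then have "(1 + norm x) ^ N \<le> (2 * (1 + norm y)) ^ N" by (intro power_mono) auto
    then have "C * (1 + norm x) ^ N \<le> C * (2 ^ N * (1 + norm y) ^ N)" using C(1) by (intro mult_left_mono) (simp_all only: power_mult_distrib)
    moreover have "(1 + norm x) ^ N > 0" "(1 + norm y) ^ N > 0" by (auto intro!: zero_less_power add_pos_nonneg)
    ultimately have "C / (1 + norm y) ^ N \<le> (C * 2 ^ N) / (1 + norm x) ^ N" by (simp add: divide_simps mult_ac)
    then have "h * norm (partial i \<phi> y) \<le> h * ((C * 2 ^ N) / (1 + norm x) ^ N)"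
      using C(2)[of y] h by (intro mult_left_mono) auto
    then show ?thesis using t(3) h by (simp add: norm_mult y_def)
  qed
  then show ?thesis by (rule that)
qed

text \<open>Obtained by translation instead of integration by parts: the Fourier transform of a
  difference quotient is the difference quotient of a phase times
  \<open>fourier \<phi> \<xi>\<close>, and both sides of this identity converge.\<close>

lemma fourier_partial:
  fixes \<phi> :: "real^'n::finite \<Rightarrow> complex"
  assumes \<phi>: "\<phi> \<in> schwartz"
  shows "fourier (partial i \<phi>) \<xi> = 2 * of_real pi * \<i> * of_real (\<xi> $ i) * fourier \<phi> \<xi>"
proof -
  note [measurable] = schwartz_measurable[OF \<phi>] schwartz_measurable[OF schwartz_partial[OF \<phi>]]
  define e where "e = (axis i 1 :: real^'n)"
  define N where "N = 2 * CARD('n)"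
  obtain C where C: "\<And>x h. 0 < h \<Longrightarrow> h \<le> 1 \<Longrightarrow> norm (\<phi> (x + h *\<^sub>R axis i 1) - \<phi> x) \<le> h * (C / (1 + norm x) ^ N)"
    using schwartz_increment_bound[OF \<phi>] by metis
  define s where "s = (\<lambda>n x. of_real (real (Suc n)) * (\<phi> (x + inverse (real (Suc n)) *\<^sub>R e) - \<phi> x) * phase (\<xi> \<bullet> x))"
  have "(\<lambda>n. LINT x|lborel. s n x) \<longlonglongrightarrow> (LINT x|lborel. partial i \<phi> x * phase (\<xi> \<bullet> x))"
  proof (rule integral_dominated_convergence[where w="\<lambda>x. C * (1 / (1 + norm x) ^ N)"])
    show "integrable lborel (\<lambda>x::real^'n. C * (1 / (1 + norm x) ^ N))"
      by (intro integrable_mult_right integrable_inverse_power_norm) (simp add: N_def)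
    show "AE x in lborel. (\<lambda>n. s n x) \<longlonglongrightarrow> partial i \<phi> x * phase (\<xi> \<bullet> x)"
      using difference_quotient_seq[of "\<lambda>t. \<phi> (_ + t *\<^sub>R e)"] has_derivative_line[OF \<phi>, of _ i 0]
      unfolding s_def e_def[symmetric] by (intro AE_I2 tendsto_mult) (auto simp: )
    show "AE x in lborel. norm (s n x) \<le> C * (1 / (1 + norm x) ^ N)" for n
    proof (intro AE_I2)
      fix x :: "real^'n"
      have "inverse (real (Suc n)) \<le> 1" by (simp add: inverse_le_1_iff)
      then have "norm (\<phi> (x + inverse (real (Suc n)) *\<^sub>R e) - \<phi> x) \<le> inverse (real (Suc n)) * (C / (1 + norm x) ^ N)"
        unfolding e_def by (intro C) auto
      then have "real (Suc n) * norm (\<phi> (x + inverse (real (Suc n)) *\<^sub>R e) - \<phi> x) \<le> real (Suc n) * (inverse (real (Suc n)) * (C / (1 + norm x) ^ N))"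
        by (intro mult_left_mono) auto
      then show "norm (s n x) \<le> C * (1 / (1 + norm x) ^ N)"
        by (simp add: s_def norm_mult mult.assoc[symmetric] del: of_nat_Suc)
    qed
  qed (unfold s_def, measurable)
  moreover have "(LINT x|lborel. s n x) = of_real (real (Suc n)) * (phase (- (inverse (real (Suc n)) * \<xi> $ i)) - 1) * fourier \<phi> \<xi>" for n
  proof -
    define h where "h = inverse (real (Suc n))"
    have i1: "integrable lborel (\<lambda>x. \<phi> x * phase (\<xi> \<bullet> x))" by (intro integrable_mult_phase schwartz_integrable0 \<phi>)
    have eq: "\<phi> (x + h *\<^sub>R e) * phase (\<xi> \<bullet> x) = phase (- (h * \<xi> $ i)) * (\<lambda>y. \<phi> y * phase (\<xi> \<bullet> y)) (x + h *\<^sub>R e)" for x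
    proof -
      have "\<xi> \<bullet> x = - (h * \<xi> $ i) + \<xi> \<bullet> (x + h *\<^sub>R e)" by (simp add: inner_add_right e_def inner_axis)
      then have "phase (\<xi> \<bullet> x) = phase (- (h * \<xi> $ i)) * phase (\<xi> \<bullet> (x + h *\<^sub>R e))" by (metis phase_add)
      then show ?thesis by (simp add: mult_ac)
    qed
    have i2: "integrable lborel (\<lambda>x. \<phi> (x + h *\<^sub>R e) * phase (\<xi> \<bullet> x))"
      unfolding eq by (intro integrable_mult_right integrable_lborel_shift i1)
    have "(LINT x|lborel. \<phi> (x + h *\<^sub>R e) * phase (\<xi> \<bullet> x)) = phase (- (h * \<xi> $ i)) * fourier \<phi> \<xi>"
      unfolding eq integral_mult_right_zero fourier_phase by (subst integral_lborel_shift) auto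
    then have "(LINT x|lborel. \<phi> (x + h *\<^sub>R e) * phase (\<xi> \<bullet> x) - \<phi> x * phase (\<xi> \<bullet> x)) = (phase (- (h * \<xi> $ i)) - 1) * fourier \<phi> \<xi>"
      using i1 i2 by (simp add: fourier_phase algebra_simps)
    moreover have "s n = (\<lambda>x. of_real (real (Suc n)) * (\<phi> (x + h *\<^sub>R e) * phase (\<xi> \<bullet> x) - \<phi> x * phase (\<xi> \<bullet> x)))"
      by (simp add: s_def h_def algebra_simps fun_eq_iff)
    ultimately show ?thesis by (simp only: integral_mult_right_zero h_def mult.assoc)
  qed
  moreover have "(\<lambda>n. of_real (real (Suc n)) * (phase (- (inverse (real (Suc n)) * \<xi> $ i)) - 1) * fourier \<phi> \<xi>) \<longlonglongrightarrow> (2 * of_real pi * \<i> * of_real (\<xi> $ i)) * fourier \<phi> \<xi>"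
  proof (rule tendsto_mult[OF _ tendsto_const])
    have "((\<lambda>t. phase (- (t * \<xi> $ i))) has_derivative (\<lambda>h. of_real h * (2 * of_real pi * \<i> * of_real (\<xi> $ i)))) (at 0)"
    proof -
      have "((\<lambda>t. - (2 * of_real pi * \<i> * of_real (- (t * \<xi> $ i)))) has_derivative
          (\<lambda>h. - (2 * of_real pi * \<i> * of_real (- (h * \<xi> $ i))))) (at 0)"
        by (auto intro!: derivative_eq_intros)
      from has_derivative_compose[OF this has_field_derivative_imp_has_derivative[OF DERIV_exp]]
      show ?thesis by (simp add: phase_def mult_ac)
    qed
    from difference_quotient_seq[OF this]
    show "(\<lambda>n. of_real (real (Suc n)) * (phase (- (inverse (real (Suc n)) * \<xi> $ i)) - 1)) \<longlonglongrightarrow> 2 * of_real pi * \<i> * of_real (\<xi> $ i)" by simp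
  qed
  ultimately show ?thesis unfolding fourier_phase[of "partial i \<phi>"] by (simp only:) (rule LIMSEQ_unique)
qed

text \<open>Every further power of |\<xi>| is paid for with one partial derivative of \<phi>. The
  dependence on \<phi> is kept as a seminorm because it later yields continuity of distributions
  given on the Fourier side.\<close>

lemma fourier_decay:
  "\<exists>C N. 0 \<le> C \<and> (\<forall>\<phi>\<in>schwartz. \<forall>\<xi>::real^'n::finite. (1 + norm \<xi>) ^ m * norm (fourier \<phi> \<xi>) \<le> C * schwartz_seminorm N \<phi>)"
proof (induction m)
  case 0
  define N where "N = 2 * CARD('n)"
  define C where "C = (LINT x|lborel. 1 / (1 + norm (x::real^'n)) ^ N)"
  have i: "integrable lborel (\<lambda>x::real^'n. 1 / (1 + norm x) ^ N)"
    by (rule integrable_inverse_power_norm) (simp add: N_def)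
  have "norm (fourier \<phi> \<xi>) \<le> C * schwartz_seminorm N \<phi>" if \<phi>: "\<phi> \<in> schwartz" for \<phi> and \<xi> :: "real^'n"
  proof -
    have "norm (fourier \<phi> \<xi>) \<le> (LINT x|lborel. norm (\<phi> x))" by (rule fourier_norm_le)
    also have "\<dots> \<le> (LINT x|lborel. schwartz_seminorm N \<phi> * (1 / (1 + norm (x::real^'n)) ^ N))"
    proof (intro Bochner_Integration.integral_mono integrable_norm schwartz_integrable0 \<phi> integrable_mult_right i)
      fix x :: "real^'n"
      have "(1 + norm x) ^ N > 0" by (auto intro!: zero_less_power add_pos_nonneg)
      then show "norm (\<phi> x) \<le> schwartz_seminorm N \<phi> * (1 / (1 + norm x) ^ N)"
        using schwartz_seminorm_upper[OF \<phi>, of "[]" N x] by (simp add: pos_le_divide_eq mult.commute)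
    qed
    also have "\<dots> = C * schwartz_seminorm N \<phi>" unfolding C_def integral_mult_right_zero by simp
    finally show ?thesis .
  qed
  moreover have "0 \<le> C" unfolding C_def by (intro integral_nonneg_AE) auto
  ultimately show ?case by auto
next
  case (Suc m)
  then obtain C N where C: "0 \<le> C" "\<And>\<phi> \<xi>. \<phi> \<in> schwartz \<Longrightarrow> (1 + norm (\<xi>::real^'n)) ^ m * norm (fourier \<phi> \<xi>) \<le> C * schwartz_seminorm N \<phi>"
    by blast
  have "(1 + norm \<xi>) ^ Suc m * norm (fourier \<phi> \<xi>) \<le> ((1 + real CARD('n)) * C) * schwartz_seminorm (Suc N) \<phi>"
    if \<phi>: "\<phi> \<in> schwartz" for \<phi> and \<xi> :: "real^'n"
  proof -
    define P where "P = (1 + norm \<xi>) ^ m"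
    have P: "P \<ge> 0" by (simp add: P_def)
    \<comment> \<open>|\<xi>| is bounded by the sum of the |\<xi>_i|, so that each summand can be
      traded for a derivative in one coordinate direction.\<close>
    have "1 + norm \<xi> \<le> 1 + (\<Sum>i\<in>UNIV. \<bar>\<xi> $ i\<bar>)" using norm_le_l1_cart[of \<xi>] by simp
    then have "(1 + norm \<xi>) * (P * norm (fourier \<phi> \<xi>)) \<le> (1 + (\<Sum>i\<in>UNIV. \<bar>\<xi> $ i\<bar>)) * (P * norm (fourier \<phi> \<xi>))"
      using P by (intro mult_right_mono) auto
    also have "\<dots> = P * norm (fourier \<phi> \<xi>) + (\<Sum>i\<in>UNIV. P * (\<bar>\<xi> $ i\<bar> * norm (fourier \<phi> \<xi>)))"
      by (simp add: distrib_left distrib_right sum_distrib_left sum_distrib_right mult_ac)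
    also have "\<dots> \<le> C * schwartz_seminorm (Suc N) \<phi> + (\<Sum>i\<in>(UNIV::'n set). C * schwartz_seminorm (Suc N) \<phi>)"
    proof (intro add_mono sum_mono)
      show "P * norm (fourier \<phi> \<xi>) \<le> C * schwartz_seminorm (Suc N) \<phi>"
        unfolding P_def by (rule order_trans[OF C(2)[OF \<phi>]]) (intro mult_left_mono schwartz_seminorm_Suc \<phi> C(1))
      fix i
      \<comment> \<open>Lets the factor 2 pi produced by the derivative be discarded.\<close>
      have "1 \<le> 2 * pi" using pi_gt3 by simp
      then have "1 * (\<bar>\<xi> $ i\<bar> * norm (fourier \<phi> \<xi>)) \<le> (2 * pi) * (\<bar>\<xi> $ i\<bar> * norm (fourier \<phi> \<xi>))"
        by (intro mult_right_mono) auto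
      also have "\<dots> = norm (fourier (partial i \<phi>) \<xi>)" by (simp add: fourier_partial[OF \<phi>] norm_mult)
      finally have "P * (\<bar>\<xi> $ i\<bar> * norm (fourier \<phi> \<xi>)) \<le> P * norm (fourier (partial i \<phi>) \<xi>)"
        using P by (intro mult_left_mono) auto
      also have "\<dots> \<le> C * schwartz_seminorm N (partial i \<phi>)"
        unfolding P_def by (rule C(2)[OF schwartz_partial[OF \<phi>]])
      also have "\<dots> \<le> C * schwartz_seminorm (Suc N) \<phi>"
        by (intro mult_left_mono schwartz_seminorm_partial \<phi> C(1))
      finally show "P * (\<bar>\<xi> $ i\<bar> * norm (fourier \<phi> \<xi>)) \<le> C * schwartz_seminorm (Suc N) \<phi>" .
    qed
    also have "\<dots> = ((1 + real CARD('n)) * C) * schwartz_seminorm (Suc N) \<phi>" by (simp add: algebra_simps)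
    finally show ?thesis by (simp add: P_def mult.assoc)
  qed
  moreover have "0 \<le> (1 + real CARD('n)) * C" using C(1) by simp
  ultimately show ?case by blast
qed

lemma schwartz_coord: "\<phi> \<in> schwartz \<Longrightarrow> (\<lambda>x. c * of_real (x $ i) * \<phi> x) \<in> schwartz"
  using schwartz_cmult[OF slowly_growing_mult_schwartz[OF slowly_growing_coord]] by (simp add: mult.assoc)

lemma fourier_schwartz:
  assumes "\<phi> \<in> schwartz"
  shows "fourier \<phi> \<in> schwartz"
proof (rule schwartz_coinduct[where A="fourier ` schwartz"])
  show "partial i g \<in> fourier ` schwartz" if g: "g \<in> fourier ` schwartz" for g :: "real^'a \<Rightarrow> complex" and i
  proof -
    obtain \<psi> where "g = fourier \<psi>" "\<psi> \<in> schwartz" using g by auto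
    then show ?thesis using partial_fourier[OF schwartz_rapid, of \<psi> i]
        schwartz_coord[of \<psi> "- (2 * of_real pi * \<i>)" i] by (simp only:) blast
  qed
  show "g differentiable at x" if "g \<in> fourier ` schwartz" for g :: "real^'a \<Rightarrow> complex" and x
    using that fourier_differentiable[OF schwartz_rapid] by auto
  show "\<exists>C. \<forall>x. (1 + norm x) ^ m * norm (g x) \<le> C" if g: "g \<in> fourier ` schwartz" for g :: "real^'a \<Rightarrow> complex" and m
    using g fourier_decay[of m, where 'n='a] by blast
qed (use assms in auto)

lemma fourier_inv_reflect:
  assumes "\<phi> \<in> schwartz"
  shows "fourier_inv \<phi> = fourier (\<lambda>x. \<phi> (- x))"
  by (simp add: fun_eq_iff fourier_inv_fourier fourier_reflect[OF schwartz_measurable[OF assms]])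

lemma fourier_inv_schwartz: "\<phi> \<in> schwartz \<Longrightarrow> fourier_inv \<phi> \<in> schwartz"
  by (simp add: fourier_inv_reflect fourier_schwartz schwartz_reflect)

lemma fourier_inv_decay:
  "\<exists>C N. 0 \<le> C \<and> (\<forall>\<phi>\<in>schwartz. \<forall>\<xi>::real^'n::finite. (1 + norm \<xi>) ^ m * norm (fourier_inv \<phi> \<xi>) \<le> C * schwartz_seminorm N \<phi>)"
  using fourier_decay[of m, where 'n='n] unfolding fourier_inv_fourier by (metis norm_minus_cancel)

section \<open>Fourier inversion\<close>

text \<open>The common hypothesis for Fubini: a tensor product of integrable functions times a
  bounded kernel, which is a phase in some uses and the constant 1 in others.\<close>

lemma integrable_pair_bounded:
  fixes f :: "'a::euclidean_space \<Rightarrow> complex" and g :: "'b::euclidean_space \<Rightarrow> complex"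
  assumes f: "integrable lborel f" and g: "integrable lborel g"
    and [measurable]: "(\<lambda>(x, y). K x y) \<in> borel_measurable (borel \<Otimes>\<^sub>M borel)"
    and K: "\<And>x y. norm (K x y :: complex) \<le> 1"
  shows "integrable (lborel \<Otimes>\<^sub>M lborel) (\<lambda>(x, y). f x * g y * K x y)"
proof (rule integrableI_bounded)
  have [measurable]: "f \<in> borel_measurable borel" "g \<in> borel_measurable borel" using f g by auto
  show m: "(\<lambda>(x, y). f x * g y * K x y) \<in> borel_measurable (lborel \<Otimes>\<^sub>M lborel)" by measurable
  have "(\<integral>\<^sup>+z. ennreal (norm (case z of (x, y) \<Rightarrow> f x * g y * K x y)) \<partial>(lborel \<Otimes>\<^sub>M lborel))
     = (\<integral>\<^sup>+x. (\<integral>\<^sup>+y. ennreal (norm (f x * g y * K x y)) \<partial>lborel) \<partial>lborel)"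
    by (subst lborel.nn_integral_fst[symmetric]) (use m in auto)
  also have "\<dots> \<le> (\<integral>\<^sup>+x. (\<integral>\<^sup>+y. ennreal (norm (f x)) * ennreal (norm (g y)) \<partial>lborel) \<partial>lborel)"
  proof (intro nn_integral_mono)
    fix x y
    have "norm (f x * g y * K x y) \<le> norm (f x) * norm (g y) * 1"
      unfolding norm_mult by (intro mult_left_mono K) auto
    then show "ennreal (norm (f x * g y * K x y)) \<le> ennreal (norm (f x)) * ennreal (norm (g y))"
      by (simp add: ennreal_mult'[symmetric] ennreal_leI)
  qed
  also have "\<dots> = (\<integral>\<^sup>+x. ennreal (norm (f x)) \<partial>lborel) * (\<integral>\<^sup>+y. ennreal (norm (g y)) \<partial>lborel)"
    by (simp add: nn_integral_cmult nn_integral_multc)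
  also have "\<dots> < \<infinity>"
    using f g by (simp add: integrable_iff_bounded ennreal_mult_less_top)
  finally show "(\<integral>\<^sup>+z. ennreal (norm (case z of (x, y) \<Rightarrow> f x * g y * K x y)) \<partial>(lborel \<Otimes>\<^sub>M lborel)) < \<infinity>" .
qed

text \<open>The phase is symmetric in its two variables, so Fubini moves the transform from one
  factor to the other.\<close>

lemma fourier_multiplication:
  fixes f g :: "real^'n::finite \<Rightarrow> complex"
  assumes f: "integrable lborel f" and g: "integrable lborel g"
  shows "(LINT \<xi>|lborel. fourier f \<xi> * g \<xi>) = (LINT x|lborel. f x * fourier g x)"
proof -
  have "integrable (lborel \<Otimes>\<^sub>M lborel) (\<lambda>(x, y). f x * g y * phase (y \<bullet> x))"
    by (rule integrable_pair_bounded[OF f g]) auto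
  from lborel_pair.Fubini_integral[OF this]
  have "(LINT y|lborel. (LINT x|lborel. f x * g y * phase (y \<bullet> x))) = (LINT x|lborel. (LINT y|lborel. f x * g y * phase (y \<bullet> x)))" .
  moreover have "(LINT x|lborel. f x * g y * phase (y \<bullet> x)) = fourier f y * g y" for y
    unfolding fourier_phase by (subst integral_mult_left_zero[symmetric]) (simp add: mult_ac)
  moreover have "(LINT y|lborel. f x * g y * phase (y \<bullet> x)) = f x * fourier g x" for x
    unfolding fourier_phase by (subst integral_mult_right_zero[symmetric]) (simp add: mult_ac inner_commute)
  ultimately show ?thesis by simp
qed

lemma heat_kernel_even: "heat_kernel r (x - y) = heat_kernel r (y - x)"
  by (simp add: heat_kernel_def norm_minus_commute)

text \<open>The multiplication formula for a modulated Gaussian, whose transform is the heat kernel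
  centred at x. This regularised inversion formula needs only that f is integrable.\<close>

lemma fourier_inv_gauss_conv:
  fixes f :: "real^'n::finite \<Rightarrow> complex"
  assumes f: "integrable lborel f" and c: "c > 0"
  shows "fourier_inv (\<lambda>\<xi>. fourier f \<xi> * of_real (gauss c \<xi>)) x = (LINT y|lborel. f y * of_real (heat_kernel c (x - y)))"
proof -
  define g where "g = (\<lambda>\<xi>. of_real (gauss c \<xi>) * phase (- (x \<bullet> \<xi>)))"
  have ig: "integrable lborel (\<lambda>\<xi>::real^'n. complex_of_real (gauss c \<xi>))"
    using gauss_integrable(1)[OF c, where 'n='n] by (simp add: complex_of_real_integrable_eq)
  have fg: "fourier g y = of_real (heat_kernel c (x - y))" for y
  proof -
    have "fourier g y = fourier (\<lambda>\<xi>. of_real (gauss c \<xi>)) (y - x)"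
      unfolding fourier_phase g_def
      by (intro Bochner_Integration.integral_cong) (auto simp: mult.assoc phase_add[symmetric] inner_diff_left)
    then show ?thesis by (simp only: fourier_gauss[OF c] heat_kernel_even[of c x y])
  qed
  have "fourier_inv (\<lambda>\<xi>. fourier f \<xi> * of_real (gauss c \<xi>)) x = (LINT \<xi>|lborel. fourier f \<xi> * g \<xi>)"
    by (simp add: fourier_inv_phase g_def mult_ac)
  also have "\<dots> = (LINT y|lborel. f y * fourier g y)"
    by (rule fourier_multiplication[OF f]) (unfold g_def, rule integrable_mult_phase[OF ig])
  also have "\<dots> = (LINT y|lborel. f y * of_real (heat_kernel c (x - y)))" by (simp only: fg)
  finally show ?thesis .
qed

lemma integral_lborel_scale:
  fixes f :: "'a::euclidean_space \<Rightarrow> complex"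
  assumes [measurable]: "f \<in> borel_measurable borel" and c: "c > 0"
  shows "(LINT x|lborel. f x) = (LINT x|lborel. of_real (c ^ DIM('a)) * f (c *\<^sub>R x))"
proof -
  have "(LINT x|lborel. f x) = (LINT x|density (distr lborel borel (\<lambda>x. 0 + c *\<^sub>R x)) (\<lambda>_. ennreal (c ^ DIM('a))). f x)"
    using c by (subst lborel_affine[of c 0]) auto
  also have "\<dots> = (LINT x|distr lborel borel (\<lambda>x. 0 + c *\<^sub>R x). c ^ DIM('a) *\<^sub>R f x)"
    by (rule integral_density) (use c in auto)
  also have "\<dots> = (LINT x|lborel. c ^ DIM('a) *\<^sub>R f (0 + c *\<^sub>R x))"
    by (rule integral_distr) auto
  finally show ?thesis by (simp only: scaleR_conv_of_real add_0)
qed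

text \<open>The substitution y = x - sqrt r z moves r out of the kernel into the argument of f;
  dominated convergence then only needs f to be continuous and bounded.\<close>

lemma heat_kernel_approx_identity:
  fixes f :: "real^'n::finite \<Rightarrow> complex"
  assumes f: "continuous_on UNIV f" and B: "\<And>x. norm (f x) \<le> B"
  shows "(\<lambda>j. LINT y|lborel. f y * of_real (heat_kernel (inverse (real (Suc j))) (x - y))) \<longlonglongrightarrow> f x"
proof -
  have [measurable]: "f \<in> borel_measurable borel" by (rule borel_measurable_continuous_onI[OF f])
  have eq: "(LINT y|lborel. f y * of_real (heat_kernel r (x - y))) = (LINT z|lborel. f (x - sqrt r *\<^sub>R z) * of_real (heat_kernel 1 z))"
    if r: "r > 0" for r
  proof -
    have "(LINT y|lborel. f y * of_real (heat_kernel r (x - y))) = (LINT z|lborel. (\<lambda>y. f y * of_real (heat_kernel r (x - y))) (x - z))"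
      by (rule integral_lborel_reflect[symmetric]) measurable
    also have "\<dots> = (LINT z|lborel. f (x - z) * of_real (heat_kernel r z))" by simp
    also have "\<dots> = (LINT z|lborel. of_real (sqrt r ^ CARD('n)) * (f (x - sqrt r *\<^sub>R z) * of_real (heat_kernel r (sqrt r *\<^sub>R z))))"
      using r by (subst integral_lborel_scale[where c="sqrt r"]) auto
    also have "\<dots> = (LINT z|lborel. f (x - sqrt r *\<^sub>R z) * of_real (heat_kernel 1 z))"
    proof (intro Bochner_Integration.integral_cong refl)
      fix z :: "real^'n"
      have "sqrt r ^ CARD('n) * r powr (- real CARD('n) / 2) = 1"
      proof -
        have "sqrt r ^ CARD('n) = r powr (real CARD('n) / 2)"
          using r by (simp add: powr_half_sqrt[symmetric] powr_power)
        then show ?thesis using r by (simp add: powr_add[symmetric])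
      qed
      then have "sqrt r ^ CARD('n) * heat_kernel r (sqrt r *\<^sub>R z) = heat_kernel 1 z"
        using r by (simp add: heat_kernel_def power_mult_distrib mult.assoc[symmetric])
      then show "of_real (sqrt r ^ CARD('n)) * (f (x - sqrt r *\<^sub>R z) * of_real (heat_kernel r (sqrt r *\<^sub>R z))) = f (x - sqrt r *\<^sub>R z) * of_real (heat_kernel 1 z)"
        by (simp only: of_real_mult[symmetric] mult.assoc[symmetric] mult.commute[of _ "f _"])
           (simp only: of_real_mult[symmetric] mult.assoc)
    qed
    finally show ?thesis .
  qed
  have "(\<lambda>j. LINT z|lborel. f (x - sqrt (inverse (real (Suc j))) *\<^sub>R z) * of_real (heat_kernel 1 z)) \<longlonglongrightarrow> (LINT z|lborel. f x * of_real (heat_kernel 1 (z::real^'n)))"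
  proof (rule integral_dominated_convergence[where w="\<lambda>z. B * heat_kernel 1 z"])
    show "integrable lborel (\<lambda>z::real^'n. B * heat_kernel 1 z)" by (intro integrable_mult_right heat_kernel_integrable) auto
    show "AE z in lborel. (\<lambda>j. f (x - sqrt (inverse (real (Suc j))) *\<^sub>R z) * of_real (heat_kernel 1 z)) \<longlonglongrightarrow> f x * of_real (heat_kernel 1 (z::real^'n))"
    proof (intro AE_I2 tendsto_mult tendsto_const)
      fix z :: "real^'n"
      have "(\<lambda>j. x - sqrt (inverse (real (Suc j))) *\<^sub>R z) \<longlonglongrightarrow> x - sqrt 0 *\<^sub>R z"
        by (intro tendsto_intros LIMSEQ_inverse_real_of_nat)
      then have "(\<lambda>j. x - sqrt (inverse (real (Suc j))) *\<^sub>R z) \<longlonglongrightarrow> x" by simp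
      moreover have "isCont f x" using f by (simp add: continuous_on_eq_continuous_at)
      ultimately show "(\<lambda>j. f (x - sqrt (inverse (real (Suc j))) *\<^sub>R z)) \<longlonglongrightarrow> f x"
        by (rule isCont_tendsto_compose[rotated])
    qed
    show "AE z in lborel. norm (f (x - sqrt (inverse (real (Suc j))) *\<^sub>R z) * of_real (heat_kernel 1 z)) \<le> B * heat_kernel 1 z" for j
      by (intro AE_I2) (auto simp: norm_mult intro!: mult_right_mono B)
  qed measurable
  moreover have "(LINT z|lborel. f x * of_real (heat_kernel 1 (z::real^'n))) = f x"
    unfolding integral_mult_right_zero integral_complex_of_real heat_kernel_integrable(2)[OF zero_less_one] by simp
  moreover have "(LINT y|lborel. f y * of_real (heat_kernel (inverse (real (Suc j))) (x - y)))
      = (LINT z|lborel. f (x - sqrt (inverse (real (Suc j))) *\<^sub>R z) * of_real (heat_kernel 1 z))" for j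
    by (rule eq) simp
  ultimately show ?thesis by (simp only:)
qed

text \<open>The Gaussian-regularised inverse transform has two limits: \<phi> by the approximate
  identity, and the unregularised integral by dominated convergence, as
  \<open>fourier \<phi>\<close> is integrable.\<close>

theorem fourier_inversion:
  fixes \<phi> :: "real^'n::finite \<Rightarrow> complex"
  assumes \<phi>: "\<phi> \<in> schwartz"
  shows "fourier_inv (fourier \<phi>) = \<phi>"
proof
  fix x :: "real^'n"
  have F: "fourier \<phi> \<in> schwartz" by (rule fourier_schwartz[OF \<phi>])
  note [measurable] = schwartz_measurable[OF F]
  obtain B where B: "\<And>x. norm (\<phi> x) \<le> B / (1 + norm x) ^ 0" by (rule schwartz_bound[OF \<phi>, of 0]) (rule that)
  have "(\<lambda>j. LINT y|lborel. \<phi> y * of_real (heat_kernel (inverse (real (Suc j))) (x - y))) \<longlonglongrightarrow> \<phi> x"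
    by (rule heat_kernel_approx_identity[OF schwartz_continuous[OF \<phi>], of B]) (use B in simp)
  then have "(\<lambda>j. fourier_inv (\<lambda>\<xi>. fourier \<phi> \<xi> * of_real (gauss (inverse (real (Suc j))) \<xi>)) x) \<longlonglongrightarrow> \<phi> x"
    by (subst fourier_inv_gauss_conv[OF schwartz_integrable0[OF \<phi>]]) auto
  moreover have "(\<lambda>j. fourier_inv (\<lambda>\<xi>. fourier \<phi> \<xi> * of_real (gauss (inverse (real (Suc j))) \<xi>)) x) \<longlonglongrightarrow> fourier_inv (fourier \<phi>) x"
    unfolding fourier_inv_phase
  proof (rule integral_dominated_convergence[where w="\<lambda>\<xi>. norm (fourier \<phi> \<xi>)"])
    show "integrable lborel (\<lambda>\<xi>. norm (fourier \<phi> \<xi>))" by (intro integrable_norm schwartz_integrable0 F)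
    show "AE \<xi> in lborel. (\<lambda>j. fourier \<phi> \<xi> * of_real (gauss (inverse (real (Suc j))) \<xi>) * phase (- (x \<bullet> \<xi>))) \<longlonglongrightarrow> fourier \<phi> \<xi> * phase (- (x \<bullet> \<xi>))"
    proof (intro AE_I2)
      fix \<xi> :: "real^'n"
      have "(\<lambda>j. gauss (inverse (real (Suc j))) \<xi>) \<longlonglongrightarrow> exp (- pi * 0 * (norm \<xi>)\<^sup>2)"
        unfolding gauss_def by (intro tendsto_intros LIMSEQ_inverse_real_of_nat)
      then have "(\<lambda>j. fourier \<phi> \<xi> * of_real (gauss (inverse (real (Suc j))) \<xi>) * phase (- (x \<bullet> \<xi>))) \<longlonglongrightarrow> fourier \<phi> \<xi> * of_real (exp (- pi * 0 * (norm \<xi>)\<^sup>2)) * phase (- (x \<bullet> \<xi>))"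
        by (intro tendsto_intros)
      then show "(\<lambda>j. fourier \<phi> \<xi> * of_real (gauss (inverse (real (Suc j))) \<xi>) * phase (- (x \<bullet> \<xi>))) \<longlonglongrightarrow> fourier \<phi> \<xi> * phase (- (x \<bullet> \<xi>))" by simp
    qed
    show "AE \<xi> in lborel. norm (fourier \<phi> \<xi> * of_real (gauss (inverse (real (Suc j))) \<xi>) * phase (- (x \<bullet> \<xi>))) \<le> norm (fourier \<phi> \<xi>)" for j
      by (intro AE_I2) (auto simp: norm_mult gauss_def intro!: mult_left_le)
  qed measurable
  ultimately show "fourier_inv (fourier \<phi>) x = \<phi> x" by (rule LIMSEQ_unique[rotated])
qed

theorem fourier_fourier_inv:
  assumes \<phi>: "\<phi> \<in> schwartz"
  shows "fourier (fourier_inv \<phi>) = \<phi>"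
proof
  fix x
  have "fourier (fourier_inv \<phi>) x = fourier_inv (fourier (\<lambda>x. \<phi> (- x))) (- x)"
    by (simp add: fourier_inv_fourier fourier_inv_reflect[OF \<phi>])
  also have "\<dots> = \<phi> x" by (simp add: fourier_inversion schwartz_reflect \<phi>)
  finally show "fourier (fourier_inv \<phi>) x = \<phi> x" .
qed

section \<open>Density of Schwartz functions in weighted spaces\<close>

text \<open>The approximants are heat convolutions of f. Defined on the Fourier side, they are
  Schwartz because a slowly growing function times a Gaussian is. The uniform majorant comes from
  the semigroup law, since \<open>gauss 1\<close> is the heat kernel with parameter 1 and
  convolution raises the parameter to r + 1 \<le> 2.\<close>

lemma schwartz_approx_continuous:
  fixes f :: "real^'n::finite \<Rightarrow> complex"
  assumes f: "continuous_on UNIV f" and C: "\<And>x. norm (f x) \<le> C * gauss 1 x"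
  obtains \<phi> where "\<And>j. \<phi> j \<in> schwartz" "\<And>x. (\<lambda>j. \<phi> j x) \<longlonglongrightarrow> f x" "\<And>j x. norm (\<phi> j x) \<le> C * gauss (1/2) x"
proof -
  have [measurable]: "f \<in> borel_measurable borel" by (rule borel_measurable_continuous_onI[OF f])
  have C0: "C \<ge> 0" using order_trans[OF norm_ge_zero C[of 0]] by (simp add: gauss_def)
  have g: "(\<lambda>x::real^'n. complex_of_real (gauss 1 x)) \<in> schwartz" by (rule gauss_schwartz) simp
  have rf: "rapid f"
    by (rule rapid_bound[OF schwartz_rapid[OF g], of _ C 0]) (use C in \<open>auto simp: gauss_def\<close>)
  define \<phi> where "\<phi> = (\<lambda>j. fourier_inv (\<lambda>\<xi>. fourier f \<xi> * of_real (gauss (inverse (real (Suc j))) \<xi>)))"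
  have eq: "\<phi> j x = (LINT y|lborel. f y * of_real (heat_kernel (inverse (real (Suc j))) (x - y)))" for j x
    unfolding \<phi>_def by (rule fourier_inv_gauss_conv[OF rapid_integrable[OF rf]]) simp
  have "norm (f x) \<le> C" for x
    by (rule order_trans[OF C]) (use C0 in \<open>auto simp: gauss_def intro!: mult_left_le\<close>)
  then have lim: "(\<lambda>j. \<phi> j x) \<longlonglongrightarrow> f x" for x
    unfolding eq by (rule heat_kernel_approx_identity[OF f])
  have bd: "norm (\<phi> j x) \<le> C * gauss (1/2) x" for j x
  proof -
    define r where "r = inverse (real (Suc j))"
    have r: "0 < r" "r \<le> 1" unfolding r_def by (auto simp: inverse_le_1_iff)
    have nn: "(\<integral>\<^sup>+y. ennreal (C * (heat_kernel r (x - y) * heat_kernel 1 y)) \<partial>lborel) = ennreal (C * heat_kernel (r + 1) x)"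
      using C0 heat_kernel_semigroup[of r 1 x] r by (simp add: ennreal_mult' nn_integral_cmult)
    have "has_bochner_integral lborel (\<lambda>y. C * (heat_kernel r (x - y) * heat_kernel 1 y)) (C * heat_kernel (r + 1) x)"
      by (rule has_bochner_integral_nn_integral[OF _ _ _ nn]) (use C0 in auto)
    then have i: "integrable lborel (\<lambda>y. C * (heat_kernel r (x - y) * heat_kernel 1 y))" "(LINT y|lborel. C * (heat_kernel r (x - y) * heat_kernel 1 y)) = C * heat_kernel (r + 1) x"
      by (auto simp: has_bochner_integral_iff)
    have "norm (\<phi> j x) \<le> (LINT y|lborel. norm (f y * of_real (heat_kernel r (x - y))))"
      unfolding eq r_def by (rule integral_norm_bound)
    also have "\<dots> \<le> (LINT y|lborel. C * (heat_kernel r (x - y) * heat_kernel 1 y))"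
    proof (rule integral_mono_AE')
      show "AE y in lborel. norm (f y * of_real (heat_kernel r (x - y))) \<le> C * (heat_kernel r (x - y) * heat_kernel 1 y)"
      proof (intro AE_I2)
        fix y :: "real^'n"
        have "norm (f y) * heat_kernel r (x - y) \<le> C * gauss 1 y * heat_kernel r (x - y)" by (intro mult_right_mono C) simp
        then show "norm (f y * of_real (heat_kernel r (x - y))) \<le> C * (heat_kernel r (x - y) * heat_kernel 1 y)"
          by (simp add: norm_mult heat_kernel_gauss[of 1] mult_ac)
      qed
      show "AE y in lborel. 0 \<le> C * (heat_kernel r (x - y) * heat_kernel 1 y)" using C0 by simp
    qed (rule i(1))
    also have "\<dots> = C * heat_kernel (r + 1) x" by (rule i(2))
    also have "\<dots> \<le> C * gauss (1/2) x"
    proof (intro mult_left_mono C0)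
      have "(r + 1) powr (- real CARD('n) / 2) \<le> 1"
        using r by (simp add: powr_minus_divide ge_one_powr_ge_zero)
      moreover have "exp (- pi * (norm x)\<^sup>2 / (r + 1)) \<le> exp (- pi * (norm x)\<^sup>2 / 2)"
      proof -
        have "(norm x)\<^sup>2 / 2 \<le> (norm x)\<^sup>2 / (r + 1)" using r by (intro divide_left_mono) auto
        then have "pi * ((norm x)\<^sup>2 / 2) \<le> pi * ((norm x)\<^sup>2 / (r + 1))" by (intro mult_left_mono) auto
        then show ?thesis by simp
      qed
      ultimately have "(r + 1) powr (- real CARD('n) / 2) * exp (- pi * (norm x)\<^sup>2 / (r + 1)) \<le> 1 * exp (- pi * (norm x)\<^sup>2 / 2)"
        by (intro mult_mono) auto
      then show "heat_kernel (r + 1) x \<le> gauss (1/2) x" by (simp add: heat_kernel_def gauss_def)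
    qed
    finally show ?thesis .
  qed
  have "\<phi> j \<in> schwartz" for j
    unfolding \<phi>_def by (intro fourier_inv_schwartz slowly_growing_mult_schwartz fourier_slowly_growing rf gauss_schwartz) simp
  then show ?thesis using that lim bd by blast
qed

text \<open>Measurability in the sense of the gauge integral is by definition approximability by
  continuous functions off a negligible set. That set is covered by a Borel null set.\<close>

lemma measurable_continuous_approx:
  fixes \<Phi> :: "real^'n::finite \<Rightarrow> complex"
  assumes [measurable]: "\<Phi> \<in> borel_measurable borel"
  obtains g where "\<And>j. continuous_on UNIV (g j)" "AE x in lborel. (\<lambda>j::nat. g j x) \<longlonglongrightarrow> \<Phi> x"
proof -
  have "\<Phi> \<in> borel_measurable lebesgue" by (simp add: measurable_completion)
  then have "\<Phi> measurable_on UNIV" by (rule lebesgue_measurable_imp_measurable_on) auto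
  then obtain N g where N: "negligible N" and g: "\<And>j::nat. continuous_on UNIV (g j)"
    "\<And>x. x \<notin> N \<Longrightarrow> (\<lambda>j. g j x) \<longlonglongrightarrow> \<Phi> x"
    unfolding measurable_on_def by auto
  obtain N' where "N' \<in> null_sets lborel" "N \<subseteq> N'"
    using N by (auto simp: negligible_iff_null_sets null_sets_completion_iff2)
  then have "AE x in lborel. (\<lambda>j. g j x) \<longlonglongrightarrow> \<Phi> x"
    using g(2) by (intro AE_I'[of N']) auto
  then show ?thesis using that g(1) by blast
qed

text \<open>Two approximations are composed: \<Phi> by continuous functions, and one of these by
  Schwartz functions. All functions involved stay below a multiple of \<open>gauss (1/2)\<close>,
  which is why integrability of w against this Gaussian is what dominated convergence asks of the
  weight.\<close>

lemma schwartz_dense_bounded: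
  fixes w :: "real^'n::finite \<Rightarrow> real" and \<Phi> :: "real^'n \<Rightarrow> complex"
  assumes [measurable]: "w \<in> borel_measurable borel" and w: "\<And>x. 0 \<le> w x" "integrable lborel (\<lambda>x. w x * gauss (1/2) x)"
    and [measurable]: "\<Phi> \<in> borel_measurable borel" and \<Phi>: "\<And>x. norm (\<Phi> x) \<le> 1" "\<And>x. norm x > R \<Longrightarrow> \<Phi> x = 0"
    and e: "e > 0"
  obtains \<phi> where "\<phi> \<in> schwartz" "integrable lborel (\<lambda>x. w x * norm (\<phi> x - \<Phi> x))" "(LINT x|lborel. w x * norm (\<phi> x - \<Phi> x)) < e"
proof -
  obtain g where g: "\<And>j. continuous_on UNIV (g j)" "AE x in lborel. (\<lambda>j::nat. g j x) \<longlonglongrightarrow> \<Phi> x"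
    using measurable_continuous_approx[of \<Phi>] by auto
  \<comment> \<open>Equal to 1 on the ball of radius R and 0 beyond radius R + 1. Together with the
    division by max 1 |g j x| below, it forces the approximants to be bounded by 1 and compactly
    supported without changing their limit.\<close>
  define cut where "cut = (\<lambda>x::real^'n. max 0 (min 1 (R + 1 - norm x)))"
  define h where "h = (\<lambda>j x. of_real (cut x / max 1 (norm (g j x))) * g j x)"
  have hc: "continuous_on UNIV (h j)" for j
    unfolding h_def cut_def by (intro continuous_intros g) (auto simp: max_def)
  have [measurable]: "h j \<in> borel_measurable borel" for j by (rule borel_measurable_continuous_onI[OF hc])
  \<comment> \<open>Makes \<open>C * gauss 1\<close> at least 1 on the ball of radius |R| + 1; the
    absolute value covers negative R.\<close>
  define C where "C = exp (pi * (\<bar>R\<bar> + 1)\<^sup>2)"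
  have C1: "C \<ge> 0" by (simp add: C_def)
  have C: "1 \<le> C * gauss 1 x" if "norm x \<le> R + 1" for x :: "real^'n"
  proof -
    have "(norm x)\<^sup>2 \<le> (\<bar>R\<bar> + 1)\<^sup>2" using that by (intro power_mono) auto
    then have "pi * (norm x)\<^sup>2 \<le> pi * (\<bar>R\<bar> + 1)\<^sup>2" by (intro mult_left_mono) auto
    then show ?thesis by (simp add: C_def gauss_def exp_add[symmetric])
  qed
  have h1: "norm (h j x) \<le> C * gauss 1 x" for j x
  proof (cases "norm x \<le> R + 1")
    case True
    have "norm (h j x) = cut x * (norm (g j x) / max 1 (norm (g j x)))"
    proof -
      have "0 \<le> cut x / max 1 (norm (g j x))" by (auto simp: cut_def intro!: divide_nonneg_nonneg)
      then have "norm (h j x) = cut x / max 1 (norm (g j x)) * norm (g j x)"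
        by (simp only: h_def norm_mult norm_of_real abs_of_nonneg)
      then show ?thesis by simp
    qed
    also have "\<dots> \<le> 1 * 1" by (intro mult_mono) (auto simp: cut_def max_def divide_le_eq)
    finally show ?thesis using C[OF True] by simp
  next
    case False
    then have "h j x = 0" by (simp add: h_def cut_def)
    then show ?thesis using C1 by (simp add: gauss_def)
  qed
  have hl: "AE x in lborel. (\<lambda>j. h j x) \<longlonglongrightarrow> \<Phi> x"
    using g(2)
  proof eventually_elim
    case (elim x)
    have "(\<lambda>j. h j x) \<longlonglongrightarrow> of_real (cut x / max 1 (norm (\<Phi> x))) * \<Phi> x"
      unfolding h_def by (intro tendsto_intros elim) auto
    moreover have "of_real (cut x / max 1 (norm (\<Phi> x))) * \<Phi> x = \<Phi> x"
      using \<Phi>[of x] by (cases "norm x > R") (auto simp: cut_def max_def)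
    ultimately show ?case by simp
  qed
  have g12: "gauss 1 x \<le> gauss (1/2) x" for x :: "real^'n" by (simp add: gauss_def)
  have \<Phi>1: "norm (\<Phi> x) \<le> C * gauss 1 x" for x
  proof (cases "norm x \<le> R")
    case True then show ?thesis using \<Phi>(1)[of x] C[of x] by simp
  next
    case False then show ?thesis using \<Phi>(2)[of x] C1 by (simp add: gauss_def)
  qed
  have iw: "integrable lborel (\<lambda>x. (2 * C) * (w x * gauss (1/2) x))" by (intro integrable_mult_right w)
  have dom: "norm (w x * norm (a - b)) \<le> (2 * C) * (w x * gauss (1/2) x)"
    if "norm a \<le> C * gauss (1/2) x" "norm b \<le> C * gauss (1/2) x" for a b :: complex and x
  proof -
    have "norm (a - b) \<le> 2 * C * gauss (1/2) x" using norm_triangle_ineq4[of a b] that by linarith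
    then have "w x * norm (a - b) \<le> w x * (2 * C * gauss (1/2) x)" by (intro mult_left_mono w)
    then show ?thesis using w(1)[of x] by (simp add: mult_ac)
  qed
  have up: "norm a \<le> C * gauss (1/2) x" if "norm a \<le> C * gauss 1 x" for a :: complex and x :: "real^'n"
    using that mult_left_mono[OF g12[of x] C1] by simp
  have l1: "(\<lambda>j. LINT x|lborel. w x * norm (h j x - \<Phi> x)) \<longlonglongrightarrow> (LINT x::real^'n|lborel. 0)"
  proof (rule integral_dominated_convergence[OF _ _ iw])
    show "AE x in lborel. (\<lambda>j. w x * norm (h j x - \<Phi> x)) \<longlonglongrightarrow> 0"
      using hl
    proof eventually_elim
      case (elim x)
      have "(\<lambda>j. w x * norm (h j x - \<Phi> x)) \<longlonglongrightarrow> w x * norm (\<Phi> x - \<Phi> x)" by (intro tendsto_intros elim)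
      then show ?case by simp
    qed
    show "AE x in lborel. norm (w x * norm (h j x - \<Phi> x)) \<le> (2 * C) * (w x * gauss (1/2) x)" for j
      by (intro AE_I2 dom up h1 \<Phi>1)
  qed measurable
  then have "\<forall>\<^sub>F j in sequentially. (LINT x|lborel. w x * norm (h j x - \<Phi> x)) < e / 2"
    by (rule order_tendstoD) (use e in simp)
  then obtain j where j: "(LINT x|lborel. w x * norm (h j x - \<Phi> x)) < e / 2"
    by (auto simp: eventually_sequentially)
  obtain \<phi> where \<phi>: "\<And>i. \<phi> i \<in> schwartz" "\<And>x. (\<lambda>i. \<phi> i x) \<longlonglongrightarrow> h j x" "\<And>i x. norm (\<phi> i x) \<le> C * gauss (1/2) x"
    using schwartz_approx_continuous[OF hc h1] by metis
  have [measurable]: "\<phi> i \<in> borel_measurable borel" for i by (rule schwartz_measurable[OF \<phi>(1)])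
  have l2: "(\<lambda>i. LINT x|lborel. w x * norm (\<phi> i x - h j x)) \<longlonglongrightarrow> (LINT x::real^'n|lborel. 0)"
  proof (rule integral_dominated_convergence[OF _ _ iw])
    show "AE x in lborel. (\<lambda>i. w x * norm (\<phi> i x - h j x)) \<longlonglongrightarrow> 0"
    proof (intro AE_I2)
      fix x
      have "(\<lambda>i. w x * norm (\<phi> i x - h j x)) \<longlonglongrightarrow> w x * norm (h j x - h j x)" by (intro tendsto_intros \<phi>)
      then show "(\<lambda>i. w x * norm (\<phi> i x - h j x)) \<longlonglongrightarrow> 0" by simp
    qed
    show "AE x in lborel. norm (w x * norm (\<phi> i x - h j x)) \<le> (2 * C) * (w x * gauss (1/2) x)" for i
      by (intro AE_I2 dom up h1 \<phi>(3))
  qed measurable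
  then have "\<forall>\<^sub>F i in sequentially. (LINT x|lborel. w x * norm (\<phi> i x - h j x)) < e / 2"
    by (rule order_tendstoD) (use e in simp)
  then obtain i where i: "(LINT x|lborel. w x * norm (\<phi> i x - h j x)) < e / 2"
    by (auto simp: eventually_sequentially)
  have i1: "integrable lborel (\<lambda>x. w x * norm (h j x - \<Phi> x))"
    by (rule Bochner_Integration.integrable_bound[OF iw]) (measurable, intro AE_I2 order_trans[OF dom[OF up[OF h1] up[OF \<Phi>1]]], simp)
  have i2: "integrable lborel (\<lambda>x. w x * norm (\<phi> i x - h j x))"
    by (rule Bochner_Integration.integrable_bound[OF iw]) (measurable, intro AE_I2 order_trans[OF dom[OF \<phi>(3) up[OF h1]]], simp)
  have i3: "integrable lborel (\<lambda>x. w x * norm (\<phi> i x - \<Phi> x))"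
    by (rule Bochner_Integration.integrable_bound[OF iw]) (measurable, intro AE_I2 order_trans[OF dom[OF \<phi>(3) up[OF \<Phi>1]]], simp)
  have "(LINT x|lborel. w x * norm (\<phi> i x - \<Phi> x)) \<le> (LINT x|lborel. w x * norm (\<phi> i x - h j x) + w x * norm (h j x - \<Phi> x))"
  proof (intro Bochner_Integration.integral_mono Bochner_Integration.integrable_add i1 i2 i3)
    fix x
    have "norm (\<phi> i x - \<Phi> x) \<le> norm (\<phi> i x - h j x) + norm (h j x - \<Phi> x)"
      using norm_triangle_ineq[of "\<phi> i x - h j x" "h j x - \<Phi> x"] by simp
    from mult_left_mono[OF this w(1)[of x]]
    show "w x * norm (\<phi> i x - \<Phi> x) \<le> w x * norm (\<phi> i x - h j x) + w x * norm (h j x - \<Phi> x)" by (simp add: distrib_left)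
  qed
  also have "\<dots> < e" using i j i1 i2 by simp
  finally show ?thesis using that \<phi>(1) i3 by blast
qed

text \<open>Truncating \<Phi> in space and in height reduces to the bounded, compactly supported
  case; dominated convergence with majorant w |\<Phi>| controls the truncation error.\<close>

lemma schwartz_dense:
  fixes w :: "real^'n::finite \<Rightarrow> real" and \<Phi> :: "real^'n \<Rightarrow> complex"
  assumes [measurable]: "w \<in> borel_measurable borel" and w: "\<And>x. 0 \<le> w x" "integrable lborel (\<lambda>x. w x * gauss (1/2) x)"
    and [measurable]: "\<Phi> \<in> borel_measurable borel" and \<Phi>: "integrable lborel (\<lambda>x. w x * norm (\<Phi> x))"
    and e: "e > 0"
  obtains \<phi> where "\<phi> \<in> schwartz" "integrable lborel (\<lambda>x. w x * norm (\<phi> x - \<Phi> x))" "(LINT x|lborel. w x * norm (\<phi> x - \<Phi> x)) < e"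
proof -
  define T where "T = (\<lambda>j::nat. \<lambda>x. if norm x \<le> real (Suc j) \<and> norm (\<Phi> x) \<le> real (Suc j) then \<Phi> x else 0)"
  have [measurable]: "T j \<in> borel_measurable borel" for j unfolding T_def by measurable
  have Tb: "norm (T j x - \<Phi> x) \<le> norm (\<Phi> x)" for j x by (simp add: T_def)
  have dom: "norm (w x * norm (T j x - \<Phi> x)) \<le> w x * norm (\<Phi> x)" for j x
    using mult_left_mono[OF Tb[of j x] w(1)[of x]] w(1)[of x] by simp
  have "(\<lambda>j. LINT x|lborel. w x * norm (T j x - \<Phi> x)) \<longlonglongrightarrow> (LINT x::real^'n|lborel. 0)"
  proof (rule integral_dominated_convergence[OF _ _ \<Phi>])
    show "AE x in lborel. (\<lambda>j. w x * norm (T j x - \<Phi> x)) \<longlonglongrightarrow> 0"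
    proof (intro AE_I2)
      fix x
      obtain N where N: "max (norm x) (norm (\<Phi> x)) \<le> real N" using real_arch_simple by blast
      have "T j x = \<Phi> x" if "j \<ge> N" for j using N that by (auto simp: T_def)
      then have "\<forall>\<^sub>F j in sequentially. w x * norm (T j x - \<Phi> x) = 0" by (auto simp: eventually_sequentially)
      then show "(\<lambda>j. w x * norm (T j x - \<Phi> x)) \<longlonglongrightarrow> 0" by (rule tendsto_eventually)
    qed
    show "AE x in lborel. norm (w x * norm (T j x - \<Phi> x)) \<le> w x * norm (\<Phi> x)" for j
      by (intro AE_I2 dom)
  qed measurable
  then have "\<forall>\<^sub>F j in sequentially. (LINT x|lborel. w x * norm (T j x - \<Phi> x)) < e / 2"
    by (rule order_tendstoD) (use e in simp)
  then obtain j where j: "(LINT x|lborel. w x * norm (T j x - \<Phi> x)) < e / 2"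
    by (auto simp: eventually_sequentially)
  \<comment> \<open>The same number bounds the support and the height of the truncation. Dividing by
    c gives height at most 1, so the tolerance for the scaled problem is e / (2 c).\<close>
  define c where "c = real (Suc j)"
  have c: "c > 0" by (simp add: c_def)
  have \<Psi>1: "norm (of_real (1 / c) * T j x) \<le> 1" for x
  proof -
    have "norm (T j x) \<le> c" by (simp add: T_def c_def)
    moreover have "norm (of_real (1 / c) * T j x) = norm (T j x) / c" using c by (simp add: norm_mult norm_divide)
    ultimately show ?thesis using c by simp
  qed
  have \<Psi>2: "of_real (1 / c) * T j x = 0" if "norm x > c" for x using that by (simp add: T_def c_def)
  have e': "0 < e / (2 * c)" using e c by simp
  have m\<Psi>: "(\<lambda>x. of_real (1 / c) * T j x) \<in> borel_measurable borel" by measurable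
  obtain \<psi> where \<psi>: "\<psi> \<in> schwartz" "integrable lborel (\<lambda>x. w x * norm (\<psi> x - of_real (1 / c) * T j x))"
    "(LINT x|lborel. w x * norm (\<psi> x - of_real (1 / c) * T j x)) < e / (2 * c)"
    by (rule schwartz_dense_bounded[where R=c, OF assms(1) w m\<Psi> \<Psi>1 \<Psi>2 e']) (assumption | rule that)+
  note [measurable] = schwartz_measurable[OF \<psi>(1)]
  define \<phi> where "\<phi> = (\<lambda>x. of_real c * \<psi> x)"
  have s: "\<phi> \<in> schwartz" unfolding \<phi>_def by (rule schwartz_cmult[OF \<psi>(1)])
  note [measurable] = schwartz_measurable[OF s]
  have sc: "w x * norm (\<phi> x - T j x) = c * (w x * norm (\<psi> x - of_real (1 / c) * T j x))" for x
  proof -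
    have "\<phi> x - T j x = of_real c * (\<psi> x - of_real (1 / c) * T j x)" using c by (simp add: \<phi>_def algebra_simps)
    then show ?thesis using c by (simp add: norm_mult)
  qed
  have i1: "integrable lborel (\<lambda>x. w x * norm (\<phi> x - T j x))" unfolding sc by (intro integrable_mult_right \<psi>)
  have b1: "(LINT x|lborel. w x * norm (\<phi> x - T j x)) < e / 2"
    unfolding sc integral_mult_right_zero using \<psi>(3) c by (simp add: field_simps)
  have i2: "integrable lborel (\<lambda>x. w x * norm (T j x - \<Phi> x))"
    by (rule Bochner_Integration.integrable_bound[OF \<Phi>]) (measurable, intro AE_I2 order_trans[OF dom], simp)
  have tri: "w x * norm (\<phi> x - \<Phi> x) \<le> w x * norm (\<phi> x - T j x) + w x * norm (T j x - \<Phi> x)" for x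
  proof -
    have "norm (\<phi> x - \<Phi> x) \<le> norm (\<phi> x - T j x) + norm (T j x - \<Phi> x)"
      using norm_triangle_ineq[of "\<phi> x - T j x" "T j x - \<Phi> x"] by simp
    from mult_left_mono[OF this w(1)[of x]] show ?thesis by (simp add: distrib_left)
  qed
  have i3: "integrable lborel (\<lambda>x. w x * norm (\<phi> x - \<Phi> x))"
    by (rule Bochner_Integration.integrable_bound[OF Bochner_Integration.integrable_add[OF i1 i2]])
       (measurable, intro AE_I2, use tri w(1) in \<open>simp add: abs_of_nonneg\<close>)
  have "(LINT x|lborel. w x * norm (\<phi> x - \<Phi> x)) \<le> (LINT x|lborel. w x * norm (\<phi> x - T j x) + w x * norm (T j x - \<Phi> x))"
    by (intro Bochner_Integration.integral_mono Bochner_Integration.integrable_add i1 i2 i3 tri)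
  also have "\<dots> < e" using b1 j i1 i2 by simp
  finally show ?thesis using that s i3 by blast
qed

text \<open>Test against Schwartz approximations of the unimodular function conjugate to \<open>g\<close>,
  cut off to the part of a ball where \<open>norm g > B\<close>.\<close>

lemma bounded_by_duality:
  fixes g :: "real^'n::finite \<Rightarrow> complex" and B :: "real^'n \<Rightarrow> real"
  assumes [measurable]: "g \<in> borel_measurable borel" "B \<in> borel_measurable borel" and B: "\<And>x. 0 \<le> B x"
    and gi: "\<And>\<psi>. \<psi> \<in> schwartz \<Longrightarrow> integrable lborel (\<lambda>x. g x * \<psi> x)"
    and Bi: "\<And>\<psi>. \<psi> \<in> schwartz \<Longrightarrow> integrable lborel (\<lambda>x. B x * norm (\<psi> x))"
    and le: "\<And>\<psi>. \<psi> \<in> schwartz \<Longrightarrow> norm (LINT x|lborel. g x * \<psi> x) \<le> (LINT x|lborel. B x * norm (\<psi> x))"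
  shows "AE x in lborel. norm (g x) \<le> B x"
proof -
  \<comment> \<open>The weight is the sum of both functions so that a single approximation controls
    the error in the pairing with g and in the integral against B.\<close>
  define w where "w = (\<lambda>x. norm (g x) + B x)"
  have mw[measurable]: "w \<in> borel_measurable borel" unfolding w_def by measurable
  have w0: "0 \<le> w x" for x using B by (simp add: w_def)
  have gs: "(\<lambda>x::real^'n. complex_of_real (gauss (1/2) x)) \<in> schwartz" by (rule gauss_schwartz) simp
  have gpos: "gauss (1/2) x > 0" for x :: "real^'n" by (simp add: gauss_def)
  have "integrable lborel (\<lambda>x. norm (g x * complex_of_real (gauss (1/2) x)) + B x * norm (complex_of_real (gauss (1/2) x)))"
    by (intro Bochner_Integration.integrable_add integrable_norm gi Bi gs)
  then have wi: "integrable lborel (\<lambda>x. w x * gauss (1/2) x)"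
    using gpos by (simp add: w_def distrib_right norm_mult abs_of_pos)
  have *: "AE x in lborel. norm x \<le> R \<longrightarrow> norm (g x) \<le> B x" for R :: nat
  proof -
    define E where "E = {x. norm x \<le> real R \<and> norm (g x) > B x}"
    have [measurable]: "E \<in> sets borel" unfolding E_def by measurable
    define \<Phi> where "\<Phi> = (\<lambda>x. if x \<in> E then cnj (sgn (g x)) else 0)"
    have [measurable]: "cnj \<in> borel_measurable borel"
      by (intro borel_measurable_continuous_onI continuous_intros)
    have m\<Phi>[measurable]: "\<Phi> \<in> borel_measurable borel" unfolding \<Phi>_def sgn_div_norm by measurable
    have \<Phi>1: "norm (\<Phi> x) \<le> 1" for x by (simp add: \<Phi>_def norm_sgn)
    have \<Phi>2: "\<Phi> x = 0" if "norm x > real R" for x using that by (simp add: \<Phi>_def E_def)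
    have g\<Phi>: "g x * \<Phi> x = of_real (indicator E x * norm (g x))" for x
    proof (cases "g x = 0")
      case False
      have "g x * cnj (sgn (g x)) = of_real (norm (g x))"
        using False by (simp add: sgn_div_norm complex_norm_square[symmetric] scaleR_conv_of_real power2_eq_square field_simps)
      then show ?thesis by (simp add: \<Phi>_def)
    qed (simp add: \<Phi>_def)
    have n\<Phi>: "norm (\<Phi> x) = indicator E x" for x using B[of x] by (auto simp: \<Phi>_def E_def norm_sgn indicator_def)
    define C where "C = exp (pi * (real R)\<^sup>2 / 2)"
    have C: "indicator E x \<le> C * gauss (1/2) x" for x
    proof (cases "x \<in> E")
      case True
      then have "(norm x)\<^sup>2 \<le> (real R)\<^sup>2" by (intro power_mono) (auto simp: E_def)
      then have "pi * (norm x)\<^sup>2 \<le> pi * (real R)\<^sup>2" by (intro mult_left_mono) auto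
      then show ?thesis using True by (simp add: C_def gauss_def exp_add[symmetric])
    qed (simp add: C_def gauss_def)
    have iE: "integrable lborel (\<lambda>x. w x * indicator E x)"
    proof (rule Bochner_Integration.integrable_bound[OF integrable_mult_right[OF wi, of C]], measurable, intro AE_I2)
      fix x
      have "w x * indicator E x \<le> w x * (C * gauss (1/2) x)" by (intro mult_left_mono C w0)
      then show "norm (w x * indicator E x) \<le> norm (C * (w x * gauss (1/2) x))"
        using w0[of x] gpos[of x] by (simp add: C_def mult_ac abs_mult)
    qed
    have igE: "integrable lborel (\<lambda>x. indicator E x * norm (g x))" and iBE: "integrable lborel (\<lambda>x. indicator E x * B x)"
      by (rule Bochner_Integration.integrable_bound[OF iE], measurable, intro AE_I2,
          use B in \<open>auto simp: w_def indicator_def\<close>)+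
    have "(LINT x|lborel. indicator E x * norm (g x)) \<le> (LINT x|lborel. indicator E x * B x)"
    proof (rule field_le_epsilon)
      fix e :: real assume e: "e > 0"
      obtain \<phi> where \<phi>: "\<phi> \<in> schwartz" "integrable lborel (\<lambda>x. w x * norm (\<phi> x - \<Phi> x))" "(LINT x|lborel. w x * norm (\<phi> x - \<Phi> x)) < e"
        by (rule schwartz_dense_bounded[where R="real R", OF mw w0 wi m\<Phi> \<Phi>1 \<Phi>2 e]) (assumption | rule that)+
      note [measurable] = schwartz_measurable[OF \<phi>(1)]
      have ig: "integrable lborel (\<lambda>x. norm (g x) * norm (\<phi> x - \<Phi> x))" and iB: "integrable lborel (\<lambda>x. B x * norm (\<phi> x - \<Phi> x))"
        by (rule Bochner_Integration.integrable_bound[OF \<phi>(2)], measurable, intro AE_I2,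
          use B in \<open>auto simp: w_def distrib_right abs_of_nonneg\<close>)+
      have ig': "integrable lborel (\<lambda>x. g x * (\<Phi> x - \<phi> x))"
        by (rule Bochner_Integration.integrable_bound[OF ig]) (auto simp: norm_mult norm_minus_commute)
      have "(LINT x|lborel. indicator E x * norm (g x)) = norm (LINT x|lborel. g x * \<Phi> x)"
        unfolding g\<Phi> integral_complex_of_real norm_of_real by (intro abs_of_nonneg[symmetric] integral_nonneg_AE) auto
      also have "(LINT x|lborel. g x * \<Phi> x) = (LINT x|lborel. g x * \<phi> x) + (LINT x|lborel. g x * (\<Phi> x - \<phi> x))"
        by (subst Bochner_Integration.integral_add[symmetric, OF gi[OF \<phi>(1)] ig']) (simp add: algebra_simps)
      also have "norm \<dots> \<le> (LINT x|lborel. B x * norm (\<phi> x)) + (LINT x|lborel. norm (g x) * norm (\<phi> x - \<Phi> x))"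
      proof (rule order_trans[OF norm_triangle_ineq add_mono[OF le[OF \<phi>(1)]]])
        show "norm (LINT x|lborel. g x * (\<Phi> x - \<phi> x)) \<le> (LINT x|lborel. norm (g x) * norm (\<phi> x - \<Phi> x))"
          by (rule order_trans[OF integral_norm_bound]) (simp add: norm_mult norm_minus_commute)
      qed
      finally have h1: "(LINT x|lborel. indicator E x * norm (g x)) \<le> (LINT x|lborel. B x * norm (\<phi> x)) + (LINT x|lborel. norm (g x) * norm (\<phi> x - \<Phi> x))" .
      have "(LINT x|lborel. B x * norm (\<phi> x)) \<le> (LINT x|lborel. indicator E x * B x + B x * norm (\<phi> x - \<Phi> x))"
      proof (intro Bochner_Integration.integral_mono Bi[OF \<phi>(1)] Bochner_Integration.integrable_add iBE iB)
        fix x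
        have "norm (\<phi> x) \<le> norm (\<Phi> x) + norm (\<phi> x - \<Phi> x)" using norm_triangle_ineq[of "\<Phi> x" "\<phi> x - \<Phi> x"] by simp
        from mult_left_mono[OF this B[of x]]
        show "B x * norm (\<phi> x) \<le> indicator E x * B x + B x * norm (\<phi> x - \<Phi> x)" by (simp add: n\<Phi> distrib_left mult.commute)
      qed
      also have "\<dots> = (LINT x|lborel. indicator E x * B x) + (LINT x|lborel. B x * norm (\<phi> x - \<Phi> x))"
        by (rule Bochner_Integration.integral_add[OF iBE iB])
      finally have h2: "(LINT x|lborel. B x * norm (\<phi> x)) \<le> (LINT x|lborel. indicator E x * B x) + (LINT x|lborel. B x * norm (\<phi> x - \<Phi> x))" .
      have "(LINT x|lborel. B x * norm (\<phi> x - \<Phi> x)) + (LINT x|lborel. norm (g x) * norm (\<phi> x - \<Phi> x)) = (LINT x|lborel. w x * norm (\<phi> x - \<Phi> x))"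
        using ig iB by (simp add: w_def distrib_right)
      then show "(LINT x|lborel. indicator E x * norm (g x)) \<le> (LINT x|lborel. indicator E x * B x) + e"
        using h1 h2 \<phi>(3) by linarith
    qed
    then have z: "(LINT x|lborel. indicator E x * (norm (g x) - B x)) \<le> 0"
      using igE iBE by (simp add: right_diff_distrib)
    have nn: "AE x in lborel. 0 \<le> indicator E x * (norm (g x) - B x)" by (intro AE_I2) (auto simp: E_def indicator_def)
    have i: "integrable lborel (\<lambda>x. indicator E x * (norm (g x) - B x))"
      using igE iBE by (simp add: right_diff_distrib)
    have "(LINT x|lborel. indicator E x * (norm (g x) - B x)) = 0"
      using z integral_nonneg_AE[OF nn] by simp
    then have "AE x in lborel. indicator E x * (norm (g x) - B x) = 0"
      using integral_nonneg_eq_0_iff_AE[OF i nn] by simp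
    then show ?thesis by eventually_elim (auto simp: E_def indicator_def split: if_splits)
  qed
  have "AE x in lborel. \<forall>R::nat. norm x \<le> R \<longrightarrow> norm (g x) \<le> B x"
    by (subst AE_all_countable) (use * in auto)
  then show ?thesis by eventually_elim (use real_arch_simple in blast)
qed

section \<open>The spaces $PM^k$ on the Fourier side\<close>

definition fun_dist :: "(real^'n::finite \<Rightarrow> complex) \<Rightarrow> 'n dist" where
  "fun_dist g = (\<lambda>\<phi>. if \<phi> \<in> schwartz then (LINT \<xi>|lborel. g \<xi> * \<phi> \<xi>) else 0)"

text \<open>The distribution whose Fourier transform is the function g. Elements of
  \<open>PM k\<close> are handled through this map; it inverts \<open>hat\<close> up to null
  sets.\<close>

definition of_hat :: "(real^'n::finite \<Rightarrow> complex) \<Rightarrow> 'n dist" where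
  "of_hat g = dist_fourier_inv (fun_dist g)"

text \<open>Membership in the Fourier image of \<open>PM k\<close> with an explicit constant A. The
  weight stands on the right, so sums, products and integrals of such bounds need no
  division.\<close>

definition powr_bounded :: "real \<Rightarrow> real \<Rightarrow> (real^'n::finite \<Rightarrow> complex) \<Rightarrow> bool" where
  "powr_bounded k A g \<longleftrightarrow> g \<in> borel_measurable borel \<and> 0 \<le> A \<and> (AE \<xi> in lborel. norm (g \<xi>) \<le> A * norm \<xi> powr (- k))"

lemma of_hat_eq: "\<phi> \<in> schwartz \<Longrightarrow> of_hat g \<phi> = (LINT \<xi>|lborel. g \<xi> * fourier_inv \<phi> \<xi>)"
  by (simp add: of_hat_def dist_fourier_inv_def fun_dist_def fourier_inv_schwartz)

lemma of_hat_outside: "\<phi> \<notin> schwartz \<Longrightarrow> of_hat g \<phi> = 0"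
  by (simp add: of_hat_def dist_fourier_inv_def)

lemma dist_fourier_of_hat: "dist_fourier (of_hat g) = fun_dist g"
  by (auto simp: dist_fourier_def fun_dist_def fun_eq_iff of_hat_eq fourier_schwartz fourier_inversion)

lemma powr_boundedD:
  assumes "powr_bounded k A g"
  shows "g \<in> borel_measurable borel" "0 \<le> A" "AE \<xi> in lborel. norm (g \<xi>) \<le> A * norm \<xi> powr (- k)"
  using assms by (auto simp: powr_bounded_def)

lemma powr_bounded_add:
  assumes "powr_bounded k A f" "powr_bounded k B g"
  shows "powr_bounded k (A + B) (\<lambda>x. f x + g x)"
proof -
  note [measurable] = powr_boundedD(1)[OF assms(1)] powr_boundedD(1)[OF assms(2)]
  have "AE x in lborel. norm (f x + g x) \<le> (A + B) * norm x powr (- k)"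
    using powr_boundedD(3)[OF assms(1)] powr_boundedD(3)[OF assms(2)]
    by eventually_elim (auto simp: distrib_right intro: order_trans[OF norm_triangle_ineq])
  then show ?thesis using assms by (simp add: powr_bounded_def)
qed

lemma powr_bounded_uminus: "powr_bounded k A f \<Longrightarrow> powr_bounded k A (\<lambda>x. - f x)"
  by (simp add: powr_bounded_def)

lemma powr_bounded_diff: "powr_bounded k A f \<Longrightarrow> powr_bounded k B g \<Longrightarrow> powr_bounded k (A + B) (\<lambda>x. f x - g x)"
  using powr_bounded_add[OF _ powr_bounded_uminus, of k A f B g] by simp

lemma AE_lborel_False: "\<not> (AE x in lborel. False)"
proof -
  have "emeasure lborel (space lborel :: (real^'n::finite) set) \<noteq> 0" by (simp add: emeasure_lborel_UNIV)
  then show ?thesis by (simp add: AE_iff_measurable[where N=UNIV])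
qed

text \<open>Used at the exponents k, n - 2, k - 2 and, for the Hardy potential, 2. The condition k <
  n makes |\<xi>|^(-k) integrable at the origin, and 0 \<le> k keeps it bounded away from the
  origin.\<close>

locale pm_exponent =
  fixes k :: real and n_type :: "'n::finite itself"
  assumes k0: "0 \<le> k" and kn: "k < real CARD('n)" and n3: "3 \<le> CARD('n)"
begin

lemma integrable_powr_bound:
  fixes \<phi> :: "real^'n \<Rightarrow> complex"
  assumes "\<And>x. norm (\<phi> x) \<le> C / (1 + norm x) ^ (2 * CARD('n))" "\<phi> \<in> borel_measurable borel"
  shows "integrable lborel (\<lambda>x. norm x powr (- k) * norm (\<phi> x))"
    and "(LINT x|lborel. norm x powr (- k) * norm (\<phi> x))
      \<le> C * (LINT x|lborel. norm (x::real^'n) powr (- k) / (1 + norm x) ^ (2 * CARD('n)))"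
proof -
  note [measurable] = assms(2)
  have i: "integrable lborel (\<lambda>x::real^'n. C * (norm x powr (- k) / (1 + norm x) ^ (2 * CARD('n))))"
    by (intro integrable_mult_right integrable_powr_inverse_power k0 kn n3) simp
  have le: "norm x powr (- k) * norm (\<phi> x) \<le> C * (norm x powr (- k) / (1 + norm x) ^ (2 * CARD('n)))" for x
    using mult_left_mono[OF assms(1)[of x], of "norm x powr (- k)"] by (simp add: mult_ac)
  show *: "integrable lborel (\<lambda>x. norm x powr (- k) * norm (\<phi> x))"
    by (rule Bochner_Integration.integrable_bound[OF i]) (measurable, intro AE_I2, use order_trans[OF le abs_ge_self] in \<open>simp add: abs_mult\<close>)
  show "(LINT x|lborel. norm x powr (- k) * norm (\<phi> x))
      \<le> C * (LINT x|lborel. norm (x::real^'n) powr (- k) / (1 + norm x) ^ (2 * CARD('n)))"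
    unfolding integral_mult_right_zero[symmetric]
    by (intro Bochner_Integration.integral_mono * i le)
qed

lemma integrable_powr_schwartz:
  fixes \<phi> :: "real^'n \<Rightarrow> complex"
  assumes "\<phi> \<in> schwartz"
  shows "integrable lborel (\<lambda>x. norm x powr (- k) * norm (\<phi> x))"
proof -
  obtain C where "\<And>x. norm (\<phi> x) \<le> C / (1 + norm x) ^ (2 * CARD('n))"
    by (rule schwartz_bound[OF assms, of "2 * CARD('n)"]) (rule that)
  then show ?thesis by (rule integrable_powr_bound) (rule schwartz_measurable[OF assms])
qed

lemma powr_bounded_integrable:
  fixes g \<Phi> :: "real^'n \<Rightarrow> complex"
  assumes g: "powr_bounded k A g" and \<Phi>: "integrable lborel (\<lambda>x. norm x powr (- k) * norm (\<Phi> x))"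
    and m: "\<Phi> \<in> borel_measurable borel"
  shows "integrable lborel (\<lambda>x. g x * \<Phi> x)"
    and "norm (LINT x|lborel. g x * \<Phi> x) \<le> A * (LINT x|lborel. norm x powr (- k) * norm (\<Phi> x))"
proof -
  note [measurable] = powr_boundedD(1)[OF g] m
  have le: "AE x in lborel. norm (g x * \<Phi> x) \<le> A * (norm x powr (- k) * norm (\<Phi> x))"
    using powr_boundedD(3)[OF g]
    by eventually_elim (simp add: norm_mult mult.assoc[symmetric] mult_right_mono)
  show *: "integrable lborel (\<lambda>x. g x * \<Phi> x)"
  proof (rule Bochner_Integration.integrable_bound[OF integrable_mult_right[OF \<Phi>, of A]], measurable)
    show "AE x in lborel. norm (g x * \<Phi> x) \<le> norm (A * (norm x powr (- k) * norm (\<Phi> x)))"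
      using le by eventually_elim (use powr_boundedD(2)[OF g] in simp)
  qed
  have "norm (LINT x|lborel. g x * \<Phi> x) \<le> (LINT x|lborel. norm (g x * \<Phi> x))" by (rule integral_norm_bound)
  also have "\<dots> \<le> (LINT x|lborel. A * (norm x powr (- k) * norm (\<Phi> x)))"
    by (intro integral_mono_AE integrable_norm * integrable_mult_right \<Phi> le)
  finally show "norm (LINT x|lborel. g x * \<Phi> x) \<le> A * (LINT x|lborel. norm x powr (- k) * norm (\<Phi> x))" by simp
qed

lemma powr_bounded_schwartz:
  fixes g \<phi> :: "real^'n \<Rightarrow> complex"
  assumes "powr_bounded k A g" "\<phi> \<in> schwartz"
  shows "integrable lborel (\<lambda>x. g x * \<phi> x)"
    and "norm (LINT x|lborel. g x * \<phi> x) \<le> A * (LINT x|lborel. norm x powr (- k) * norm (\<phi> x))"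
  using powr_bounded_integrable[OF assms(1) integrable_powr_schwartz[OF assms(2)] schwartz_measurable[OF assms(2)]] by auto

lemma powr_bounded_locally_integrable:
  fixes g :: "real^'n \<Rightarrow> complex"
  assumes g: "powr_bounded k A g"
  shows "locally_integrable g"
  unfolding locally_integrable_def set_integrable_def
proof (intro allI impI)
  fix K :: "(real^'n) set" assume K: "compact K"
  note [measurable] = powr_boundedD(1)[OF g] borel_compact[OF K]
  obtain R where R: "\<And>x. x \<in> K \<Longrightarrow> norm x \<le> R" using compact_imp_bounded[OF K] by (auto simp: bounded_iff)
  define N where "N = 2 * CARD('n)"
  have "integrable lborel (\<lambda>x. (A * (1 + \<bar>R\<bar>) ^ N) * (norm (x::real^'n) powr (- k) / (1 + norm x) ^ N))"
    by (intro integrable_mult_right integrable_powr_inverse_power k0 kn n3) (simp add: N_def)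
  then show "integrable lborel (\<lambda>x. indicat_real K x *\<^sub>R g x)"
  proof (rule Bochner_Integration.integrable_bound, measurable)
    show "AE x in lborel. norm (indicat_real K x *\<^sub>R g x) \<le> norm ((A * (1 + \<bar>R\<bar>) ^ N) * (norm x powr (- k) / (1 + norm x) ^ N))"
      using powr_boundedD(3)[OF g]
    proof eventually_elim
      case (elim x)
      have A: "A \<ge> 0" by (rule powr_boundedD(2)[OF g])
      have p: "(1 + norm x) ^ N > 0" by (auto intro!: zero_less_power add_pos_nonneg)
      show ?case
      proof (cases "x \<in> K")
        case True
        have "(1 + norm x) ^ N \<le> (1 + \<bar>R\<bar>) ^ N" using R[OF True] by (intro power_mono) auto
        then have "1 \<le> (1 + \<bar>R\<bar>) ^ N / (1 + norm x) ^ N" using p by simp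
        then have "A * norm x powr (- k) * 1 \<le> A * norm x powr (- k) * ((1 + \<bar>R\<bar>) ^ N / (1 + norm x) ^ N)"
          using A by (intro mult_left_mono) auto
        also have "\<dots> = (A * (1 + \<bar>R\<bar>) ^ N) * (norm x powr (- k) / (1 + norm x) ^ N)" by simp
        finally show ?thesis using elim True A p by (simp del: times_divide_eq_right)
      qed simp
    qed
  qed
qed

lemma represents_of_hat:
  fixes g :: "real^'n \<Rightarrow> complex"
  assumes "powr_bounded k A g"
  shows "represents g (dist_fourier (of_hat g))"
  using powr_bounded_schwartz[OF assms] powr_bounded_locally_integrable[OF assms]
  by (simp add: represents_def dist_fourier_of_hat fun_dist_def)

text \<open>Continuity follows from the quantitative decay of the inverse transform: 2n powers of 1
  + |\<xi>| are enough to make the weight |\<xi>|^(-k) integrable, at the price of one Schwartz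
  seminorm.\<close>

lemma of_hat_tempered:
  fixes g :: "real^'n \<Rightarrow> complex"
  assumes g: "powr_bounded k A g"
  shows "of_hat g \<in> tempered"
  unfolding tempered_def
proof (intro CollectI conjI ballI allI impI)
  have ie: "integrable lborel (\<lambda>\<xi>. \<phi> \<xi> * phase (- (x \<bullet> \<xi>)))" if "\<phi> \<in> schwartz" for \<phi> :: "real^'n \<Rightarrow> complex" and x
    by (intro integrable_mult_phase schwartz_integrable0 that)
  fix \<phi> \<psi> :: "real^'n \<Rightarrow> complex" and c :: complex assume \<phi>: "\<phi> \<in> schwartz"
  have "fourier_inv (\<lambda>x. c * \<phi> x) = (\<lambda>x. c * fourier_inv \<phi> x)"
    by (simp add: fun_eq_iff fourier_inv_phase mult.assoc)
  then show "of_hat g (\<lambda>x. c * \<phi> x) = c * of_hat g \<phi>"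
    by (simp add: of_hat_eq \<phi> schwartz_cmult mult.left_commute)
  assume \<psi>: "\<psi> \<in> schwartz"
  have "fourier_inv (\<lambda>x. \<phi> x + \<psi> x) = (\<lambda>x. fourier_inv \<phi> x + fourier_inv \<psi> x)"
    by (simp add: fun_eq_iff fourier_inv_phase distrib_right ie \<phi> \<psi>)
  then show "of_hat g (\<lambda>x. \<phi> x + \<psi> x) = of_hat g \<phi> + of_hat g \<psi>"
    using powr_bounded_schwartz(1)[OF g fourier_inv_schwartz[OF \<phi>]] powr_bounded_schwartz(1)[OF g fourier_inv_schwartz[OF \<psi>]]
    by (simp add: of_hat_eq \<phi> \<psi> schwartz_add distrib_left)
next
  define M where "M = 2 * CARD('n)"
  obtain C N where C: "0 \<le> C" "\<And>\<phi> \<xi>. \<phi> \<in> schwartz \<Longrightarrow> (1 + norm (\<xi>::real^'n)) ^ M * norm (fourier_inv \<phi> \<xi>) \<le> C * schwartz_seminorm N \<phi>"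
    using fourier_inv_decay[of M, where 'n='n] by blast
  define J where "J = (LINT x|lborel. norm (x::real^'n) powr (- k) / (1 + norm x) ^ M)"
  have "norm (of_hat g \<phi>) \<le> (A * C * J) * schwartz_seminorm N \<phi>" if \<phi>: "\<phi> \<in> schwartz" for \<phi>
  proof -
    have "norm (fourier_inv \<phi> x) \<le> (C * schwartz_seminorm N \<phi>) / (1 + norm x) ^ M" for x
    proof -
      have "(1 + norm x) ^ M > 0" by (auto intro!: zero_less_power add_pos_nonneg)
      then show ?thesis using C(2)[OF \<phi>, of x] by (simp add: pos_le_divide_eq mult.commute)
    qed
    then have "(LINT x|lborel. norm x powr (- k) * norm (fourier_inv \<phi> x)) \<le> (C * schwartz_seminorm N \<phi>) * J"
      unfolding J_def M_def by (rule integrable_powr_bound) (rule schwartz_measurable[OF fourier_inv_schwartz[OF \<phi>]])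
    then have "A * (LINT x|lborel. norm x powr (- k) * norm (fourier_inv \<phi> x)) \<le> A * ((C * schwartz_seminorm N \<phi>) * J)"
      by (intro mult_left_mono powr_boundedD(2)[OF g])
    then show ?thesis
      using powr_bounded_schwartz(2)[OF g fourier_inv_schwartz[OF \<phi>]] by (simp add: of_hat_eq \<phi> mult_ac)
  qed
  then show "\<exists>C N. \<forall>\<phi>\<in>schwartz. norm (of_hat g \<phi>) \<le> C * schwartz_seminorm N \<phi>" by blast
qed (rule of_hat_outside)

end

section \<open>Passing between a distribution and the representative of its transform\<close>

lemma locally_integrable_measurable:
  fixes g :: "real^'n::finite \<Rightarrow> complex"
  assumes "locally_integrable g"
  shows "g \<in> borel_measurable borel"
proof (rule borel_measurable_LIMSEQ_metric)
  show "(\<lambda>x. indicator (cball 0 (real j)) x *\<^sub>R g x) \<in> borel_measurable borel" for j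
  proof -
    have "integrable lborel (\<lambda>x. indicator (cball 0 (real j)) x *\<^sub>R g x)"
      using assms compact_cball unfolding locally_integrable_def set_integrable_def by blast
    from borel_measurable_integrable[OF this] show ?thesis by simp
  qed
  show "(\<lambda>j. indicator (cball 0 (real j)) x *\<^sub>R g x) \<longlonglongrightarrow> g x" if "x \<in> space borel" for x
  proof (rule tendsto_eventually)
    obtain N where N: "norm x \<le> real N" using real_arch_simple by blast
    show "\<forall>\<^sub>F j in sequentially. indicator (cball 0 (real j)) x *\<^sub>R g x = g x"
      unfolding eventually_sequentially
    proof (intro exI[of _ N] allI impI)
      fix j assume "N \<le> j"
      then have "norm x \<le> real j" using N by (meson of_nat_mono order_trans)
      then show "indicator (cball 0 (real j)) x *\<^sub>R g x = g x" by simp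
    qed
  qed
qed

text \<open>The duality bound with B = 0, applied to the difference. This makes the arbitrary choice
  in \<open>hat\<close> harmless.\<close>

lemma represents_unique:
  fixes g g' :: "real^'n::finite \<Rightarrow> complex"
  assumes "represents g T" "represents g' T"
  shows "AE x in lborel. g x = g' x"
proof -
  have [measurable]: "g \<in> borel_measurable borel" "g' \<in> borel_measurable borel"
    using assms by (auto simp: represents_def locally_integrable_measurable)
  have "AE x in lborel. norm (g x - g' x) \<le> 0"
  proof (rule bounded_by_duality)
    fix \<psi> :: "real^'n \<Rightarrow> complex" assume \<psi>: "\<psi> \<in> schwartz"
    have i: "integrable lborel (\<lambda>x. g x * \<psi> x)" "integrable lborel (\<lambda>x. g' x * \<psi> x)"
      "(LINT x|lborel. g x * \<psi> x) = (LINT x|lborel. g' x * \<psi> x)"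
      using assms \<psi> by (auto simp: represents_def)
    then show "integrable lborel (\<lambda>x. (g x - g' x) * \<psi> x)" by (simp add: left_diff_distrib)
    show "norm (LINT x|lborel. (g x - g' x) * \<psi> x) \<le> (LINT x|lborel. 0 * norm (\<psi> x))"
      using i by (simp add: left_diff_distrib)
  qed auto
  then show ?thesis by eventually_elim simp
qed

text \<open>Holds for every functional u: if the chosen \<open>hat u\<close> is not measurable, the
  essential supremum is infinite by convention.\<close>

lemma PM_esssup_nonneg: "0 \<le> PM_esssup k (u :: 'n::finite dist)"
proof (cases "(\<lambda>\<xi>. ereal (norm \<xi> powr k * norm (hat u \<xi>))) \<in> borel_measurable lborel")
  case True
  have "(0::ereal) = esssup (lborel :: (real^'n) measure) (\<lambda>_. 0)"
    by (rule esssup_const[symmetric]) (simp add: emeasure_lborel_UNIV)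
  also have "\<dots> \<le> PM_esssup k u" unfolding PM_esssup_def by (intro esssup_mono) auto
  finally show ?thesis .
next
  case False
  then show ?thesis unfolding PM_esssup_def by (subst esssup_non_measurable) (auto simp: top_ereal_def)
qed

lemma PM_norm_nonneg: "0 \<le> PM_norm k u"
  unfolding PM_norm_def by (rule real_of_ereal_pos[OF PM_esssup_nonneg])

text \<open>The interface from \<open>PM k\<close> to weighted functions. The last claim is Fourier
  inversion on test functions; off the Schwartz space both sides are 0 by the convention for
  \<open>tempered\<close>.\<close>

lemma PM_hat:
  assumes "u \<in> PM k"
  shows "represents (hat u) (dist_fourier u)" and "powr_bounded k (PM_norm k u) (hat u)"
    and "u = of_hat (hat u)"
proof -
  have "\<exists>g. represents g (dist_fourier u)" using assms by (simp add: PM_def)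
  then show r: "represents (hat u) (dist_fourier u)" unfolding hat_def by (rule someI_ex)
  have m: "hat u \<in> borel_measurable borel" using r by (simp add: represents_def locally_integrable_measurable)
  have fin: "PM_esssup k u = ereal (PM_norm k u)"
    using assms PM_esssup_nonneg[of k u] by (auto simp: PM_def PM_norm_def ereal_real)
  have "AE \<xi> in lborel. ereal (norm \<xi> powr k * norm (hat u \<xi>)) \<le> PM_esssup k u"
    unfolding PM_esssup_def by (rule esssup_AE)
  then have "AE \<xi> in lborel. norm (hat u \<xi>) \<le> PM_norm k u * norm \<xi> powr (- k)"
    unfolding fin using AE_lborel_singleton[of 0]
  proof eventually_elim
    case (elim \<xi>)
    then show ?case by (simp add: powr_minus_divide pos_le_divide_eq mult.commute)
  qed
  then show "powr_bounded k (PM_norm k u) (hat u)" by (simp add: powr_bounded_def m PM_norm_nonneg)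
  show "u = of_hat (hat u)"
  proof
    fix \<phi> show "u \<phi> = of_hat (hat u) \<phi>"
    proof (cases "\<phi> \<in> schwartz")
      case True
      have "of_hat (hat u) \<phi> = dist_fourier u (fourier_inv \<phi>)"
        using r True by (simp add: of_hat_eq represents_def fourier_inv_schwartz)
      then show ?thesis using True by (simp add: dist_fourier_def fourier_inv_schwartz fourier_fourier_inv)
    next
      case False
      then show ?thesis using assms by (simp add: of_hat_outside PM_def tempered_def)
    qed
  qed
qed

lemma PM_esssup_le:
  assumes "powr_bounded k A (hat u)"
  shows "PM_esssup k u \<le> ereal A"
  unfolding PM_esssup_def
proof (rule esssup_I)
  note [measurable] = powr_boundedD(1)[OF assms]
  show "(\<lambda>\<xi>. ereal (norm \<xi> powr k * norm (hat u \<xi>))) \<in> borel_measurable lborel" by measurable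
  show "AE \<xi> in lborel. ereal (norm \<xi> powr k * norm (hat u \<xi>)) \<le> ereal A"
    using powr_boundedD(3)[OF assms] AE_lborel_singleton[of 0]
    by eventually_elim (simp add: powr_minus_divide pos_le_divide_eq mult.commute)
qed

lemma PM_norm_le:
  assumes "powr_bounded k A (hat u)"
  shows "PM_norm k u \<le> A"
  using PM_esssup_le[OF assms] PM_esssup_nonneg[of k u] powr_boundedD(2)[OF assms]
  unfolding PM_norm_def by (cases "PM_esssup k u") auto

lemma powr_bounded_cong_AE:
  assumes "powr_bounded k A g" "AE x in lborel. g x = h x" "h \<in> borel_measurable borel"
  shows "powr_bounded k A h"
proof -
  have "AE x in lborel. norm (h x) \<le> A * norm x powr (- k)"
    using powr_boundedD(3)[OF assms(1)] assms(2) by eventually_elim simp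
  then show ?thesis using assms by (simp add: powr_bounded_def)
qed

context pm_exponent
begin

text \<open>The converse passage. The constant A transfers to the norm because
  \<open>hat (of_hat g)\<close> can differ from g only on a null set.\<close>

lemma of_hat_PM:
  fixes g :: "real^'n \<Rightarrow> complex"
  assumes g: "powr_bounded k A g"
  shows "of_hat g \<in> PM k" and "PM_norm k (of_hat g) \<le> A" and "AE x in lborel. hat (of_hat g) x = g x"
proof -
  have r: "represents g (dist_fourier (of_hat g))" by (rule represents_of_hat[OF g])
  then have r': "represents (hat (of_hat g)) (dist_fourier (of_hat g))"
    unfolding hat_def by (rule someI[where P="\<lambda>h. represents h (dist_fourier (of_hat g))"])
  show ae: "AE x in lborel. hat (of_hat g) x = g x" by (rule represents_unique[OF r' r])
  have m: "hat (of_hat g) \<in> borel_measurable borel" using r' by (simp add: represents_def locally_integrable_measurable)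
  have "AE x in lborel. g x = hat (of_hat g) x" using ae by eventually_elim simp
  then have b: "powr_bounded k A (hat (of_hat g))" by (rule powr_bounded_cong_AE[OF g _ m])
  show "PM_norm k (of_hat g) \<le> A" by (rule PM_norm_le[OF b])
  have "PM_esssup k (of_hat g) < \<infinity>" using PM_esssup_le[OF b] by (auto simp: less_top[symmetric])
  then show "of_hat g \<in> PM k" using of_hat_tempered[OF g] r by (auto simp: PM_def)
qed

lemma of_hat_diff:
  fixes f g :: "real^'n \<Rightarrow> complex"
  assumes "powr_bounded k A f" "powr_bounded k B g"
  shows "of_hat (\<lambda>x. f x - g x) = of_hat f - of_hat g"
proof
  fix \<phi> :: "real^'n \<Rightarrow> complex"
  show "of_hat (\<lambda>x. f x - g x) \<phi> = (of_hat f - of_hat g) \<phi>"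
    using powr_bounded_schwartz(1)[OF assms(1) fourier_inv_schwartz] powr_bounded_schwartz(1)[OF assms(2) fourier_inv_schwartz]
    by (cases "\<phi> \<in> schwartz") (auto simp: of_hat_eq of_hat_outside left_diff_distrib)
qed

lemma PM_diff:
  fixes u v :: "'n dist"
  assumes "u \<in> PM k" "v \<in> PM k"
  shows "u - v \<in> PM k" and "AE x in lborel. hat (u - v) x = hat u x - hat v x"
proof -
  note b = PM_hat(2)[OF assms(1)] PM_hat(2)[OF assms(2)]
  have eq: "u - v = of_hat (\<lambda>x. hat u x - hat v x)"
    using of_hat_diff[OF b] PM_hat(3)[OF assms(1)] PM_hat(3)[OF assms(2)] by simp
  show "u - v \<in> PM k" "AE x in lborel. hat (u - v) x = hat u x - hat v x"
    unfolding eq by (rule of_hat_PM[OF powr_bounded_diff[OF b]])+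
qed

lemma powr_bounded_hat_diff:
  fixes u v :: "'n dist"
  assumes "u \<in> PM k" "v \<in> PM k"
  shows "powr_bounded k (PM_norm k (u - v)) (\<lambda>x. hat u x - hat v x)"
proof -
  note [measurable] = powr_boundedD(1)[OF PM_hat(2)[OF assms(1)]] powr_boundedD(1)[OF PM_hat(2)[OF assms(2)]]
  show ?thesis
    by (rule powr_bounded_cong_AE[OF PM_hat(2)[OF PM_diff(1)[OF assms]] PM_diff(2)[OF assms]]) measurable
qed

lemma PM_norm_diff_le:
  fixes u v :: "'n dist"
  assumes "u \<in> PM k" "v \<in> PM k" "powr_bounded k A (\<lambda>x. hat u x - hat v x)"
  shows "PM_norm k (u - v) \<le> A"
proof (rule PM_norm_le, rule powr_bounded_cong_AE[OF assms(3)])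
  show "AE x in lborel. hat u x - hat v x = hat (u - v) x"
    using PM_diff(2)[OF assms(1,2)] by eventually_elim simp
  show "hat (u - v) \<in> borel_measurable borel"
    by (rule powr_boundedD(1)[OF PM_hat(2)[OF PM_diff(1)[OF assms(1,2)]]])
qed

lemma PM_eqI:
  fixes u v :: "'n dist"
  assumes "u \<in> PM k" "v \<in> PM k" "PM_norm k (u - v) \<le> 0"
  shows "u = v"
proof -
  have ae: "AE x in lborel. hat u x = hat v x"
    using powr_boundedD(3)[OF powr_bounded_hat_diff[OF assms(1,2)]]
  proof eventually_elim
    case (elim x)
    have "PM_norm k (u - v) * norm x powr (- k) \<le> 0" using assms(3) by (intro mult_nonpos_nonneg) auto
    then have "norm (hat u x - hat v x) \<le> 0" using elim by (rule order_trans[rotated])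
    then show ?case by simp
  qed
  have "of_hat (hat u) = of_hat (hat v)"
  proof
    fix \<phi> :: "real^'n \<Rightarrow> complex"
    show "of_hat (hat u) \<phi> = of_hat (hat v) \<phi>"
    proof (cases "\<phi> \<in> schwartz")
      case True
      note [measurable] = powr_boundedD(1)[OF PM_hat(2)[OF assms(1)]] powr_boundedD(1)[OF PM_hat(2)[OF assms(2)]]
        schwartz_measurable[OF fourier_inv_schwartz[OF True]]
      show ?thesis unfolding of_hat_eq[OF True]
        by (rule integral_cong_AE) (measurable, use ae in \<open>eventually_elim, simp\<close>)
    qed (simp add: of_hat_outside)
  qed
  then show ?thesis using PM_hat(3)[OF assms(1)] PM_hat(3)[OF assms(2)] by simp
qed

end

section \<open>The Hardy potential\<close>

text \<open>Pairing with a weight \<kappa> is replaced by an integral of pairings with the kernels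
  that compose it. Integrating in t first returns \<kappa> |f|, which supplies the integrability for
  Fubini.\<close>

lemma integral_superposition:
  fixes f :: "real^'n::finite \<Rightarrow> complex" and K :: "real \<Rightarrow> real^'n \<Rightarrow> real"
  assumes [measurable]: "(\<lambda>(t, x). K t x) \<in> borel_measurable (borel \<Otimes>\<^sub>M borel)" "f \<in> borel_measurable borel"
      "\<kappa> \<in> borel_measurable borel"
    and K: "\<And>t x. 0 \<le> K t x" "AE x in lborel. (\<integral>\<^sup>+t. ennreal (K t x) \<partial>lborel) = ennreal (\<kappa> x)" and \<kappa>: "\<And>x. 0 \<le> \<kappa> x"
    and i: "integrable lborel (\<lambda>x. \<kappa> x * norm (f x))"
  shows "(LINT t|lborel. (LINT x|lborel. of_real (K t x) * f x)) = (LINT x|lborel. of_real (\<kappa> x) * f x)"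
proof -
  have m: "(\<lambda>(t, x). of_real (K t x) * f x) \<in> borel_measurable (lborel \<Otimes>\<^sub>M lborel)" by measurable
  have "integrable (lborel \<Otimes>\<^sub>M lborel) (\<lambda>(t, x). of_real (K t x) * f x)"
  proof (rule integrableI_bounded[OF m])
    have "(\<integral>\<^sup>+z. ennreal (norm (case z of (t, x) \<Rightarrow> of_real (K t x) * f x)) \<partial>(lborel \<Otimes>\<^sub>M lborel))
       = (\<integral>\<^sup>+x. (\<integral>\<^sup>+t. ennreal (norm (of_real (K t x) * f x)) \<partial>lborel) \<partial>lborel)"
      by (subst lborel_pair.nn_integral_snd[symmetric]) (use m in auto)
    also have "\<dots> = (\<integral>\<^sup>+x. ennreal (\<kappa> x * norm (f x)) \<partial>lborel)"
      using K(2)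
    proof (intro nn_integral_cong_AE, eventually_elim)
      case (elim x)
      have "(\<integral>\<^sup>+t. ennreal (norm (of_real (K t x) * f x)) \<partial>lborel) = (\<integral>\<^sup>+t. ennreal (K t x) * ennreal (norm (f x)) \<partial>lborel)"
        using K(1) by (intro nn_integral_cong) (simp add: norm_mult ennreal_mult')
      also have "\<dots> = ennreal (\<kappa> x) * ennreal (norm (f x))" by (subst nn_integral_multc) (auto simp: elim)
      finally show ?case using \<kappa> by (simp add: ennreal_mult')
    qed
    also have "\<dots> < \<infinity>" using i \<kappa> by (subst nn_integral_eq_integral) auto
    finally show "(\<integral>\<^sup>+z. ennreal (norm (case z of (t, x) \<Rightarrow> of_real (K t x) * f x)) \<partial>(lborel \<Otimes>\<^sub>M lborel)) < \<infinity>" .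
  qed
  from lborel_pair.Fubini_integral[OF this]
  have "(LINT t|lborel. (LINT x|lborel. of_real (K t x) * f x)) = (LINT x|lborel. (LINT t|lborel. of_real (K t x) * f x))" by simp
  also have "\<dots> = (LINT x|lborel. of_real (\<kappa> x) * f x)"
  proof (rule integral_cong_AE)
    show "AE x in lborel. (LINT t|lborel. of_real (K t x) * f x) = of_real (\<kappa> x) * f x"
      using K(2)
    proof eventually_elim
      case (elim x)
      have "(LINT t|lborel. K t x) = \<kappa> x"
        using elim K(1) \<kappa> by (subst integral_eq_nn_integral) auto
      then show ?case by (simp add: integral_mult_left_zero integral_complex_of_real)
    qed
  qed measurable
  finally show ?thesis .
qed

text \<open>The total mass of an exponential density with rate pi |x|^2. It represents |x|^(-2) by
  Gaussians for the Hardy potential and also evaluates the time integral of the heat symbol.\<close>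

lemma nn_integral_gauss_time:
  fixes x :: "real^'n::finite"
  assumes "x \<noteq> 0"
  shows "(\<integral>\<^sup>+t. ennreal (indicator {0<..} t * (pi * gauss t x)) \<partial>lborel) = ennreal (norm x powr (- 2))"
proof -
  define l where "l = pi * (norm x)\<^sup>2"
  have l: "l > 0" using assms by (simp add: l_def)
  interpret prob_space "density lborel (exponential_density l)" by (rule prob_space_exponential_density[OF l])
  have 1: "(\<integral>\<^sup>+t. ennreal (exponential_density l t) \<partial>lborel) = 1"
    using emeasure_space_1 by (simp add: emeasure_density)
  have "(\<integral>\<^sup>+t. ennreal (indicator {0<..} t * (pi * gauss t x)) \<partial>lborel)
     = (\<integral>\<^sup>+t. ennreal (norm x powr (- 2)) * ennreal (exponential_density l t) \<partial>lborel)"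
    using AE_lborel_singleton[of "0::real"]
  proof (intro nn_integral_cong_AE, eventually_elim)
    case (elim t)
    have "pi * gauss t x = norm x powr (- 2) * (l * exp (- t * l))"
      using assms by (simp add: gauss_def l_def powr_minus_divide mult_ac)
    then show ?case using elim by (auto simp: exponential_density_def indicator_def ennreal_mult'[symmetric])
  qed
  also have "\<dots> = ennreal (norm x powr (- 2))" by (subst nn_integral_cmult) (auto simp: 1)
  finally show ?thesis .
qed

text \<open>Under the superposition of Gaussians the multiplication formula replaces each
  \<open>gauss t\<close> by \<open>heat_kernel t\<close>. Integrating these over t without a weight
  gives the Riesz kernel with exponent n - 2.\<close>

lemma fourier_inverse_square:
  fixes \<psi> :: "real^'n::finite \<Rightarrow> complex"
  assumes \<psi>: "\<psi> \<in> schwartz" and n: "3 \<le> CARD('n)"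
  shows "(LINT x|lborel. of_real (norm x powr (- 2)) * fourier \<psi> x)
    = (LINT \<xi>|lborel. of_real (pi * nu (real CARD('n) - 2) * norm \<xi> powr (- (real CARD('n) - 2))) * \<psi> \<xi>)"
proof -
  interpret p2: pm_exponent 2 "TYPE('n)" by standard (use n in auto)
  interpret pn: pm_exponent "real CARD('n) - 2" "TYPE('n)" by standard (use n in auto)
  have F: "fourier \<psi> \<in> schwartz" by (rule fourier_schwartz[OF \<psi>])
  note [measurable] = schwartz_measurable[OF \<psi>] schwartz_measurable[OF F]
  have "(LINT x|lborel. of_real (norm x powr (- 2)) * fourier \<psi> x)
    = (LINT t|lborel. (LINT x|lborel. of_real (indicator {0<..} t * (pi * gauss t x)) * fourier \<psi> x))"
  proof (rule integral_superposition[symmetric])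
    show "AE x in lborel. (\<integral>\<^sup>+t. ennreal (indicator {0<..} t * (pi * gauss t x)) \<partial>lborel) = ennreal (norm (x::real^'n) powr (- 2))"
      using AE_lborel_singleton[of "0::real^'n"] by eventually_elim (rule nn_integral_gauss_time)
    show "integrable lborel (\<lambda>x. norm x powr - 2 * norm (fourier \<psi> x))" by (rule p2.integrable_powr_schwartz[OF F])
    show "(\<lambda>(t, x::real^'n). indicator {0<..} t * (pi * gauss t x)) \<in> borel_measurable (borel \<Otimes>\<^sub>M borel)"
      unfolding gauss_def by measurable
  qed (auto simp: gauss_def)
  also have "\<dots> = (LINT t|lborel. (LINT \<xi>|lborel. of_real (indicator {0<..} t * (pi * heat_kernel t \<xi>)) * \<psi> \<xi>))"
  proof (rule Bochner_Integration.integral_cong[OF refl])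
    fix t :: real
    show "(LINT x|lborel. of_real (indicator {0<..} t * (pi * gauss t x)) * fourier \<psi> x)
        = (LINT \<xi>|lborel. of_real (indicator {0<..} t * (pi * heat_kernel t \<xi>)) * \<psi> \<xi>)"
    proof (cases "t > 0")
      case True
      have "integrable lborel (\<lambda>x::real^'n. complex_of_real (gauss t x))"
        using gauss_integrable(1)[OF True, where 'n='n] by (simp add: complex_of_real_integrable_eq)
      from fourier_multiplication[OF schwartz_integrable0[OF \<psi>] this]
      have "(LINT x|lborel. of_real (gauss t x) * fourier \<psi> x) = (LINT \<xi>|lborel. of_real (heat_kernel t \<xi>) * \<psi> \<xi>)"
        by (simp add: fourier_gauss[OF True] mult.commute)
      then have "of_real pi * (LINT x|lborel. of_real (gauss t x) * fourier \<psi> x) = of_real pi * (LINT \<xi>|lborel. of_real (heat_kernel t \<xi>) * \<psi> \<xi>)"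
        by simp
      then show ?thesis unfolding integral_mult_right_zero[symmetric] using True by (simp add: mult.assoc)
    qed simp
  qed
  also have "\<dots> = (LINT \<xi>|lborel. of_real (pi * nu (real CARD('n) - 2) * norm \<xi> powr (- (real CARD('n) - 2))) * \<psi> \<xi>)"
  proof (rule integral_superposition)
    have nu: "0 \<le> nu (real CARD('n) - 2)" using n by (intro less_imp_le nu_pos) auto
    show "AE \<xi> in lborel. (\<integral>\<^sup>+t. ennreal (indicator {0<..} t * (pi * heat_kernel t \<xi>)) \<partial>lborel)
        = ennreal (pi * nu (real CARD('n) - 2) * norm (\<xi>::real^'n) powr (- (real CARD('n) - 2)))"
      using AE_lborel_singleton[of "0::real^'n"]
    proof eventually_elim
      case (elim \<xi>)
      have "ennreal (indicator {0<..} t * (pi * heat_kernel t \<xi>))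
         = ennreal pi * ennreal (indicator {0<..} t * t powr ((real CARD('n) - (real CARD('n) - 2)) / 2 - 1) * heat_kernel t \<xi>)" for t
        by (auto simp: indicator_def ennreal_mult'[symmetric])
      then have "(\<integral>\<^sup>+t. ennreal (indicator {0<..} t * (pi * heat_kernel t \<xi>)) \<partial>lborel)
         = ennreal pi * ennreal (nu (real CARD('n) - 2) * norm \<xi> powr (- (real CARD('n) - 2)))"
        using riesz_heat_kernel[of "real CARD('n) - 2" \<xi>] elim n by (simp only:) (subst nn_integral_cmult, auto)
      then show ?case by (simp add: ennreal_mult'[symmetric] mult.assoc)
    qed
    show "integrable lborel (\<lambda>\<xi>. pi * nu (real CARD('n) - 2) * norm \<xi> powr (- (real CARD('n) - 2)) * norm (\<psi> \<xi>))"
      using integrable_mult_right[OF pn.integrable_powr_schwartz[OF \<psi>], of "pi * nu (real CARD('n) - 2)"] by (simp add: mult_ac)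
    show "0 \<le> pi * nu (real CARD('n) - 2) * norm \<xi> powr (- (real CARD('n) - 2))" for \<xi> :: "real^'n" using nu by simp
    show "(\<lambda>(t, \<xi>::real^'n). indicator {0<..} t * (pi * heat_kernel t \<xi>)) \<in> borel_measurable (borel \<Otimes>\<^sub>M borel)" by measurable
  qed auto
  finally show ?thesis .
qed

text \<open>The transform is exactly a constant times |\<xi>|^(-(n-2)), so the upper bound for the
  norm is attained.\<close>

lemma hardy_PM:
  assumes n: "3 \<le> CARD('n::finite)"
  shows "(hardy c :: 'n dist) \<in> PM (real CARD('n) - 2)"
    and "PM_norm (real CARD('n) - 2) (hardy c :: 'n dist) = \<bar>c\<bar> * pi * nu (real CARD('n) - 2)"
proof -
  interpret pn: pm_exponent "real CARD('n) - 2" "TYPE('n)" by standard (use n in auto)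
  define \<kappa> where "\<kappa> = pi * nu (real CARD('n) - 2)"
  have \<kappa>: "\<kappa> > 0" unfolding \<kappa>_def using n by (intro mult_pos_pos nu_pos) auto
  define g where "g = (\<lambda>\<xi>::real^'n. complex_of_real (c * \<kappa> * norm \<xi> powr (- (real CARD('n) - 2))))"
  have ng: "norm (g \<xi>) = (\<bar>c\<bar> * \<kappa>) * norm \<xi> powr (- (real CARD('n) - 2))" for \<xi>
    using \<kappa> by (simp add: g_def abs_mult norm_mult)
  have b: "powr_bounded (real CARD('n) - 2) (\<bar>c\<bar> * \<kappa>) g"
    unfolding powr_bounded_def ng using \<kappa> by (auto simp: g_def)
  have eq: "hardy c = of_hat g"
  proof
    fix \<phi> :: "real^'n \<Rightarrow> complex"
    show "hardy c \<phi> = of_hat g \<phi>"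
    proof (cases "\<phi> \<in> schwartz")
      case True
      have "hardy c \<phi> = (LINT x|lborel. of_real c * (of_real (norm x powr (- 2)) * fourier (fourier_inv \<phi>) x))"
        using True by (simp add: hardy_def fourier_fourier_inv powr_minus_divide)
      also have "\<dots> = of_hat g \<phi>"
        unfolding integral_mult_right_zero fourier_inverse_square[OF fourier_inv_schwartz[OF True] n] of_hat_eq[OF True]
        unfolding integral_mult_right_zero[symmetric] by (simp add: g_def \<kappa>_def mult_ac)
      finally show ?thesis .
    qed (simp add: hardy_def of_hat_outside)
  qed
  show P: "(hardy c :: 'n dist) \<in> PM (real CARD('n) - 2)" unfolding eq by (rule pn.of_hat_PM[OF b])
  \<comment> \<open>A smaller norm would contradict the pointwise equality at almost every nonzero
    point, hence everywhere outside a null set.\<close>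
  have "\<bar>c\<bar> * \<kappa> \<le> PM_norm (real CARD('n) - 2) (hardy c :: 'n dist)"
  proof (rule ccontr)
    assume *: "\<not> ?thesis"
    have "AE x::real^'n in lborel. False"
      using powr_boundedD(3)[OF PM_hat(2)[OF P]] pn.of_hat_PM(3)[OF b, folded eq] AE_lborel_singleton[of "0::real^'n"]
    proof eventually_elim
      case (elim x)
      then show ?case using * ng[of x] by (simp add: mult_le_cancel_right)
    qed
    then show False using AE_lborel_False by blast
  qed
  then show "PM_norm (real CARD('n) - 2) (hardy c :: 'n dist) = \<bar>c\<bar> * pi * nu (real CARD('n) - 2)"
    using pn.of_hat_PM(2)[OF b, folded eq] by (simp add: \<kappa>_def mult.assoc)
qed

text \<open>Once the Gamma functional equation has removed \<open>nu k\<close>, the only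
  transcendental factor left is the one in the norm of the Hardy potential. The threshold (k - 2)(n
  - k) is what remains.\<close>

lemma C_const_eq:
  assumes "2 < k" "k < n"
  shows "C_const n k = 1 / (pi * nu (n - 2) * ((k - 2) * (n - k)))"
proof -
  have "nu (k - 2) > 0" "nu (n - 2) > 0" using assms by (auto intro!: nu_pos)
  moreover have nk: "nu k = nu (k - 2) * (k - 2) / (2 * pi)" using nu_plus_2[of "k - 2"] assms by simp
  ultimately show ?thesis unfolding C_const_def K_const_eq[OF assms] nk using assms
    by (simp add: divide_simps power2_eq_square)
qed

section \<open>The a priori estimate\<close>

locale equation =
  fixes k n :: real and n_type :: "'n::finite itself"
  assumes k2: "2 < k" and kn: "k < n" and n3: "3 \<le> CARD('n)" and n: "n = real CARD('n)"
begin

text \<open>The instance \<open>pk\<close> serves data and solutions, \<open>pv\<close> potentials,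
  and \<open>pc\<close> convolutions of a potential with a solution.\<close>

sublocale pk: pm_exponent k n_type by standard (use k2 kn n3 n in auto)
sublocale pv: pm_exponent "n - 2" n_type by standard (use n3 n in auto)
sublocale pc: pm_exponent "k - 2" n_type by standard (use k2 kn n3 n in auto)

section \<open>Convolution with a potential\<close>

definition riesz_const :: real where "riesz_const = K_const 2 (n - k) n"

lemma riesz_const_pos: "0 < riesz_const"
  unfolding riesz_const_def K_const_eq[OF k2 kn] using k2 kn by (intro mult_pos_pos divide_pos_pos nu_pos) auto

lemma C_riesz_const: "C_const n k = riesz_const / (4 * pi\<^sup>2)"
  by (simp add: C_const_def riesz_const_def)

lemma C_pos: "0 < C_const n k"
  using riesz_const_pos by (simp add: C_riesz_const)

text \<open>Valid at every nonzero \<xi> although V and h are bounded only almost everywhere: the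
  exceptional sets, the one for V being reflected about \<xi>, are null for the integration in
  \<eta>.\<close>

lemma nn_convolution_bound:
  fixes V h :: "real^'n \<Rightarrow> complex"
  assumes V: "powr_bounded (n - 2) v V" and h: "powr_bounded k M h" and \<xi>: "\<xi> \<noteq> 0"
  shows "(\<integral>\<^sup>+\<eta>. ennreal (norm (V (\<xi> - \<eta>) * h \<eta>)) \<partial>lborel) \<le> ennreal (v * M * riesz_const * norm \<xi> powr (- (k - 2)))"
proof -
  note vM = powr_boundedD(2)[OF V] powr_boundedD(2)[OF h]
  have "(\<integral>\<^sup>+\<eta>. ennreal (norm (V (\<xi> - \<eta>) * h \<eta>)) \<partial>lborel)
    \<le> (\<integral>\<^sup>+\<eta>. ennreal (v * M) * ennreal (norm (\<xi> - \<eta>) powr (- (n - 2)) * norm \<eta> powr (- k)) \<partial>lborel)"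
    using AE_lborel_reflect[OF powr_boundedD(3)[OF V], of \<xi>] powr_boundedD(3)[OF h]
  proof (intro nn_integral_mono_AE, eventually_elim)
    case (elim \<eta>)
    have "norm (V (\<xi> - \<eta>)) * norm (h \<eta>) \<le> (v * norm (\<xi> - \<eta>) powr (- (n - 2))) * (M * norm \<eta> powr (- k))"
      by (intro mult_mono elim) (use vM in auto)
    then show ?case using vM by (simp add: norm_mult ennreal_mult'[symmetric] mult_ac ennreal_leI)
  qed
  also have "\<dots> = ennreal (v * M) * ennreal (riesz_const * norm \<xi> powr (- (k - 2)))"
    by (subst nn_integral_cmult, measurable) (simp only: riesz_convolution[OF n k2 kn \<xi>] riesz_const_def)
  finally show ?thesis using vM by (simp add: ennreal_mult'[symmetric] mult.assoc)
qed

lemma convolution_integrable: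
  fixes V h :: "real^'n \<Rightarrow> complex"
  assumes V: "powr_bounded (n - 2) v V" and h: "powr_bounded k M h" and \<xi>: "\<xi> \<noteq> 0"
  shows "integrable lborel (\<lambda>\<eta>. V (\<xi> - \<eta>) * h \<eta>)"
proof -
  note [measurable] = powr_boundedD(1)[OF V] powr_boundedD(1)[OF h]
  show ?thesis
    by (rule integrableI_bounded) (measurable, use nn_convolution_bound[OF assms] in \<open>auto intro: le_less_trans\<close>)
qed

lemma convolution_bound:
  fixes V h :: "real^'n \<Rightarrow> complex"
  assumes V: "powr_bounded (n - 2) v V" and h: "powr_bounded k M h" and \<xi>: "\<xi> \<noteq> 0"
  shows "norm (Defs.convolution V h \<xi>) \<le> v * M * riesz_const * norm \<xi> powr (- (k - 2))"
proof -
  have "ennreal (norm (Defs.convolution V h \<xi>)) \<le> (\<integral>\<^sup>+\<eta>. ennreal (norm (V (\<xi> - \<eta>) * h \<eta>)) \<partial>lborel)"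
    unfolding Defs.convolution_def by (rule integral_norm_bound_ennreal[OF convolution_integrable[OF assms]])
  also have "\<dots> \<le> ennreal (v * M * riesz_const * norm \<xi> powr (- (k - 2)))" by (rule nn_convolution_bound[OF assms])
  finally show ?thesis
    using powr_boundedD(2)[OF V] powr_boundedD(2)[OF h] riesz_const_pos by (subst (asm) ennreal_le_iff) auto
qed

lemma convolution_measurable [measurable]:
  fixes V h :: "real^'n \<Rightarrow> complex"
  assumes [measurable]: "V \<in> borel_measurable borel" "h \<in> borel_measurable borel"
  shows "Defs.convolution V h \<in> borel_measurable borel"
proof -
  have "(\<lambda>\<xi>. LINT \<eta>|lborel. V (\<xi> - \<eta>) * h \<eta>) \<in> borel_measurable borel"
    by (rule lborel.borel_measurable_lebesgue_integral) measurable
  then show ?thesis by (simp add: Defs.convolution_def[abs_def])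
qed

lemma convolution_powr_bounded:
  fixes V h :: "real^'n \<Rightarrow> complex"
  assumes V: "powr_bounded (n - 2) v V" and h: "powr_bounded k M h"
  shows "powr_bounded (k - 2) (v * M * riesz_const) (Defs.convolution V h)"
proof -
  note [measurable] = powr_boundedD(1)[OF V] powr_boundedD(1)[OF h]
  have "AE \<xi> in lborel. norm (Defs.convolution V h \<xi>) \<le> v * M * riesz_const * norm \<xi> powr (- (k - 2))"
    using AE_lborel_singleton[of "0::real^'n"] by eventually_elim (rule convolution_bound[OF assms])
  then show ?thesis using powr_boundedD(2)[OF V] powr_boundedD(2)[OF h] riesz_const_pos
    by (simp add: powr_bounded_def convolution_measurable)
qed

lemma convolution_product_integrable:
  fixes V h \<rho> :: "real^'n \<Rightarrow> complex"
  assumes V: "powr_bounded (n - 2) v V" and h: "powr_bounded k M h"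
    and [measurable]: "\<rho> \<in> borel_measurable borel" and \<rho>: "integrable lborel (\<lambda>\<xi>. norm \<xi> powr (- (k - 2)) * norm (\<rho> \<xi>))"
  shows "integrable (lborel \<Otimes>\<^sub>M lborel) (\<lambda>(\<xi>, \<eta>). V (\<xi> - \<eta>) * h \<eta> * \<rho> \<xi>)"
proof -
  note [measurable] = powr_boundedD(1)[OF V] powr_boundedD(1)[OF h]
  note vM = powr_boundedD(2)[OF V] powr_boundedD(2)[OF h]
  have m: "(\<lambda>(\<xi>, \<eta>). V (\<xi> - \<eta>) * h \<eta> * \<rho> \<xi>) \<in> borel_measurable (lborel \<Otimes>\<^sub>M lborel)" by measurable
  show ?thesis
  proof (rule integrableI_bounded[OF m])
    have "(\<integral>\<^sup>+z. ennreal (norm (case z of (\<xi>, \<eta>) \<Rightarrow> V (\<xi> - \<eta>) * h \<eta> * \<rho> \<xi>)) \<partial>(lborel \<Otimes>\<^sub>M lborel))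
       = (\<integral>\<^sup>+\<xi>. (\<integral>\<^sup>+\<eta>. ennreal (norm (V (\<xi> - \<eta>) * h \<eta> * \<rho> \<xi>)) \<partial>lborel) \<partial>lborel)"
      by (subst lborel.nn_integral_fst[symmetric]) (use m in auto)
    also have "\<dots> \<le> (\<integral>\<^sup>+\<xi>. ennreal ((v * M * riesz_const) * (norm \<xi> powr (- (k - 2)) * norm (\<rho> \<xi>))) \<partial>lborel)"
      using AE_lborel_singleton[of "0::real^'n"]
    proof (intro nn_integral_mono_AE, eventually_elim)
      case (elim \<xi>)
      have "(\<integral>\<^sup>+\<eta>. ennreal (norm (V (\<xi> - \<eta>) * h \<eta> * \<rho> \<xi>)) \<partial>lborel)
         = (\<integral>\<^sup>+\<eta>. ennreal (norm (V (\<xi> - \<eta>) * h \<eta>)) * ennreal (norm (\<rho> \<xi>)) \<partial>lborel)"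
        by (intro nn_integral_cong) (simp add: norm_mult ennreal_mult')
      also have "\<dots> = (\<integral>\<^sup>+\<eta>. ennreal (norm (V (\<xi> - \<eta>) * h \<eta>)) \<partial>lborel) * ennreal (norm (\<rho> \<xi>))"
        by (rule nn_integral_multc) measurable
      also have "\<dots> \<le> ennreal (v * M * riesz_const * norm \<xi> powr (- (k - 2))) * ennreal (norm (\<rho> \<xi>))"
        by (intro mult_right_mono nn_convolution_bound[OF V h elim(2)]) auto
      also have "\<dots> = ennreal ((v * M * riesz_const) * (norm \<xi> powr (- (k - 2)) * norm (\<rho> \<xi>)))"
        using vM riesz_const_pos by (simp add: ennreal_mult'[symmetric] mult.assoc)
      finally show ?case .
    qed
    also have "\<dots> < \<infinity>"
      using integrable_mult_right[OF \<rho>, of "v * M * riesz_const"] vM riesz_const_pos by (subst nn_integral_eq_integral) auto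
    finally show "(\<integral>\<^sup>+z. ennreal (norm (case z of (\<xi>, \<eta>) \<Rightarrow> V (\<xi> - \<eta>) * h \<eta> * \<rho> \<xi>)) \<partial>(lborel \<Otimes>\<^sub>M lborel)) < \<infinity>" .
  qed
qed

text \<open>The adjoint form of convolution with V. It isolates h, so that weak continuity of a
  solution can act on a fixed test function.\<close>

lemma convolution_swap:
  fixes V h \<rho> :: "real^'n \<Rightarrow> complex"
  assumes V: "powr_bounded (n - 2) v V" and h: "powr_bounded k M h"
    and \<rho>: "\<rho> \<in> borel_measurable borel" "integrable lborel (\<lambda>\<xi>. norm \<xi> powr (- (k - 2)) * norm (\<rho> \<xi>))"
  shows "(LINT \<xi>|lborel. Defs.convolution V h \<xi> * \<rho> \<xi>) = (LINT \<eta>|lborel. h \<eta> * (LINT \<xi>|lborel. V (\<xi> - \<eta>) * \<rho> \<xi>))"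
proof -
  have "(LINT \<xi>|lborel. Defs.convolution V h \<xi> * \<rho> \<xi>) = (LINT \<xi>|lborel. (LINT \<eta>|lborel. V (\<xi> - \<eta>) * h \<eta> * \<rho> \<xi>))"
    unfolding Defs.convolution_def by simp
  also have "\<dots> = (LINT \<eta>|lborel. (LINT \<xi>|lborel. V (\<xi> - \<eta>) * h \<eta> * \<rho> \<xi>))"
    by (rule lborel_pair.Fubini_integral[symmetric]) (rule convolution_product_integrable[OF assms])
  also have "\<dots> = (LINT \<eta>|lborel. h \<eta> * (LINT \<xi>|lborel. V (\<xi> - \<eta>) * \<rho> \<xi>))"
    by (subst integral_mult_right_zero[symmetric]) (simp add: mult_ac)
  finally show ?thesis .
qed

text \<open>The adjoint maps the weighted L^1 space with exponent k - 2 to that with exponent k.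
  Inserting the extremal function h = |\<eta>|^(-k) into the Fubini statement gives the weighted
  integrability at once.\<close>

lemma convolution_test_integrable:
  fixes V \<rho> :: "real^'n \<Rightarrow> complex"
  assumes V: "powr_bounded (n - 2) v V"
    and [measurable]: "\<rho> \<in> borel_measurable borel" and \<rho>: "integrable lborel (\<lambda>\<xi>. norm \<xi> powr (- (k - 2)) * norm (\<rho> \<xi>))"
  shows "(\<lambda>\<eta>. LINT \<xi>|lborel. V (\<xi> - \<eta>) * \<rho> \<xi>) \<in> borel_measurable borel"
    and "integrable lborel (\<lambda>\<eta>. norm \<eta> powr (- k) * norm (LINT \<xi>|lborel. V (\<xi> - \<eta>) * \<rho> \<xi>))"
proof -
  note [measurable] = powr_boundedD(1)[OF V]
  show m[measurable]: "(\<lambda>\<eta>. LINT \<xi>|lborel. V (\<xi> - \<eta>) * \<rho> \<xi>) \<in> borel_measurable borel"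
    by (rule lborel.borel_measurable_lebesgue_integral) measurable
  define h where "h = (\<lambda>\<eta>::real^'n. complex_of_real (norm \<eta> powr (- k)))"
  have h: "powr_bounded k 1 h" by (auto simp: powr_bounded_def h_def)
  from lborel_pair.integrable_snd[OF convolution_product_integrable[OF V h assms(2) \<rho>]]
  have "integrable lborel (\<lambda>\<eta>. LINT \<xi>|lborel. V (\<xi> - \<eta>) * h \<eta> * \<rho> \<xi>)" .
  then have "integrable lborel (\<lambda>\<eta>. norm (LINT \<xi>|lborel. V (\<xi> - \<eta>) * h \<eta> * \<rho> \<xi>))" by (rule integrable_norm)
  moreover have "norm (LINT \<xi>|lborel. V (\<xi> - \<eta>) * h \<eta> * \<rho> \<xi>) = norm \<eta> powr (- k) * norm (LINT \<xi>|lborel. V (\<xi> - \<eta>) * \<rho> \<xi>)" for \<eta>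
  proof -
    have "(LINT \<xi>|lborel. V (\<xi> - \<eta>) * h \<eta> * \<rho> \<xi>) = h \<eta> * (LINT \<xi>|lborel. V (\<xi> - \<eta>) * \<rho> \<xi>)"
      by (subst integral_mult_right_zero[symmetric]) (simp add: mult_ac)
    then show ?thesis by (simp add: norm_mult h_def)
  qed
  ultimately show "integrable lborel (\<lambda>\<eta>. norm \<eta> powr (- k) * norm (LINT \<xi>|lborel. V (\<xi> - \<eta>) * \<rho> \<xi>))" by simp
qed

section \<open>The tested equation and its dependence on time\<close>

lemma X_spaceD:
  assumes "u \<in> X_space k"
  obtains B where "0 \<le> B" "\<And>t. 0 \<le> t \<Longrightarrow> u t \<in> PM k" "\<And>t. 0 \<le> t \<Longrightarrow> PM_norm k (u t) \<le> B"
    "\<And>t. 0 \<le> t \<Longrightarrow> powr_bounded k B (hat (u t :: 'n dist))"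
proof -
  obtain B where B: "\<And>t. 0 \<le> t \<Longrightarrow> PM_norm k (u t) \<le> B" using assms by (auto simp: X_space_def)
  have P: "\<And>t. 0 \<le> t \<Longrightarrow> u t \<in> PM k" using assms by (auto simp: X_space_def)
  have B0: "0 \<le> B" using B[of 0] PM_norm_nonneg[of k "u 0"] by simp
  have "powr_bounded k B (hat (u t))" if t: "0 \<le> t" for t
  proof -
    note b = PM_hat(2)[OF P[OF t]]
    have "AE x in lborel. norm (hat (u t) x) \<le> B * norm x powr (- k)"
      using powr_boundedD(3)[OF b]
      by eventually_elim (erule order_trans, intro mult_right_mono B t, simp)
    then show ?thesis using B0 powr_boundedD(1)[OF b] by (simp add: powr_bounded_def)
  qed
  then show ?thesis using that B0 P B by blast
qed

lemma hat_pairing: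
  fixes u :: "'n dist"
  assumes "u \<in> PM k" "\<phi> \<in> schwartz"
  shows "(LINT \<xi>|lborel. hat u \<xi> * \<phi> \<xi>) = u (fourier \<phi>)"
  using PM_hat(1)[OF assms(1)] assms(2) by (simp add: represents_def dist_fourier_def)

text \<open>The time integrand of \<open>L_hat\<close> is continuous because weak continuity of \<open>u\<close> extends, by density,
  from Schwartz functions to test functions that are integrable against \<open>norm powr (- k)\<close>.\<close>

lemma pairing_continuous:
  fixes u :: "real \<Rightarrow> 'n dist" and \<Phi> :: "real^'n \<Rightarrow> complex"
  assumes u: "u \<in> X_space k" and m[measurable]: "\<Phi> \<in> borel_measurable borel"
    and \<Phi>: "integrable lborel (\<lambda>\<eta>. norm \<eta> powr (- k) * norm (\<Phi> \<eta>))"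
  shows "continuous_on {0..} (\<lambda>s. LINT \<eta>|lborel. hat (u s) \<eta> * \<Phi> \<eta>)"
proof -
  obtain B where B: "0 \<le> B" "\<And>t. 0 \<le> t \<Longrightarrow> u t \<in> PM k" "\<And>t. 0 \<le> t \<Longrightarrow> powr_bounded k B (hat (u t))"
    using X_spaceD[OF u] by metis
  have gs: "(\<lambda>x::real^'n. complex_of_real (gauss (1/2) x)) \<in> schwartz" by (rule gauss_schwartz) simp
  have wi: "integrable lborel (\<lambda>x::real^'n. norm x powr (- k) * gauss (1/2) x)"
    using pk.integrable_powr_schwartz[OF gs] by (simp add: gauss_def)
  have "\<exists>\<phi>. \<phi> \<in> schwartz \<and> integrable lborel (\<lambda>x. norm x powr (- k) * norm (\<phi> x - \<Phi> x)) \<and>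
      (LINT x|lborel. norm x powr (- k) * norm (\<phi> x - \<Phi> x)) < inverse (real (Suc j))" for j
  proof (rule schwartz_dense[where w="\<lambda>x::real^'n. norm x powr (- k)" and \<Phi>=\<Phi> and e="inverse (real (Suc j))"])
    show "(\<lambda>x::real^'n. norm x powr (- k)) \<in> borel_measurable borel" by measurable
    show "0 \<le> norm x powr (- k)" for x :: "real^'n" by simp
    show "0 < inverse (real (Suc j))" by simp
  qed (rule wi, rule m, rule \<Phi>, rule exI, intro conjI)
  then obtain \<phi> where "\<forall>j. \<phi> j \<in> schwartz \<and> integrable lborel (\<lambda>x. norm x powr (- k) * norm (\<phi> j x - \<Phi> x)) \<and>
      (LINT x|lborel. norm x powr (- k) * norm (\<phi> j x - \<Phi> x)) < inverse (real (Suc j))"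
    by (rule choice[OF allI, THEN exE])
  then have \<phi>: "\<And>j. \<phi> j \<in> schwartz" "\<And>j. integrable lborel (\<lambda>x. norm x powr (- k) * norm (\<phi> j x - \<Phi> x))"
      "\<And>j. (LINT x|lborel. norm x powr (- k) * norm (\<phi> j x - \<Phi> x)) < inverse (real (Suc j))"
    by simp_all
  have [measurable]: "\<phi> j \<in> borel_measurable borel" for j by (rule schwartz_measurable[OF \<phi>(1)])
  \<comment> \<open>The error is uniform in s because elements of X_k are bounded in time; hence the
    limit is uniform and inherits continuity.\<close>
  have le: "dist (LINT \<eta>|lborel. hat (u s) \<eta> * \<phi> j \<eta>) (LINT \<eta>|lborel. hat (u s) \<eta> * \<Phi> \<eta>) \<le> B * inverse (real (Suc j))"
    if s: "0 \<le> s" for s j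
  proof -
    have i: "integrable lborel (\<lambda>\<eta>. hat (u s) \<eta> * \<phi> j \<eta>)" "integrable lborel (\<lambda>\<eta>. hat (u s) \<eta> * \<Phi> \<eta>)"
      by (rule pk.powr_bounded_schwartz[OF B(3)[OF s] \<phi>(1)], rule pk.powr_bounded_integrable[OF B(3)[OF s] \<Phi> m])
    have "dist (LINT \<eta>|lborel. hat (u s) \<eta> * \<phi> j \<eta>) (LINT \<eta>|lborel. hat (u s) \<eta> * \<Phi> \<eta>)
       = norm (LINT \<eta>|lborel. hat (u s) \<eta> * (\<phi> j \<eta> - \<Phi> \<eta>))"
      using i by (simp add: dist_norm right_diff_distrib)
    also have "\<dots> \<le> B * (LINT x|lborel. norm x powr (- k) * norm (\<phi> j x - \<Phi> x))"
      by (rule pk.powr_bounded_integrable[OF B(3)[OF s] \<phi>(2)]) measurable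
    also have "\<dots> \<le> B * inverse (real (Suc j))" by (intro mult_left_mono less_imp_le \<phi>(3) B(1))
    finally show ?thesis .
  qed
  show ?thesis
  proof (rule uniform_limit_theorem[where F=sequentially and f="\<lambda>j s. LINT \<eta>|lborel. hat (u s) \<eta> * \<phi> j \<eta>"])
    show "\<forall>\<^sub>F j in sequentially. continuous_on {0..} (\<lambda>s. LINT \<eta>|lborel. hat (u s) \<eta> * \<phi> j \<eta>)"
    proof (intro always_eventually allI)
      fix j
      have "continuous_on {0..} (\<lambda>s. u s (fourier (\<phi> j)))"
        using u fourier_schwartz[OF \<phi>(1)] by (simp add: X_space_def)
      then show "continuous_on {0..} (\<lambda>s. LINT \<eta>|lborel. hat (u s) \<eta> * \<phi> j \<eta>)"
        by (rule continuous_on_cong[THEN iffD1, rotated -1]) (auto simp: hat_pairing B(2) \<phi>(1))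
    qed
    show "uniform_limit {0..} (\<lambda>j s. LINT \<eta>|lborel. hat (u s) \<eta> * \<phi> j \<eta>) (\<lambda>s. LINT \<eta>|lborel. hat (u s) \<eta> * \<Phi> \<eta>) sequentially"
    proof (rule uniform_limitI)
      fix e :: real assume e: "e > 0"
      have "(\<lambda>j. B * inverse (real (Suc j))) \<longlonglongrightarrow> B * 0" by (intro tendsto_intros LIMSEQ_inverse_real_of_nat)
      then have "(\<lambda>j. B * inverse (real (Suc j))) \<longlonglongrightarrow> 0" by simp
      then have "\<forall>\<^sub>F j in sequentially. B * inverse (real (Suc j)) < e" by (rule order_tendstoD) (rule e)
      then show "\<forall>\<^sub>F j in sequentially. \<forall>s\<in>{0..}. dist (LINT \<eta>|lborel. hat (u s) \<eta> * \<phi> j \<eta>) (LINT \<eta>|lborel. hat (u s) \<eta> * \<Phi> \<eta>) < e"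
        by eventually_elim (use le in \<open>auto intro: le_less_trans\<close>)
    qed
  qed simp
qed

lemma heat_symbol_measurable [measurable]:
  "(\<lambda>(r, \<xi>::real^'n). heat_symbol r \<xi>) \<in> borel_measurable (borel \<Otimes>\<^sub>M borel)"
  unfolding heat_symbol_def by measurable

lemma norm_heat_symbol: "norm (heat_symbol r \<xi>) = gauss (4 * pi * r) \<xi>"
  unfolding heat_symbol_gauss by (simp add: gauss_def)

lemma norm_heat_symbol_le: "0 \<le> r \<Longrightarrow> norm (heat_symbol r \<xi>) \<le> 1"
  by (simp add: norm_heat_symbol gauss_def)

definition time_integrand :: "'n dist \<Rightarrow> (real \<Rightarrow> 'n dist) \<Rightarrow> (real^'n \<Rightarrow> complex) \<Rightarrow> real \<Rightarrow> real \<Rightarrow> complex" where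
  "time_integrand V u \<psi> t s = (LINT \<xi>|lborel. heat_symbol (t - s) \<xi> * Defs.convolution (hat V) (hat (u s)) \<xi> * \<psi> \<xi>)"

lemma time_integrand_integrable:
  fixes V :: "'n dist" and u :: "real \<Rightarrow> 'n dist"
  assumes V: "V \<in> PM (n - 2)" and u: "u \<in> X_space k" and \<psi>: "\<psi> \<in> schwartz"
  shows "set_integrable lborel {0..t} (time_integrand V u \<psi> t)"
proof (rule borel_integrable_atLeastAtMost')
  obtain B where B: "0 \<le> B" "\<And>t. 0 \<le> t \<Longrightarrow> u t \<in> PM k" "\<And>t. 0 \<le> t \<Longrightarrow> powr_bounded k B (hat (u t))"
    using X_spaceD[OF u] by metis
  define v where "v = PM_norm (n - 2) V"
  have Vb: "powr_bounded (n - 2) v (hat V)" unfolding v_def by (rule PM_hat(2)[OF V])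
  note [measurable] = schwartz_measurable[OF \<psi>] powr_boundedD(1)[OF Vb]
  define \<rho> where "\<rho> = (\<lambda>s \<xi>. heat_symbol (t - s) \<xi> * \<psi> \<xi>)"
  have [measurable]: "\<rho> s \<in> borel_measurable borel" for s unfolding \<rho>_def by measurable
  have wi: "integrable lborel (\<lambda>\<xi>. norm \<xi> powr (- (k - 2)) * norm (\<psi> \<xi>))" by (rule pc.integrable_powr_schwartz[OF \<psi>])
  have \<rho>le: "norm (\<rho> s \<xi>) \<le> norm (\<psi> \<xi>)" if "s \<le> t" for s \<xi>
    using mult_right_mono[OF norm_heat_symbol_le[of "t - s" \<xi>], of "norm (\<psi> \<xi>)"] that by (simp add: \<rho>_def norm_mult)
  have \<rho>i: "integrable lborel (\<lambda>\<xi>. norm \<xi> powr (- (k - 2)) * norm (\<rho> s \<xi>))" if "s \<le> t" for s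
    by (rule Bochner_Integration.integrable_bound[OF wi])
       (measurable, intro AE_I2, use \<rho>le[OF that] in \<open>auto simp: abs_mult intro!: mult_left_mono\<close>)
  have eq: "time_integrand V u \<psi> t s = (LINT \<xi>|lborel. Defs.convolution (hat V) (hat (u s)) \<xi> * \<rho> s \<xi>)" for s
    by (simp add: time_integrand_def \<rho>_def mult_ac)
  show "continuous_on {0..t} (time_integrand V u \<psi> t)"
    unfolding continuous_on_sequentially
  proof (intro allI ballI impI)
    fix x :: "nat \<Rightarrow> real" and a assume a: "a \<in> {0..t}" and x: "(\<forall>n. x n \<in> {0..t}) \<and> x \<longlonglongrightarrow> a"
    define \<Phi> where "\<Phi> = (\<lambda>\<eta>. LINT \<xi>|lborel. hat V (\<xi> - \<eta>) * \<rho> a \<xi>)"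
    have at: "a \<le> t" "0 \<le> a" and xt: "\<And>j. x j \<le> t" "\<And>j. 0 \<le> x j" using a x by auto
    have \<Phi>: "\<Phi> \<in> borel_measurable borel" "integrable lborel (\<lambda>\<eta>. norm \<eta> powr (- k) * norm (\<Phi> \<eta>))"
      unfolding \<Phi>_def by (rule convolution_test_integrable[OF Vb _ \<rho>i[OF at(1)]], measurable)+
    have cb: "powr_bounded (k - 2) (v * B * riesz_const) (Defs.convolution (hat V) (hat (u s)))" if "0 \<le> s" for s
      by (rule convolution_powr_bounded[OF Vb B(3)[OF that]])
    have ci: "integrable lborel (\<lambda>\<xi>. Defs.convolution (hat V) (hat (u s)) \<xi> * \<rho> r \<xi>)" if "0 \<le> s" "r \<le> t" for s r
      by (rule pc.powr_bounded_integrable[OF cb[OF that(1)] \<rho>i[OF that(2)]]) measurable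
    have sw: "(LINT \<xi>|lborel. Defs.convolution (hat V) (hat (u s)) \<xi> * \<rho> a \<xi>) = (LINT \<eta>|lborel. hat (u s) \<eta> * \<Phi> \<eta>)" if "0 \<le> s" for s
      unfolding \<Phi>_def by (rule convolution_swap[OF Vb B(3)[OF that] _ \<rho>i[OF at(1)]]) measurable
    have lim1: "(\<lambda>j. LINT \<eta>|lborel. hat (u (x j)) \<eta> * \<Phi> \<eta>) \<longlonglongrightarrow> (LINT \<eta>|lborel. hat (u a) \<eta> * \<Phi> \<eta>)"
    proof -
      have "continuous_on {0..} (\<lambda>s. LINT \<eta>|lborel. hat (u s) \<eta> * \<Phi> \<eta>)" by (rule pairing_continuous[OF u \<Phi>])
      then show ?thesis using at xt x unfolding continuous_on_sequentially by (auto simp: o_def)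
    qed
    have lim2: "(\<lambda>j. LINT \<xi>|lborel. norm \<xi> powr (- (k - 2)) * norm (\<rho> (x j) \<xi> - \<rho> a \<xi>)) \<longlonglongrightarrow> (LINT \<xi>::real^'n|lborel. 0)"
    proof (rule integral_dominated_convergence)
      show "integrable lborel (\<lambda>\<xi>. 2 * (norm \<xi> powr (- (k - 2)) * norm (\<psi> \<xi>)))" by (intro integrable_mult_right wi)
      show "AE \<xi> in lborel. (\<lambda>j. norm \<xi> powr (- (k - 2)) * norm (\<rho> (x j) \<xi> - \<rho> a \<xi>)) \<longlonglongrightarrow> 0"
      proof (intro AE_I2)
        fix \<xi> :: "real^'n"
        have "(\<lambda>j. \<rho> (x j) \<xi>) \<longlonglongrightarrow> \<rho> a \<xi>"
          unfolding \<rho>_def heat_symbol_def using x by (intro tendsto_intros) auto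
        then have "(\<lambda>j. norm \<xi> powr (- (k - 2)) * norm (\<rho> (x j) \<xi> - \<rho> a \<xi>)) \<longlonglongrightarrow> norm \<xi> powr (- (k - 2)) * norm (\<rho> a \<xi> - \<rho> a \<xi>)"
          by (intro tendsto_intros)
        then show "(\<lambda>j. norm \<xi> powr (- (k - 2)) * norm (\<rho> (x j) \<xi> - \<rho> a \<xi>)) \<longlonglongrightarrow> 0" by simp
      qed
      show "AE \<xi> in lborel. norm (norm \<xi> powr (- (k - 2)) * norm (\<rho> (x j) \<xi> - \<rho> a \<xi>)) \<le> 2 * (norm \<xi> powr (- (k - 2)) * norm (\<psi> \<xi>))" for j
      proof (intro AE_I2)
        fix \<xi> :: "real^'n"
        have "norm (\<rho> (x j) \<xi> - \<rho> a \<xi>) \<le> 2 * norm (\<psi> \<xi>)"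
          using norm_triangle_ineq4[of "\<rho> (x j) \<xi>" "\<rho> a \<xi>"] \<rho>le[OF xt(1), of j \<xi>] \<rho>le[OF at(1), of \<xi>] by linarith
        from mult_left_mono[OF this, of "norm \<xi> powr (- (k - 2))"]
        show "norm (norm \<xi> powr (- (k - 2)) * norm (\<rho> (x j) \<xi> - \<rho> a \<xi>)) \<le> 2 * (norm \<xi> powr (- (k - 2)) * norm (\<psi> \<xi>))"
          by (simp add: abs_mult mult_ac)
      qed
    qed measurable
    have lim3: "(\<lambda>j. LINT \<xi>|lborel. Defs.convolution (hat V) (hat (u (x j))) \<xi> * (\<rho> (x j) \<xi> - \<rho> a \<xi>)) \<longlonglongrightarrow> 0"
    proof (rule Lim_null_comparison)
      have d: "norm (LINT \<xi>|lborel. Defs.convolution (hat V) (hat (u (x j))) \<xi> * (\<rho> (x j) \<xi> - \<rho> a \<xi>))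
          \<le> (v * B * riesz_const) * (LINT \<xi>|lborel. norm \<xi> powr (- (k - 2)) * norm (\<rho> (x j) \<xi> - \<rho> a \<xi>))" for j
      proof (rule pc.powr_bounded_integrable(2)[OF cb[OF xt(2)]])
        show "integrable lborel (\<lambda>\<xi>. norm \<xi> powr (- (k - 2)) * norm (\<rho> (x j) \<xi> - \<rho> a \<xi>))"
        proof (rule Bochner_Integration.integrable_bound[OF Bochner_Integration.integrable_add[OF \<rho>i[OF xt(1), of j] \<rho>i[OF at(1)]]], measurable, intro AE_I2)
          fix \<xi> :: "real^'n"
          from mult_left_mono[OF norm_triangle_ineq4[of "\<rho> (x j) \<xi>" "\<rho> a \<xi>"], of "norm \<xi> powr (- (k - 2))"]
          show "norm (norm \<xi> powr (- (k - 2)) * norm (\<rho> (x j) \<xi> - \<rho> a \<xi>))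
             \<le> norm (norm \<xi> powr (- (k - 2)) * norm (\<rho> (x j) \<xi>) + norm \<xi> powr (- (k - 2)) * norm (\<rho> a \<xi>))"
            by (simp add: abs_mult distrib_left abs_of_nonneg)
        qed
      qed measurable
      then show "\<forall>\<^sub>F j in sequentially. norm (LINT \<xi>|lborel. Defs.convolution (hat V) (hat (u (x j))) \<xi> * (\<rho> (x j) \<xi> - \<rho> a \<xi>))
          \<le> (v * B * riesz_const) * (LINT \<xi>|lborel. norm \<xi> powr (- (k - 2)) * norm (\<rho> (x j) \<xi> - \<rho> a \<xi>))" by simp
      have "(\<lambda>j. (v * B * riesz_const) * (LINT \<xi>|lborel. norm \<xi> powr (- (k - 2)) * norm (\<rho> (x j) \<xi> - \<rho> a \<xi>))) \<longlonglongrightarrow> (v * B * riesz_const) * (LINT \<xi>::real^'n|lborel. 0)"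
        by (intro tendsto_mult tendsto_const lim2)
      then show "(\<lambda>j. (v * B * riesz_const) * (LINT \<xi>|lborel. norm \<xi> powr (- (k - 2)) * norm (\<rho> (x j) \<xi> - \<rho> a \<xi>))) \<longlonglongrightarrow> 0" by simp
    qed
    have "time_integrand V u \<psi> t (x j) = (LINT \<xi>|lborel. Defs.convolution (hat V) (hat (u (x j))) \<xi> * (\<rho> (x j) \<xi> - \<rho> a \<xi>)) + (LINT \<eta>|lborel. hat (u (x j)) \<eta> * \<Phi> \<eta>)" for j
      unfolding eq sw[OF xt(2), symmetric]
      using ci[OF xt(2) xt(1), of j j] ci[OF xt(2) at(1), of j] by (simp add: right_diff_distrib)
    moreover have "time_integrand V u \<psi> t a = 0 + (LINT \<eta>|lborel. hat (u a) \<eta> * \<Phi> \<eta>)"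
      unfolding eq sw[OF at(2), symmetric] by simp
    ultimately show "(time_integrand V u \<psi> t \<circ> x) \<longlonglongrightarrow> time_integrand V u \<psi> t a"
      unfolding o_def by (simp only:) (rule tendsto_add[OF lim3 lim1])
  qed
qed

lemma L_hat_time_integrand:
  "\<psi> \<in> schwartz \<Longrightarrow> L_hat V u t \<psi> = (LINT s:{0..t}|lborel. time_integrand V u \<psi> t s)"
  by (simp add: L_hat_def time_integrand_def)

lemma heat_op_fourier:
  fixes u :: "'n dist"
  assumes "u \<in> PM k" "0 \<le> t" "\<psi> \<in> schwartz"
  shows "heat_op t u (fourier \<psi>) = (LINT \<xi>|lborel. hat u \<xi> * (heat_symbol t \<xi> * \<psi> \<xi>))"
  using assms hat_pairing[OF assms(1) heat_mult_schwartz[OF assms(2,3)]]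
  by (simp add: heat_op_def dist_fourier_inv_def dist_mult_def dist_fourier_def fourier_schwartz fourier_inversion heat_mult_schwartz)

lemma L_op_fourier:
  assumes "\<psi> \<in> schwartz"
  shows "L_op V u t (fourier \<psi>) = L_hat V u t \<psi>"
  using assms by (simp add: L_op_def dist_fourier_inv_def fourier_schwartz fourier_inversion)

text \<open>Testing against \<open>fourier \<psi>\<close> cancels the inverse transforms in both
  terms. Nothing is lost, because every Schwartz function has this form.\<close>

lemma solves_fourier:
  fixes u\<^sub>0 V :: "'n dist"
  assumes "solves u\<^sub>0 V u" "u\<^sub>0 \<in> PM k" "u \<in> X_space k" "0 \<le> t" "\<psi> \<in> schwartz"
  shows "(LINT \<xi>|lborel. hat (u t) \<xi> * \<psi> \<xi>)
    = (LINT \<xi>|lborel. hat u\<^sub>0 \<xi> * (heat_symbol t \<xi> * \<psi> \<xi>)) + (LINT s:{0..t}|lborel. time_integrand V u \<psi> t s)"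
proof -
  have "u t \<in> PM k" using assms by (simp add: X_space_def)
  then have "(LINT \<xi>|lborel. hat (u t) \<xi> * \<psi> \<xi>) = u t (fourier \<psi>)" by (rule hat_pairing[OF _ assms(5)])
  also have "\<dots> = heat_op t u\<^sub>0 (fourier \<psi>) + L_op V u t (fourier \<psi>)"
    using assms(1,4) by (simp add: solves_def)
  finally show ?thesis
    by (simp add: heat_op_fourier[OF assms(2,4,5)] L_op_fourier[OF assms(5)] L_hat_time_integrand[OF assms(5)])
qed

text \<open>The substitution r = 4 pi (t - s) contributes 1/(4 pi) and the normalisation of the
  exponential density contributes 1/pi. Only an inequality holds because the integral over s stops
  at 0.\<close>

lemma heat_time_integral:
  fixes \<xi> :: "real^'n"
  assumes "\<xi> \<noteq> 0"
  shows "(\<integral>\<^sup>+s. ennreal (indicator {0..t} s * gauss (4 * pi * (t - s)) \<xi>) \<partial>lborel) \<le> ennreal (norm \<xi> powr (- 2) / (4 * pi\<^sup>2))"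
proof -
  define f where "f = (\<lambda>r. ennreal (indicator {0<..} r * (pi * gauss r \<xi>)))"
  have [measurable]: "f \<in> borel_measurable borel" unfolding f_def gauss_def by measurable
  have "ennreal (norm \<xi> powr (- 2)) = \<bar>- (4 * pi)\<bar> * (\<integral>\<^sup>+s. f (4 * pi * t + - (4 * pi) * s) \<partial>lborel)"
    unfolding nn_integral_gauss_time[OF assms, symmetric] f_def[symmetric] by (rule nn_integral_real_affine) auto
  then have *: "ennreal (norm \<xi> powr (- 2)) = ennreal (4 * pi) * (\<integral>\<^sup>+s. f (4 * pi * t + - (4 * pi) * s) \<partial>lborel)" by simp
  have "(\<integral>\<^sup>+s. ennreal (indicator {0..t} s * gauss (4 * pi * (t - s)) \<xi>) \<partial>lborel)
     \<le> (\<integral>\<^sup>+s. ennreal (1 / pi) * f (4 * pi * t + - (4 * pi) * s) \<partial>lborel)"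
    using AE_lborel_singleton[of t]
  proof (intro nn_integral_mono_AE, eventually_elim)
    case (elim s)
    show ?case
    proof (cases "s \<in> {0..t}")
      case True
      then have "0 < 4 * pi * t - 4 * pi * s" using elim by simp
      then have "ennreal (1 / pi) * f (4 * pi * t + - (4 * pi) * s) = ennreal (gauss (4 * pi * (t - s)) \<xi>)"
        by (simp add: f_def ennreal_mult'[symmetric] right_diff_distrib)
      then show ?thesis using True by simp
    qed simp
  qed
  also have "\<dots> = ennreal (1 / pi) * (\<integral>\<^sup>+s. f (4 * pi * t + - (4 * pi) * s) \<partial>lborel)"
    by (rule nn_integral_cmult) measurable
  also have "\<dots> = ennreal (1 / (4 * pi\<^sup>2)) * ennreal (norm \<xi> powr (- 2))"
  proof -
    have "ennreal (1 / (4 * pi\<^sup>2)) * ennreal (4 * pi) = ennreal (1 / pi)"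
      by (simp add: ennreal_mult'[symmetric] power2_eq_square)
    then show ?thesis unfolding * by (simp add: mult.assoc[symmetric])
  qed
  finally show ?thesis by (simp add: ennreal_mult'[symmetric])
qed

text \<open>The single estimate behind the a priori bound, the Lipschitz bound and uniqueness, which
  differ only in the choice of D and M. These are assumed at positive times only, as supplied by
  \<open>X_norm\<close>, whereas the conclusion includes t = 0.\<close>

lemma solution_estimate:
  fixes u\<^sub>0 v\<^sub>0 V W :: "'n dist"
  assumes PM: "u\<^sub>0 \<in> PM k" "v\<^sub>0 \<in> PM k" "V \<in> PM (n - 2)" "W \<in> PM (n - 2)"
    and X: "u \<in> X_space k" "v \<in> X_space k" and sol: "solves u\<^sub>0 V u" "solves v\<^sub>0 W v"
    and D: "\<And>s. 0 < s \<Longrightarrow> PM_norm k (u s - v s) \<le> D" and M: "\<And>s. 0 < s \<Longrightarrow> PM_norm k (v s) \<le> M"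
    and t: "0 \<le> t"
  shows "PM_norm k (u t - v t) \<le> PM_norm k (u\<^sub>0 - v\<^sub>0)
    + C_const n k * (PM_norm (n - 2) V * D + PM_norm (n - 2) (V - W) * M)"
proof -
  define a where "a = PM_norm k (u\<^sub>0 - v\<^sub>0)"
  define Q where "Q = PM_norm (n - 2) V * D + PM_norm (n - 2) (V - W) * M"
  have D0: "0 \<le> D" and M0: "0 \<le> M" using D[of 1] M[of 1] PM_norm_nonneg order_trans by (metis zero_less_one)+
  have Q0: "0 \<le> Q" unfolding Q_def by (intro add_nonneg_nonneg mult_nonneg_nonneg PM_norm_nonneg D0 M0)
  have a0: "0 \<le> a" unfolding a_def by (rule PM_norm_nonneg)
  have Pu: "u s \<in> PM k" and Pv: "v s \<in> PM k" if "0 \<le> s" for s using X that by (auto simp: X_space_def)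
  have bV: "powr_bounded (n - 2) (PM_norm (n - 2) V) (hat V)" by (rule PM_hat(2)[OF PM(3)])
  have bW: "powr_bounded (n - 2) (PM_norm (n - 2) W) (hat W)" by (rule PM_hat(2)[OF PM(4)])
  have bVW: "powr_bounded (n - 2) (PM_norm (n - 2) (V - W)) (\<lambda>x. hat V x - hat W x)"
    by (rule pv.powr_bounded_hat_diff[OF PM(3,4)])
  \<comment> \<open>The claimed weighted bound; the duality lemma reduces it to bounding the tested
    difference of the two equations.\<close>
  define B where "B = (\<lambda>\<xi>::real^'n. (a + C_const n k * Q) * norm \<xi> powr (- k))"
  have "AE \<xi> in lborel. norm (hat (u t) \<xi> - hat (v t) \<xi>) \<le> B \<xi>"
  proof (rule bounded_by_duality)
    note but = PM_hat(2)[OF Pu[OF t]] and bvt = PM_hat(2)[OF Pv[OF t]]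
    note [measurable] = powr_boundedD(1)[OF but] powr_boundedD(1)[OF bvt]
    show "(\<lambda>\<xi>. hat (u t) \<xi> - hat (v t) \<xi>) \<in> borel_measurable borel" by measurable
    show "B \<in> borel_measurable borel" unfolding B_def by measurable
    show "0 \<le> B x" for x using a0 Q0 C_pos by (simp add: B_def)
    fix \<psi> :: "real^'n \<Rightarrow> complex" assume \<psi>: "\<psi> \<in> schwartz"
    have [measurable]: "\<psi> \<in> borel_measurable borel" by (rule schwartz_measurable[OF \<psi>])
    have iuv: "integrable lborel (\<lambda>x. hat (u t) x * \<psi> x)" "integrable lborel (\<lambda>x. hat (v t) x * \<psi> x)"
      by (rule pk.powr_bounded_schwartz[OF but \<psi>], rule pk.powr_bounded_schwartz[OF bvt \<psi>])
    then show "integrable lborel (\<lambda>x. (hat (u t) x - hat (v t) x) * \<psi> x)" by (simp add: left_diff_distrib)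
    have wk: "integrable lborel (\<lambda>x. norm x powr (- k) * norm (\<psi> x))" by (rule pk.integrable_powr_schwartz[OF \<psi>])
    show "integrable lborel (\<lambda>x. B x * norm (\<psi> x))"
      using integrable_mult_right[OF wk, of "a + C_const n k * Q"] by (simp add: B_def mult.assoc)
    define J where "J = (LINT x|lborel. norm x powr (- k) * norm (\<psi> x))"
    have hs: "(\<lambda>\<xi>. heat_symbol t \<xi> * \<psi> \<xi>) \<in> schwartz" by (rule heat_mult_schwartz[OF t \<psi>])
    note [measurable] = schwartz_measurable[OF hs]
    have T1: "norm (LINT \<xi>|lborel. (hat u\<^sub>0 \<xi> - hat v\<^sub>0 \<xi>) * (heat_symbol t \<xi> * \<psi> \<xi>)) \<le> a * J"
    proof -
      have "norm (LINT \<xi>|lborel. (hat u\<^sub>0 \<xi> - hat v\<^sub>0 \<xi>) * (heat_symbol t \<xi> * \<psi> \<xi>))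
         \<le> a * (LINT x|lborel. norm x powr (- k) * norm (heat_symbol t x * \<psi> x))"
        unfolding a_def by (rule pk.powr_bounded_schwartz(2)[OF pk.powr_bounded_hat_diff[OF PM(1,2)] hs])
      also have "\<dots> \<le> a * J"
        unfolding J_def
      proof (intro mult_left_mono a0 Bochner_Integration.integral_mono wk pk.integrable_powr_schwartz hs)
        fix x :: "real^'n"
        show "norm (heat_symbol t x * \<psi> x) \<le> norm (\<psi> x)"
          using mult_right_mono[OF norm_heat_symbol_le[OF t, of x], of "norm (\<psi> x)"] by (simp add: norm_mult)
      qed auto
      finally show ?thesis .
    qed
    define G where "G = (\<lambda>s. time_integrand V u \<psi> t s - time_integrand W v \<psi> t s)"
    have iG: "set_integrable lborel {0..t} G"
      unfolding G_def by (intro set_integral_diff time_integrand_integrable PM X \<psi>)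
    \<comment> \<open>The right-hand side is an explicit jointly measurable function of s and \<xi>,
      so the later exchange of integrals never involves the representatives
      \<open>hat (u s)\<close>.\<close>
    have Gb: "ennreal (norm (G s)) \<le> (\<integral>\<^sup>+\<xi>. ennreal (gauss (4 * pi * (t - s)) \<xi>) * ennreal (riesz_const * Q * (norm \<xi> powr (- (k - 2)) * norm (\<psi> \<xi>))) \<partial>lborel)"
      if s: "0 < s" "s \<le> t" for s
    proof -
      have s0: "0 \<le> s" "0 \<le> t - s" using s by auto
      note bu = PM_hat(2)[OF Pu[OF s0(1)]] and bv = PM_hat(2)[OF Pv[OF s0(1)]]
      have buv: "powr_bounded k (PM_norm k (u s - v s)) (\<lambda>x. hat (u s) x - hat (v s) x)"
        by (rule pk.powr_bounded_hat_diff[OF Pu[OF s0(1)] Pv[OF s0(1)]])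
      note [measurable] = powr_boundedD(1)[OF bu] powr_boundedD(1)[OF bv] powr_boundedD(1)[OF bV] powr_boundedD(1)[OF bW]
      have hs: "(\<lambda>\<xi>. heat_symbol (t - s) \<xi> * \<psi> \<xi>) \<in> schwartz" by (rule heat_mult_schwartz[OF s0(2) \<psi>])
      define cu where "cu = Defs.convolution (hat V) (hat (u s))"
      define cv where "cv = Defs.convolution (hat W) (hat (v s))"
      have i1: "integrable lborel (\<lambda>\<xi>. cu \<xi> * (heat_symbol (t - s) \<xi> * \<psi> \<xi>))"
        unfolding cu_def by (rule pc.powr_bounded_schwartz(1)[OF convolution_powr_bounded[OF bV bu] hs])
      have i2: "integrable lborel (\<lambda>\<xi>. cv \<xi> * (heat_symbol (t - s) \<xi> * \<psi> \<xi>))"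
        unfolding cv_def by (rule pc.powr_bounded_schwartz(1)[OF convolution_powr_bounded[OF bW bv] hs])
      have "G s = (LINT \<xi>|lborel. (cu \<xi> - cv \<xi>) * (heat_symbol (t - s) \<xi> * \<psi> \<xi>))"
      proof -
        have "time_integrand V u \<psi> t s = (LINT \<xi>|lborel. cu \<xi> * (heat_symbol (t - s) \<xi> * \<psi> \<xi>))"
          "time_integrand W v \<psi> t s = (LINT \<xi>|lborel. cv \<xi> * (heat_symbol (t - s) \<xi> * \<psi> \<xi>))"
          by (simp_all add: time_integrand_def cu_def cv_def mult_ac)
        then show ?thesis unfolding G_def using i1 i2 by (simp add: left_diff_distrib)
      qed
      moreover have "integrable lborel (\<lambda>\<xi>. (cu \<xi> - cv \<xi>) * (heat_symbol (t - s) \<xi> * \<psi> \<xi>))"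
        using i1 i2 by (simp add: left_diff_distrib)
      ultimately have "ennreal (norm (G s)) \<le> (\<integral>\<^sup>+\<xi>. ennreal (norm ((cu \<xi> - cv \<xi>) * (heat_symbol (t - s) \<xi> * \<psi> \<xi>))) \<partial>lborel)"
        by (simp only:) (rule integral_norm_bound_ennreal)
      also have "\<dots> \<le> (\<integral>\<^sup>+\<xi>. ennreal (gauss (4 * pi * (t - s)) \<xi>) * ennreal (riesz_const * Q * (norm \<xi> powr (- (k - 2)) * norm (\<psi> \<xi>))) \<partial>lborel)"
        using AE_lborel_singleton[of "0::real^'n"]
      proof (intro nn_integral_mono_AE, eventually_elim)
        case (elim \<xi>)
        \<comment> \<open>V * u - W * v = V * (u - v) + (V - W) * v: the first term is controlled by
          D, the second by M.\<close>
        have e: "cu \<xi> - cv \<xi> = Defs.convolution (hat V) (\<lambda>x. hat (u s) x - hat (v s) x) \<xi> + Defs.convolution (\<lambda>x. hat V x - hat W x) (hat (v s)) \<xi>"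
          using convolution_integrable[OF bV bu elim(2)] convolution_integrable[OF bV bv elim(2)] convolution_integrable[OF bW bv elim(2)]
          by (simp add: cu_def cv_def Defs.convolution_def left_diff_distrib right_diff_distrib)
        have "norm (cu \<xi> - cv \<xi>) \<le> PM_norm (n - 2) V * PM_norm k (u s - v s) * riesz_const * norm \<xi> powr (- (k - 2))
            + PM_norm (n - 2) (V - W) * PM_norm k (v s) * riesz_const * norm \<xi> powr (- (k - 2))"
          unfolding e by (rule order_trans[OF norm_triangle_ineq add_mono[OF convolution_bound[OF bV buv elim(2)] convolution_bound[OF bVW bv elim(2)]]])
        also have "\<dots> \<le> PM_norm (n - 2) V * D * riesz_const * norm \<xi> powr (- (k - 2))
            + PM_norm (n - 2) (V - W) * M * riesz_const * norm \<xi> powr (- (k - 2))"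
        proof (rule add_mono)
          have w: "0 \<le> riesz_const" "0 \<le> norm \<xi> powr (- (k - 2))" using riesz_const_pos by auto
          show "PM_norm (n - 2) V * PM_norm k (u s - v s) * riesz_const * norm \<xi> powr (- (k - 2)) \<le> PM_norm (n - 2) V * D * riesz_const * norm \<xi> powr (- (k - 2))"
            by (rule mult_right_mono[OF mult_right_mono[OF mult_left_mono[OF D[OF s(1)] PM_norm_nonneg] w(1)] w(2)])
          show "PM_norm (n - 2) (V - W) * PM_norm k (v s) * riesz_const * norm \<xi> powr (- (k - 2)) \<le> PM_norm (n - 2) (V - W) * M * riesz_const * norm \<xi> powr (- (k - 2))"
            by (rule mult_right_mono[OF mult_right_mono[OF mult_left_mono[OF M[OF s(1)] PM_norm_nonneg] w(1)] w(2)])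
        qed
        also have "\<dots> = riesz_const * Q * norm \<xi> powr (- (k - 2))" by (simp add: Q_def algebra_simps)
        finally have "norm (cu \<xi> - cv \<xi>) * (gauss (4 * pi * (t - s)) \<xi> * norm (\<psi> \<xi>)) \<le> riesz_const * Q * norm \<xi> powr (- (k - 2)) * (gauss (4 * pi * (t - s)) \<xi> * norm (\<psi> \<xi>))"
          by (intro mult_right_mono) (auto simp: gauss_def)
        then have "norm ((cu \<xi> - cv \<xi>) * (heat_symbol (t - s) \<xi> * \<psi> \<xi>)) \<le> gauss (4 * pi * (t - s)) \<xi> * (riesz_const * Q * (norm \<xi> powr (- (k - 2)) * norm (\<psi> \<xi>)))"
          by (simp add: norm_mult norm_heat_symbol mult_ac)
        then show ?case by (subst ennreal_mult'[symmetric]) (auto simp: gauss_def intro!: ennreal_leI)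
      qed
      finally show ?thesis .
    qed
    have T2: "norm (LINT s:{0..t}|lborel. G s) \<le> C_const n k * Q * J"
    proof -
      have "ennreal (norm (LINT s:{0..t}|lborel. G s)) \<le> (\<integral>\<^sup>+s. ennreal (norm (indicator {0..t} s *\<^sub>R G s)) \<partial>lborel)"
        unfolding set_lebesgue_integral_def by (rule integral_norm_bound_ennreal) (use iG in \<open>simp add: set_integrable_def\<close>)
      also have "\<dots> \<le> (\<integral>\<^sup>+s. (\<integral>\<^sup>+\<xi>. ennreal (indicator {0..t} s * gauss (4 * pi * (t - s)) \<xi>) * ennreal (riesz_const * Q * (norm \<xi> powr (- (k - 2)) * norm (\<psi> \<xi>))) \<partial>lborel) \<partial>lborel)"
        \<comment> \<open>The time s = 0 is discarded, since D and M give no information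
          there.\<close>
        using AE_lborel_singleton[of "0::real"]
      proof (intro nn_integral_mono_AE, eventually_elim)
        case (elim s)
        show ?case using Gb[of s] elim by (cases "s \<in> {0..t}") auto
      qed
      also have "\<dots> = (\<integral>\<^sup>+\<xi>. (\<integral>\<^sup>+s. ennreal (indicator {0..t} s * gauss (4 * pi * (t - s)) \<xi>) * ennreal (riesz_const * Q * (norm \<xi> powr (- (k - 2)) * norm (\<psi> \<xi>))) \<partial>lborel) \<partial>lborel)"
        unfolding gauss_def by (rule lborel_pair.Fubini'[symmetric]) measurable
      also have "\<dots> \<le> (\<integral>\<^sup>+\<xi>. ennreal (C_const n k * Q * (norm \<xi> powr (- k) * norm (\<psi> \<xi>))) \<partial>lborel)"
        using AE_lborel_singleton[of "0::real^'n"]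
      proof (intro nn_integral_mono_AE, eventually_elim)
        case (elim \<xi>)
        have "(\<integral>\<^sup>+s. ennreal (indicator {0..t} s * gauss (4 * pi * (t - s)) \<xi>) * ennreal (riesz_const * Q * (norm \<xi> powr (- (k - 2)) * norm (\<psi> \<xi>))) \<partial>lborel)
          = (\<integral>\<^sup>+s. ennreal (indicator {0..t} s * gauss (4 * pi * (t - s)) \<xi>) \<partial>lborel) * ennreal (riesz_const * Q * (norm \<xi> powr (- (k - 2)) * norm (\<psi> \<xi>)))"
          unfolding gauss_def by (rule nn_integral_multc) measurable
        also have "\<dots> \<le> ennreal (norm \<xi> powr (- 2) / (4 * pi\<^sup>2)) * ennreal (riesz_const * Q * (norm \<xi> powr (- (k - 2)) * norm (\<psi> \<xi>)))"
          by (intro mult_right_mono heat_time_integral elim) auto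
        also have "\<dots> = ennreal (C_const n k * Q * ((norm \<xi> powr (- 2) * norm \<xi> powr (- (k - 2))) * norm (\<psi> \<xi>)))"
          using riesz_const_pos Q0 by (simp add: ennreal_mult'[symmetric] C_riesz_const mult_ac)
        \<comment> \<open>The factor |\<xi>|^(-2) from the time integral compensates exactly for the
          loss of two powers in the convolution.\<close>
        also have "norm \<xi> powr (- 2) * norm \<xi> powr (- (k - 2)) = norm \<xi> powr (- k)"
          unfolding powr_add[symmetric] by simp
        finally show ?case .
      qed
      also have "\<dots> = ennreal (C_const n k * Q * J)"
        unfolding J_def integral_mult_right_zero[symmetric]
        using C_pos Q0 by (intro nn_integral_eq_integral integrable_mult_right wk) auto
      finally show ?thesis
        using C_pos Q0 by (subst (asm) ennreal_le_iff) (auto simp: J_def intro!: mult_nonneg_nonneg integral_nonneg_AE)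
    qed
    have i0: "integrable lborel (\<lambda>\<xi>. hat u\<^sub>0 \<xi> * (heat_symbol t \<xi> * \<psi> \<xi>))" "integrable lborel (\<lambda>\<xi>. hat v\<^sub>0 \<xi> * (heat_symbol t \<xi> * \<psi> \<xi>))"
      by (rule pk.powr_bounded_schwartz[OF PM_hat(2)[OF PM(1)] hs], rule pk.powr_bounded_schwartz[OF PM_hat(2)[OF PM(2)] hs])
    have e1: "(LINT x|lborel. (hat (u t) x - hat (v t) x) * \<psi> x) = (LINT x|lborel. hat (u t) x * \<psi> x) - (LINT x|lborel. hat (v t) x * \<psi> x)"
      using iuv by (simp add: left_diff_distrib)
    have e2: "(LINT \<xi>|lborel. (hat u\<^sub>0 \<xi> - hat v\<^sub>0 \<xi>) * (heat_symbol t \<xi> * \<psi> \<xi>))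
       = (LINT \<xi>|lborel. hat u\<^sub>0 \<xi> * (heat_symbol t \<xi> * \<psi> \<xi>)) - (LINT \<xi>|lborel. hat v\<^sub>0 \<xi> * (heat_symbol t \<xi> * \<psi> \<xi>))"
      using i0 by (simp add: left_diff_distrib)
    have e3: "(LINT s:{0..t}|lborel. G s) = (LINT s:{0..t}|lborel. time_integrand V u \<psi> t s) - (LINT s:{0..t}|lborel. time_integrand W v \<psi> t s)"
      unfolding G_def by (rule set_integral_diff(2)) (intro time_integrand_integrable PM X \<psi>)+
    have "(LINT x|lborel. (hat (u t) x - hat (v t) x) * \<psi> x)
       = (LINT \<xi>|lborel. (hat u\<^sub>0 \<xi> - hat v\<^sub>0 \<xi>) * (heat_symbol t \<xi> * \<psi> \<xi>)) + (LINT s:{0..t}|lborel. G s)"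
      unfolding e1 e2 e3 solves_fourier[OF sol(1) PM(1) X(1) t \<psi>] solves_fourier[OF sol(2) PM(2) X(2) t \<psi>]
      by (rule add_diff_add)
    then have "norm (LINT x|lborel. (hat (u t) x - hat (v t) x) * \<psi> x)
        \<le> norm (LINT \<xi>|lborel. (hat u\<^sub>0 \<xi> - hat v\<^sub>0 \<xi>) * (heat_symbol t \<xi> * \<psi> \<xi>)) + norm (LINT s:{0..t}|lborel. G s)"
      by (simp only: norm_triangle_ineq)
    also have "\<dots> \<le> a * J + C_const n k * Q * J" by (intro add_mono T1 T2)
    also have "\<dots> = (a + C_const n k * Q) * J" by (rule distrib_right[symmetric])
    also have "\<dots> = (LINT x|lborel. B x * norm (\<psi> x))"
      unfolding J_def B_def integral_mult_right_zero[symmetric] by (simp only: mult.assoc)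
    finally show "norm (LINT x|lborel. (hat (u t) x - hat (v t) x) * \<psi> x) \<le> (LINT x|lborel. B x * norm (\<psi> x))" .
  qed
  then have "powr_bounded k (a + C_const n k * Q) (\<lambda>\<xi>. hat (u t) \<xi> - hat (v t) \<xi>)"
    using powr_boundedD(1)[OF pk.powr_bounded_hat_diff[OF Pu[OF t] Pv[OF t]]] a0 Q0 C_pos
    by (simp add: powr_bounded_def B_def)
  from pk.PM_norm_diff_le[OF Pu[OF t] Pv[OF t] this] show ?thesis by (simp add: a_def Q_def)
qed

section \<open>A priori bound, Lipschitz dependence and uniqueness\<close>

lemma X_norm_upper:
  fixes u v :: "real \<Rightarrow> 'n dist"
  assumes X: "u \<in> X_space k" "v \<in> X_space k" and s: "0 < s"
  shows "PM_norm k (u s - v s) \<le> X_norm k (u - v)"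
proof -
  obtain B where B: "\<And>t. 0 \<le> t \<Longrightarrow> u t \<in> PM k" "\<And>t. 0 \<le> t \<Longrightarrow> powr_bounded k B (hat (u t))"
    using X_spaceD[OF X(1)] by metis
  obtain B' where B': "\<And>t. 0 \<le> t \<Longrightarrow> v t \<in> PM k" "\<And>t. 0 \<le> t \<Longrightarrow> powr_bounded k B' (hat (v t))"
    using X_spaceD[OF X(2)] by metis
  have "PM_norm k (u t - v t) \<le> B + B'" if "0 \<le> t" for t
    by (rule pk.PM_norm_diff_le[OF B(1) B'(1) powr_bounded_diff[OF B(2) B'(2)]]) (use that in auto)
  then have "bdd_above ((\<lambda>t. PM_norm k ((u - v) t)) ` {0<..})" by (intro bdd_aboveI2[where M="B + B'"]) auto
  from cSUP_upper[OF _ this, of s] s show ?thesis by (simp add: X_norm_def)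
qed

lemma X_norm_least:
  assumes "\<And>t. 0 < t \<Longrightarrow> PM_norm k (u t - v t) \<le> A"
  shows "X_norm k (u - v) \<le> A"
  unfolding X_norm_def by (intro cSUP_least) (use assms in auto)

lemma of_hat_0: "of_hat (\<lambda>_. 0) = (0 :: 'n dist)"
proof
  fix \<phi> :: "real^'n \<Rightarrow> complex"
  show "of_hat (\<lambda>_. 0) \<phi> = (0 :: 'n dist) \<phi>"
    by (cases "\<phi> \<in> schwartz") (auto simp: of_hat_eq of_hat_outside)
qed

lemma zero_powr_bounded: "powr_bounded p 0 (\<lambda>_::real^'n. 0)"
  by (simp add: powr_bounded_def)

lemma zero_PM: "(0 :: 'n dist) \<in> PM k" "PM_norm k (0 :: 'n dist) \<le> 0" "(0 :: 'n dist) \<in> PM (n - 2)"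
  using pk.of_hat_PM(1,2)[OF zero_powr_bounded] pv.of_hat_PM(1)[OF zero_powr_bounded] by (simp_all add: of_hat_0)

lemma zero_X: "(0 :: real \<Rightarrow> 'n dist) \<in> X_space k"
  using zero_PM by (auto simp: X_space_def)

text \<open>The representative \<open>hat 0\<close> need not vanish pointwise, so the convolution is
  shown to vanish off the origin through the convolution bound with constant 0.\<close>

lemma zero_solves: "solves (0 :: 'n dist) 0 0"
  unfolding solves_def
proof (intro allI impI ext)
  fix t :: real and \<phi> :: "real^'n \<Rightarrow> complex" assume t: "0 \<le> t"
  have h: "powr_bounded k 0 (hat (0 :: 'n dist))"
    using PM_hat(2)[OF zero_PM(1)] zero_PM(2) PM_norm_nonneg[of k "0 :: 'n dist"] by simp
  have c: "Defs.convolution (hat (0 :: 'n dist)) (hat (0 :: 'n dist)) \<xi> = 0" if "\<xi> \<noteq> 0" for \<xi>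
    using convolution_bound[OF PM_hat(2)[OF zero_PM(3)] h that] by simp
  have "(LINT \<xi>|lborel. heat_symbol (t - s) \<xi> * Defs.convolution (hat (0 :: 'n dist)) (hat (0 :: 'n dist)) \<xi> * \<psi> \<xi>) = 0" for s \<psi>
    using AE_lborel_singleton[of "0::real^'n"] by (intro integral_eq_zero_AE, eventually_elim) (simp add: c)
  then have "L_hat (0 :: 'n dist) 0 t \<psi> = 0" for \<psi> by (simp add: L_hat_def set_lebesgue_integral_def)
  then have "L_op (0 :: 'n dist) 0 t \<phi> = 0" by (simp add: L_op_def dist_fourier_inv_def)
  moreover have "heat_op t (0 :: 'n dist) \<phi> = 0"
    by (simp add: heat_op_def dist_fourier_inv_def dist_mult_def dist_fourier_def)
  ultimately show "(0 :: real \<Rightarrow> 'n dist) t \<phi> = (heat_op t 0 + L_op 0 0 t) \<phi>" by simp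
qed

text \<open>Comparison of v with the zero solution for zero data and zero potential; the term with
  the difference of potentials carries the factor M = 0.\<close>

lemma solution_norm:
  fixes v\<^sub>0 W :: "'n dist"
  assumes PM: "v\<^sub>0 \<in> PM k" "W \<in> PM (n - 2)" and X: "v \<in> X_space k" and sol: "solves v\<^sub>0 W v"
  shows "X_norm k v \<le> PM_norm k v\<^sub>0 + C_const n k * PM_norm (n - 2) W * X_norm k v"
proof -
  have "PM_norm k (v t - (0 :: real \<Rightarrow> 'n dist) t) \<le> PM_norm k (v\<^sub>0 - 0) + C_const n k * (PM_norm (n - 2) W * X_norm k (v - 0) + PM_norm (n - 2) (W - 0) * 0)"
    if "0 < t" for t
    by (rule solution_estimate[OF PM(1) zero_PM(1) PM(2) zero_PM(3) X zero_X sol zero_solves X_norm_upper[OF X zero_X]])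
       (use that zero_PM(2) in auto)
  from X_norm_least[where u=v and v=0, OF this] show ?thesis by (simp add: mult.assoc)
qed

text \<open>Absorption is used twice: the a priori bound for v absorbs with the constant of W and
  supplies M, and the estimate for u - v, with its own norm as D, absorbs with the constant of
  V.\<close>

theorem continuous_dependence:
  fixes u\<^sub>0 v\<^sub>0 V W :: "'n dist"
  assumes PM: "u\<^sub>0 \<in> PM k" "v\<^sub>0 \<in> PM k" "V \<in> PM (n - 2)" "W \<in> PM (n - 2)"
    and small: "PM_norm (n - 2) V < 1 / C_const n k" "PM_norm (n - 2) W < 1 / C_const n k"
    and X: "u \<in> X_space k" "v \<in> X_space k" and sol: "solves u\<^sub>0 V u" "solves v\<^sub>0 W v"
  shows "X_norm k (u - v) \<le> 1 / (1 - C_const n k * PM_norm (n - 2) V) *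
    (PM_norm k (u\<^sub>0 - v\<^sub>0) + C_const n k * PM_norm k v\<^sub>0 / (1 - C_const n k * PM_norm (n - 2) W) * PM_norm (n - 2) (V - W))"
proof -
  define C where "C = C_const n k"
  have C: "C > 0" unfolding C_def by (rule C_pos)
  define qV where "qV = C * PM_norm (n - 2) V"
  define qW where "qW = C * PM_norm (n - 2) W"
  have q: "qV < 1" "qW < 1" using small C by (auto simp: qV_def qW_def C_def[symmetric] field_simps)
  \<comment> \<open>The a priori bound for v; it is the origin of the denominator containing
    W.\<close>
  define Mv where "Mv = PM_norm k v\<^sub>0 / (1 - qW)"
  have "X_norm k v \<le> PM_norm k v\<^sub>0 + qW * X_norm k v"
    using solution_norm[OF PM(2,4) X(2) sol(2)] by (simp add: qW_def C_def)
  then have "X_norm k v * (1 - qW) \<le> PM_norm k v\<^sub>0" by (simp add: algebra_simps)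
  then have Xv: "X_norm k v \<le> Mv" using q by (simp add: Mv_def pos_le_divide_eq)
  have vs: "PM_norm k (v s) \<le> Mv" if "0 < s" for s
    using X_norm_upper[OF X(2) zero_X that] Xv by simp
  have "PM_norm k (u t - v t) \<le> PM_norm k (u\<^sub>0 - v\<^sub>0) + C_const n k * (PM_norm (n - 2) V * X_norm k (u - v) + PM_norm (n - 2) (V - W) * Mv)"
    if "0 < t" for t
    by (rule solution_estimate[OF PM X sol X_norm_upper[OF X] vs]) (use that in auto)
  from X_norm_least[OF this]
  have "X_norm k (u - v) * (1 - qV) \<le> PM_norm k (u\<^sub>0 - v\<^sub>0) + C * (PM_norm (n - 2) (V - W) * Mv)"
    by (simp add: qV_def C_def algebra_simps)
  then have "X_norm k (u - v) \<le> (PM_norm k (u\<^sub>0 - v\<^sub>0) + C * (PM_norm (n - 2) (V - W) * Mv)) / (1 - qV)"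
    using q by (simp add: pos_le_divide_eq)
  then show ?thesis unfolding C_def[symmetric] qV_def[symmetric] qW_def[symmetric] Mv_def by (simp add: mult_ac)
qed

text \<open>Lipschitz dependence with equal data gives a vanishing norm, which concerns positive
  times only. A second use of the estimate, now with D = 0, covers t = 0; negative times agree by
  the convention of \<open>X_space\<close>.\<close>

theorem uniqueness:
  fixes u\<^sub>0 V :: "'n dist"
  assumes PM: "u\<^sub>0 \<in> PM k" "V \<in> PM (n - 2)" and small: "PM_norm (n - 2) V < 1 / C_const n k"
    and X: "u \<in> X_space k" "v \<in> X_space k" and sol: "solves u\<^sub>0 V u" "solves u\<^sub>0 V v"
  shows "u = v"
proof
  fix t
  have z: "PM_norm k (0 :: 'n dist) = 0" "PM_norm (n - 2) (0 :: 'n dist) = 0"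
    using zero_PM(2) PM_norm_nonneg[of k "0 :: 'n dist"] pv.of_hat_PM(2)[OF zero_powr_bounded] PM_norm_nonneg[of "n - 2" "0 :: 'n dist"]
    by (auto simp: of_hat_0)
  have Xn: "X_norm k (u - v) \<le> 0"
    using continuous_dependence[OF PM(1,1) PM(2,2) small small X sol] by (simp add: z)
  obtain B where B: "\<And>t. 0 \<le> t \<Longrightarrow> PM_norm k (v t) \<le> B"
    using X_spaceD[OF X(2)] by metis
  show "u t = v t"
  proof (cases "0 \<le> t")
    case True
    have P: "u t \<in> PM k" "v t \<in> PM k" using X True by (auto simp: X_space_def)
    have "PM_norm k (u t - v t) \<le> PM_norm k (u\<^sub>0 - u\<^sub>0) + C_const n k * (PM_norm (n - 2) V * 0 + PM_norm (n - 2) (V - V) * B)"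
      by (rule solution_estimate[OF PM(1,1) PM(2,2) X sol order_trans[OF X_norm_upper[OF X] Xn]]) (use True B in auto)
    then show ?thesis using pk.PM_eqI[OF P] by (simp add: z)
  next
    case False
    then show ?thesis using X by (simp add: X_space_def)
  qed
qed

end

section \<open>Existence by a Neumann series on the Fourier side\<close>

lemma integrable_indicator_Icc: "integrable lborel (indicator {a..b::real} :: real \<Rightarrow> real)"
  by (rule integrable_real_indicator) (auto simp: emeasure_lborel_Icc_eq)

context equation
begin

text \<open>Since \<open>norm 0 powr (- k) = 0\<close>, the pointwise bound forces the value 0 at the origin; the operator
  below is therefore set to 0 there.\<close>

definition jointly_bounded :: "real \<Rightarrow> (real \<Rightarrow> real^'n \<Rightarrow> complex) \<Rightarrow> bool" where
  "jointly_bounded M h \<longleftrightarrow> (\<lambda>(s, \<eta>). h s \<eta>) \<in> borel_measurable (borel \<Otimes>\<^sub>M borel) \<and> 0 \<le> M \<and>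
     (\<forall>s \<eta>. norm (h s \<eta>) \<le> M * norm \<eta> powr (- k))"

definition T_op :: "(real^'n \<Rightarrow> complex) \<Rightarrow> (real \<Rightarrow> real^'n \<Rightarrow> complex) \<Rightarrow> real \<Rightarrow> real^'n \<Rightarrow> complex" where
  "T_op V h t \<xi> = (if \<xi> = 0 then 0 else
     (LINT s:{0..t}|lborel. heat_symbol (t - s) \<xi> * Defs.convolution V (h s) \<xi>))"

section \<open>The Duhamel operator on jointly measurable functions\<close>

lemma jointly_boundedD:
  assumes "jointly_bounded M h"
  shows "(\<lambda>(s, \<eta>). h s \<eta>) \<in> borel_measurable (borel \<Otimes>\<^sub>M borel)" "0 \<le> M"
    "norm (h s \<eta>) \<le> M * norm \<eta> powr (- k)" "powr_bounded k M (h s)"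
proof -
  show m[measurable]: "(\<lambda>(s, \<eta>). h s \<eta>) \<in> borel_measurable (borel \<Otimes>\<^sub>M borel)" and "0 \<le> M"
    and b: "norm (h s \<eta>) \<le> M * norm \<eta> powr (- k)" for s \<eta>
    using assms by (auto simp: jointly_bounded_def)
  have "h s \<in> borel_measurable borel" by measurable
  then show "powr_bounded k M (h s)" using b \<open>0 \<le> M\<close> by (simp add: powr_bounded_def)
qed

lemma jointly_bounded_add:
  assumes "jointly_bounded M h" "jointly_bounded M' h'"
  shows "jointly_bounded (M + M') (\<lambda>s \<eta>. h s \<eta> + h' s \<eta>)"
proof -
  note [measurable] = jointly_boundedD(1)[OF assms(1)] jointly_boundedD(1)[OF assms(2)]
  have "(\<lambda>(s, \<eta>). h s \<eta> + h' s \<eta>) \<in> borel_measurable (borel \<Otimes>\<^sub>M borel)" by measurable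
  moreover have "norm (h s \<eta> + h' s \<eta>) \<le> (M + M') * norm \<eta> powr (- k)" for s \<eta>
    using norm_triangle_ineq[of "h s \<eta>" "h' s \<eta>"] jointly_boundedD(3)[OF assms(1), of s \<eta>] jointly_boundedD(3)[OF assms(2), of s \<eta>]
    by (simp add: distrib_right)
  ultimately show ?thesis using jointly_boundedD(2)[OF assms(1)] jointly_boundedD(2)[OF assms(2)] by (simp add: jointly_bounded_def)
qed

lemma convolution_measurable_pair:
  assumes [measurable]: "V \<in> borel_measurable borel" "(\<lambda>(s, \<eta>). h s \<eta>) \<in> borel_measurable (borel \<Otimes>\<^sub>M borel)"
  shows "(\<lambda>(s, \<xi>::real^'n). Defs.convolution V (h s) \<xi>) \<in> borel_measurable (borel \<Otimes>\<^sub>M borel)"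
proof -
  have "(\<lambda>p. LINT \<eta>|lborel. V (snd p - \<eta>) * h (fst p) \<eta>) \<in> borel_measurable (borel \<Otimes>\<^sub>M (borel :: (real^'n) measure))"
    by (rule lborel.borel_measurable_lebesgue_integral) measurable
  then show ?thesis by (simp add: Defs.convolution_def case_prod_beta')
qed

lemma T_op_measurable:
  assumes [measurable]: "V \<in> borel_measurable borel" "(\<lambda>(s, \<eta>). h s \<eta>) \<in> borel_measurable (borel \<Otimes>\<^sub>M borel)"
  shows "(\<lambda>(t, \<xi>::real^'n). T_op V h t \<xi>) \<in> borel_measurable (borel \<Otimes>\<^sub>M borel)"
proof -
  note [measurable] = convolution_measurable_pair[OF assms]
  \<comment> \<open>The indicator of {0..t} is split into a function of s and a function of t - s,
    which displays joint measurability in the parameter t.\<close>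
  have "(\<lambda>p. LINT s|lborel. (indicator {0..} s * indicator {0..} (fst p - s)) *\<^sub>R (heat_symbol (fst p - s) (snd p) * Defs.convolution V (h s) (snd p)))
      \<in> borel_measurable (borel \<Otimes>\<^sub>M (borel :: (real^'n) measure))"
    by (rule lborel.borel_measurable_lebesgue_integral) measurable
  then have [measurable]: "(\<lambda>(t, \<xi>::real^'n). LINT s|lborel. (indicator {0..} s * indicator {0..} (t - s)) *\<^sub>R (heat_symbol (t - s) \<xi> * Defs.convolution V (h s) \<xi>))
      \<in> borel_measurable (borel \<Otimes>\<^sub>M borel)" by (simp add: case_prod_beta')
  have eq: "T_op V h t \<xi> = (if \<xi> = 0 then 0 else
     (LINT s|lborel. (indicator {0..} s * indicator {0..} (t - s)) *\<^sub>R (heat_symbol (t - s) \<xi> * Defs.convolution V (h s) \<xi>)))" for t \<xi>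
    unfolding T_op_def set_lebesgue_integral_def
    by (auto simp: indicator_def intro!: Bochner_Integration.integral_cong)
  show ?thesis unfolding eq by measurable
qed

lemma T_op_integrable:
  assumes V: "powr_bounded (n - 2) v V" and h: "jointly_bounded M h" and \<xi>: "\<xi> \<noteq> 0"
  shows "set_integrable lborel {0..t} (\<lambda>s. heat_symbol (t - s) \<xi> * Defs.convolution V (h s) \<xi>)"
  unfolding set_integrable_def
proof -
  note [measurable] = convolution_measurable_pair[OF powr_boundedD(1)[OF V] jointly_boundedD(1)[OF h]]
  define c where "c = v * M * riesz_const * norm \<xi> powr (- (k - 2))"
  have "integrable lborel (\<lambda>s. indicator {0..t} s *\<^sub>R c)" by (simp add: integrable_indicator_Icc)
  then show "integrable lborel (\<lambda>s. indicator {0..t} s *\<^sub>R (heat_symbol (t - s) \<xi> * Defs.convolution V (h s) \<xi>))"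
  proof (rule Bochner_Integration.integrable_bound, measurable, intro AE_I2)
    fix s :: real
    have "norm (heat_symbol (t - s) \<xi> * Defs.convolution V (h s) \<xi>) \<le> 1 * c" if "s \<le> t"
      unfolding norm_mult c_def
      by (intro mult_mono norm_heat_symbol_le convolution_bound[OF V jointly_boundedD(4)[OF h] \<xi>]) (use that in auto)
    then show "norm (indicator {0..t} s *\<^sub>R (heat_symbol (t - s) \<xi> * Defs.convolution V (h s) \<xi>)) \<le> norm (indicator {0..t} s *\<^sub>R c)"
      by (auto simp: indicator_def)
  qed
qed

text \<open>The contraction property, valid at every point: the convolution bound combined with the
  time integral of the heat symbol. At \<xi> = 0 both sides are 0.\<close>

lemma T_op_bound:
  assumes V: "powr_bounded (n - 2) v V" and h: "jointly_bounded M h"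
  shows "norm (T_op V h t \<xi>) \<le> (C_const n k * v * M) * norm \<xi> powr (- k)"
proof (cases "\<xi> = 0")
  case False
  define c where "c = v * M * riesz_const * norm \<xi> powr (- (k - 2))"
  have c0: "0 \<le> c" unfolding c_def using powr_boundedD(2)[OF V] jointly_boundedD(2)[OF h] riesz_const_pos by auto
  have "ennreal (norm (T_op V h t \<xi>)) \<le> (\<integral>\<^sup>+s. ennreal (norm (indicator {0..t} s *\<^sub>R (heat_symbol (t - s) \<xi> * Defs.convolution V (h s) \<xi>))) \<partial>lborel)"
    using T_op_integrable[OF V h False, of t] False
    by (simp only: T_op_def if_False set_lebesgue_integral_def set_integrable_def integral_norm_bound_ennreal)
  also have "\<dots> \<le> (\<integral>\<^sup>+s. ennreal (indicator {0..t} s * gauss (4 * pi * (t - s)) \<xi>) * ennreal c \<partial>lborel)"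
  proof (rule nn_integral_mono)
    fix s :: real
    have "gauss (4 * pi * (t - s)) \<xi> * norm (Defs.convolution V (h s) \<xi>) \<le> gauss (4 * pi * (t - s)) \<xi> * c"
      unfolding c_def by (intro mult_left_mono convolution_bound[OF V jointly_boundedD(4)[OF h] False]) (simp add: gauss_def)
    then show "ennreal (norm (indicator {0..t} s *\<^sub>R (heat_symbol (t - s) \<xi> * Defs.convolution V (h s) \<xi>)))
        \<le> ennreal (indicator {0..t} s * gauss (4 * pi * (t - s)) \<xi>) * ennreal c"
      using c0 by (auto simp: indicator_def norm_mult norm_heat_symbol ennreal_mult''[symmetric] intro!: ennreal_leI)
  qed
  also have "\<dots> = (\<integral>\<^sup>+s. ennreal (indicator {0..t} s * gauss (4 * pi * (t - s)) \<xi>) \<partial>lborel) * ennreal c"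
    unfolding gauss_def by (rule nn_integral_multc) measurable
  also have "\<dots> \<le> ennreal (norm \<xi> powr (- 2) / (4 * pi\<^sup>2)) * ennreal c"
    by (rule mult_right_mono[OF heat_time_integral[OF False]]) simp
  also have "\<dots> = ennreal ((C_const n k * v * M) * (norm \<xi> powr (- 2) * norm \<xi> powr (- (k - 2))))"
    using c0 by (simp add: ennreal_mult''[symmetric] C_riesz_const c_def mult_ac)
  also have "norm \<xi> powr (- 2) * norm \<xi> powr (- (k - 2)) = norm \<xi> powr (- k)"
    unfolding powr_add[symmetric] by simp
  finally show ?thesis
    using C_pos powr_boundedD(2)[OF V] jointly_boundedD(2)[OF h] by (subst (asm) ennreal_le_iff) auto
qed (simp add: T_op_def)

lemma T_op_jointly_bounded:
  assumes V: "powr_bounded (n - 2) v V" and h: "jointly_bounded M h"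
  shows "jointly_bounded (C_const n k * v * M) (T_op V h)"
  using T_op_measurable[OF powr_boundedD(1)[OF V] jointly_boundedD(1)[OF h]] T_op_bound[OF V h]
    C_pos powr_boundedD(2)[OF V] jointly_boundedD(2)[OF h] by (simp add: jointly_bounded_def)

lemma T_op_add:
  assumes V: "powr_bounded (n - 2) v V" and h: "jointly_bounded M h" "jointly_bounded M' h'"
  shows "T_op V (\<lambda>s \<eta>. h s \<eta> + h' s \<eta>) t \<xi> = T_op V h t \<xi> + T_op V h' t \<xi>"
proof (cases "\<xi> = 0")
  case False
  have "Defs.convolution V (\<lambda>\<eta>. h s \<eta> + h' s \<eta>) \<xi> = Defs.convolution V (h s) \<xi> + Defs.convolution V (h' s) \<xi>" for s
    unfolding Defs.convolution_def distrib_left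
    by (rule Bochner_Integration.integral_add) (rule convolution_integrable[OF V jointly_boundedD(4)[OF h(1)] False] convolution_integrable[OF V jointly_boundedD(4)[OF h(2)] False])+
  then show ?thesis
    using False set_integral_add(2)[OF T_op_integrable[OF V h(1) False] T_op_integrable[OF V h(2) False]]
    by (simp add: T_op_def distrib_left)
qed (simp add: T_op_def)

text \<open>Dominated convergence on a bounded time interval: the moving indicator converges except
  at the endpoint s = a. Weak continuity of the solution rests on this pointwise continuity.\<close>

lemma T_op_continuous:
  assumes V: "powr_bounded (n - 2) v V" and h: "jointly_bounded M h"
  shows "continuous_on {0..} (\<lambda>t. T_op V h t \<xi>)"
proof (cases "\<xi> = 0")
  case True
  then show ?thesis by (simp add: T_op_def)
next
  case False
  note [measurable] = convolution_measurable_pair[OF powr_boundedD(1)[OF V] jointly_boundedD(1)[OF h]]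
  define c where "c = v * M * riesz_const * norm \<xi> powr (- (k - 2))"
  have c0: "0 \<le> c" unfolding c_def using powr_boundedD(2)[OF V] jointly_boundedD(2)[OF h] riesz_const_pos by auto
  show ?thesis
    unfolding continuous_on_sequentially
  proof (intro allI ballI impI)
    fix x :: "nat \<Rightarrow> real" and a assume a: "a \<in> {0..}" and "(\<forall>n. x n \<in> {0..}) \<and> x \<longlonglongrightarrow> a"
    then have x: "x \<longlonglongrightarrow> a" by simp
    obtain R where R: "\<And>j. x j \<le> R" using convergent_imp_Bseq[OF convergentI[OF x]] by (auto simp: Bseq_def) (metis abs_le_D1)
    have "(\<lambda>j. LINT s|lborel. indicator {0..x j} s *\<^sub>R (heat_symbol (x j - s) \<xi> * Defs.convolution V (h s) \<xi>))
       \<longlonglongrightarrow> (LINT s|lborel. indicator {0..a} s *\<^sub>R (heat_symbol (a - s) \<xi> * Defs.convolution V (h s) \<xi>))"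
    proof (rule integral_dominated_convergence)
      show "integrable lborel (\<lambda>s. indicator {0..R} s *\<^sub>R c)" by (simp add: integrable_indicator_Icc)
      show "AE s in lborel. (\<lambda>j. indicator {0..x j} s *\<^sub>R (heat_symbol (x j - s) \<xi> * Defs.convolution V (h s) \<xi>))
          \<longlonglongrightarrow> indicator {0..a} s *\<^sub>R (heat_symbol (a - s) \<xi> * Defs.convolution V (h s) \<xi>)"
        using AE_lborel_singleton[of a]
      proof eventually_elim
        case (elim s)
        have "(\<lambda>j. indicator {0..x j} s :: real) \<longlonglongrightarrow> indicator {0..a} s"
        proof (cases "s < a")
          case True
          then have "\<forall>\<^sub>F j in sequentially. s < x j" using x by (rule order_tendstoD(1)[rotated])
          then have "\<forall>\<^sub>F j in sequentially. (indicator {0..x j} s :: real) = indicator {0..a} s"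
            by eventually_elim (use True in \<open>auto simp: indicator_def\<close>)
          then show ?thesis by (rule tendsto_eventually)
        next
          case False
          then have "a < s" using elim by simp
          then have "\<forall>\<^sub>F j in sequentially. x j < s" using x by (rule order_tendstoD(2)[rotated])
          then have "\<forall>\<^sub>F j in sequentially. (indicator {0..x j} s :: real) = indicator {0..a} s"
            by eventually_elim (use \<open>a < s\<close> in \<open>auto simp: indicator_def\<close>)
          then show ?thesis by (rule tendsto_eventually)
        qed
        then show ?case unfolding heat_symbol_def by (intro tendsto_intros x) auto
      qed
      show "AE s in lborel. norm (indicator {0..x j} s *\<^sub>R (heat_symbol (x j - s) \<xi> * Defs.convolution V (h s) \<xi>)) \<le> indicator {0..R} s *\<^sub>R c" for j
      proof (intro AE_I2)
        fix s :: real
        have "norm (heat_symbol (x j - s) \<xi> * Defs.convolution V (h s) \<xi>) \<le> 1 * c" if "s \<le> x j"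
          unfolding norm_mult c_def
          by (intro mult_mono norm_heat_symbol_le convolution_bound[OF V jointly_boundedD(4)[OF h] False]) (use that in auto)
        then show "norm (indicator {0..x j} s *\<^sub>R (heat_symbol (x j - s) \<xi> * Defs.convolution V (h s) \<xi>)) \<le> indicator {0..R} s *\<^sub>R c"
          using R[of j] c0 by (auto simp: indicator_def)
      qed
    qed measurable
    then show "((\<lambda>t. T_op V h t \<xi>) \<circ> x) \<longlonglongrightarrow> T_op V h a \<xi>"
      using False by (simp add: o_def T_op_def set_lebesgue_integral_def)
  qed
qed

text \<open>The remainder of the series is itself jointly bounded with a geometrically small
  constant. Additivity of \<open>T_op\<close> and its pointwise bound therefore suffice to pass to
  the limit, and no completeness of X_k is invoked.\<close>

lemma neumann_series:
  assumes V: "powr_bounded (n - 2) v V" and q: "C_const n k * v < 1" and h0: "jointly_bounded M h0"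
  obtains h M' where "jointly_bounded M' h" "\<And>t \<xi>. h t \<xi> = h0 t \<xi> + T_op V h t \<xi>"
proof -
  define q where "q = C_const n k * v"
  have q1: "0 \<le> q" "q < 1" unfolding q_def using assms(2) C_pos powr_boundedD(2)[OF V] by auto
  define H where "H = (\<lambda>j. (T_op V ^^ j) h0)"
  have H: "jointly_bounded (q ^ j * M) (H j)" for j
  proof (induction j)
    case 0
    then show ?case using h0 by (simp add: H_def)
  next
    case (Suc j)
    from T_op_jointly_bounded[OF V Suc] show ?case by (simp add: H_def q_def mult_ac)
  qed
  define w where "w = (\<lambda>\<eta>::real^'n. M * norm \<eta> powr (- k))"
  have M0: "0 \<le> M" by (rule jointly_boundedD(2)[OF h0])
  have Hb: "norm (H j s \<eta>) \<le> q ^ j * w \<eta>" for j s \<eta>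
    using jointly_boundedD(3)[OF H[of j], of s \<eta>] by (simp add: w_def mult.assoc)
  have geo: "(\<lambda>j. q ^ j * w \<eta>) sums (1 / (1 - q) * w \<eta>)" for \<eta>
    using geometric_sums[of q] q1 by (intro sums_mult2) simp
  have sumH: "summable (\<lambda>j. norm (H j s \<eta>))" for s \<eta>
    by (rule summable_comparison_test'[OF sums_summable[OF geo[of \<eta>]]]) (use Hb in auto)
  define h where "h = (\<lambda>s \<eta>. \<Sum>j. H j s \<eta>)"
  define S where "S = (\<lambda>J s \<eta>. \<Sum>j<J. H j s \<eta>)"
  have [measurable]: "(\<lambda>(s, \<eta>). H j s \<eta>) \<in> borel_measurable (borel \<Otimes>\<^sub>M borel)" for j
    by (rule jointly_boundedD(1)[OF H])
  have Sj: "jointly_bounded (\<Sum>j<J. q ^ j * M) (S J)" for J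
  proof (induction J)
    case 0
    then show ?case by (simp add: S_def jointly_bounded_def)
  next
    case (Suc J)
    from jointly_bounded_add[OF Suc H[of J]] show ?case by (simp add: S_def)
  qed
  have R: "jointly_bounded (q ^ J / (1 - q) * M) (\<lambda>s \<eta>. h s \<eta> - S J s \<eta>)" for J
    unfolding jointly_bounded_def
  proof (intro conjI allI)
    have "(\<lambda>p. (\<Sum>j. H j (fst p) (snd p)) - (\<Sum>j<J. H j (fst p) (snd p))) \<in> borel_measurable (borel \<Otimes>\<^sub>M borel)"
      by measurable
    then show "(\<lambda>(s, \<eta>). h s \<eta> - S J s \<eta>) \<in> borel_measurable (borel \<Otimes>\<^sub>M borel)" by (simp add: h_def S_def case_prod_beta')
    show "0 \<le> q ^ J / (1 - q) * M" using q1 M0 by simp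
    fix s and \<eta> :: "real^'n"
    have "h s \<eta> - S J s \<eta> = (\<Sum>j. H (j + J) s \<eta>)"
      using suminf_split_initial_segment[OF summable_norm_cancel[OF sumH[of s \<eta>]], of J] by (simp add: h_def S_def)
    also have "norm \<dots> \<le> (\<Sum>j. norm (H (j + J) s \<eta>))"
      by (rule summable_norm) (use sumH[of s \<eta>] summable_iff_shift[of "\<lambda>j. norm (H j s \<eta>)" J] in simp)
    also have "\<dots> \<le> (\<Sum>j. q ^ J * (q ^ j * w \<eta>))"
    proof (rule suminf_le)
      show "norm (H (j + J) s \<eta>) \<le> q ^ J * (q ^ j * w \<eta>)" for j using Hb[of "j + J" s \<eta>] by (simp add: power_add mult_ac)
      show "summable (\<lambda>j. norm (H (j + J) s \<eta>))" using sumH[of s \<eta>] summable_iff_shift[of "\<lambda>j. norm (H j s \<eta>)" J] by simp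
      show "summable (\<lambda>j. q ^ J * (q ^ j * w \<eta>))" by (intro summable_mult sums_summable[OF geo])
    qed
    also have "\<dots> = q ^ J * (1 / (1 - q) * w \<eta>)"
      by (rule sums_unique[symmetric]) (intro sums_mult geo)
    finally show "norm (h s \<eta> - S J s \<eta>) \<le> q ^ J / (1 - q) * M * norm \<eta> powr (- k)" by (simp add: w_def)
  qed
  \<comment> \<open>The remainder after zero terms is the whole series.\<close>
  have hb: "jointly_bounded (M / (1 - q)) h" using R[of 0] by (simp add: S_def)
  \<comment> \<open>Each application of the operator shifts the partial sum by one index, so the
    first term h0 is the defect.\<close>
  have TS: "T_op V (S J) t \<xi> = S (Suc J) t \<xi> - h0 t \<xi>" for J t \<xi>
  proof (induction J)
    case 0
    have "Defs.convolution V (S 0 s) \<xi> = 0" for s by (simp add: S_def Defs.convolution_def)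
    then show ?case by (simp add: T_op_def set_lebesgue_integral_def) (simp add: S_def H_def)
  next
    case (Suc J)
    have "S (Suc J) = (\<lambda>s \<eta>. S J s \<eta> + H J s \<eta>)" by (simp add: S_def)
    then have "T_op V (S (Suc J)) t \<xi> = T_op V (S J) t \<xi> + T_op V (H J) t \<xi>"
      by (simp only: T_op_add[OF V Sj H])
    also have "T_op V (H J) t \<xi> = H (Suc J) t \<xi>" by (simp add: H_def)
    finally show ?case using Suc by (simp add: S_def)
  qed
  have "h t \<xi> = h0 t \<xi> + T_op V h t \<xi>" for t \<xi>
  proof -
    \<comment> \<open>A sequence constant in J: the defect of the fixed point equation is squeezed
      between 0 and a geometric sequence.\<close>
    have "(\<lambda>J. norm (h t \<xi> - h0 t \<xi> - T_op V h t \<xi>)) \<longlonglongrightarrow> 0"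
    proof (rule tendsto_sandwich[OF _ _ tendsto_const])
      show "\<forall>\<^sub>F J in sequentially. norm (h t \<xi> - h0 t \<xi> - T_op V h t \<xi>) \<le> q ^ J * (2 * (M / (1 - q)) * norm \<xi> powr (- k))"
      proof (intro always_eventually allI)
        fix J
        have "T_op V h t \<xi> = T_op V (S J) t \<xi> + T_op V (\<lambda>s \<eta>. h s \<eta> - S J s \<eta>) t \<xi>"
          using T_op_add[OF V Sj[of J] R[of J], of t \<xi>] by simp
        then have e: "h t \<xi> - h0 t \<xi> - T_op V h t \<xi> = (h t \<xi> - S (Suc J) t \<xi>) - T_op V (\<lambda>s \<eta>. h s \<eta> - S J s \<eta>) t \<xi>"
          by (simp add: TS)
        define Y where "Y = q ^ J / (1 - q) * M * norm \<xi> powr (- k)"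
        have Y0: "0 \<le> Y" using q1 M0 by (simp add: Y_def)
        have qY: "q * Y \<le> Y" using mult_right_mono[of q 1 Y] q1 Y0 by simp
        have "norm (h t \<xi> - S (Suc J) t \<xi>) \<le> q ^ Suc J / (1 - q) * M * norm \<xi> powr (- k)"
          by (rule jointly_boundedD(3)[OF R])
        also have "\<dots> = q * Y" by (simp add: Y_def)
        finally have a1: "norm (h t \<xi> - S (Suc J) t \<xi>) \<le> Y" using qY by (rule order_trans)
        have "norm (T_op V (\<lambda>s \<eta>. h s \<eta> - S J s \<eta>) t \<xi>) \<le> q * (q ^ J / (1 - q) * M) * norm \<xi> powr (- k)"
          using T_op_bound[OF V R[of J], of t \<xi>] by (simp add: q_def)
        also have "\<dots> = q * Y" by (simp add: Y_def)
        finally have a2: "norm (T_op V (\<lambda>s \<eta>. h s \<eta> - S J s \<eta>) t \<xi>) \<le> Y" using qY by (rule order_trans)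
        have "norm (h t \<xi> - h0 t \<xi> - T_op V h t \<xi>) \<le> Y + Y"
          unfolding e by (rule order_trans[OF norm_triangle_ineq4 add_mono[OF a1 a2]])
        then show "norm (h t \<xi> - h0 t \<xi> - T_op V h t \<xi>) \<le> q ^ J * (2 * (M / (1 - q)) * norm \<xi> powr (- k))"
          by (simp add: Y_def mult_ac)
      qed
      have "(\<lambda>J. q ^ J * (2 * (M / (1 - q)) * norm \<xi> powr (- k))) \<longlonglongrightarrow> 0 * (2 * (M / (1 - q)) * norm \<xi> powr (- k))"
        by (intro tendsto_mult tendsto_const LIMSEQ_power_zero) (use q1 in auto)
      then show "(\<lambda>J. q ^ J * (2 * (M / (1 - q)) * norm \<xi> powr (- k))) \<longlonglongrightarrow> 0" by simp
    qed auto
    then have "norm (h t \<xi> - h0 t \<xi> - T_op V h t \<xi>) = 0" by (simp add: LIMSEQ_const_iff)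
    then show ?thesis by (simp add: algebra_simps)
  qed
  then show ?thesis using that hb by blast
qed

text \<open>Identifies the weak time integral of the equation with an honest function of \<xi>.
  Fubini is available because h is jointly measurable.\<close>

lemma T_op_fubini:
  assumes V: "powr_bounded (n - 2) v V" and h: "jointly_bounded M h" and \<psi>: "\<psi> \<in> schwartz"
  shows "(LINT s:{0..t}|lborel. (LINT \<xi>|lborel. heat_symbol (t - s) \<xi> * Defs.convolution V (h s) \<xi> * \<psi> \<xi>))
    = (LINT \<xi>|lborel. T_op V h t \<xi> * \<psi> \<xi>)"
proof -
  note [measurable] = convolution_measurable_pair[OF powr_boundedD(1)[OF V] jointly_boundedD(1)[OF h]] schwartz_measurable[OF \<psi>]
    T_op_measurable[OF powr_boundedD(1)[OF V] jointly_boundedD(1)[OF h]]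
  define c where "c = v * M * riesz_const"
  have c0: "0 \<le> c" unfolding c_def using powr_boundedD(2)[OF V] jointly_boundedD(2)[OF h] riesz_const_pos by auto
  define F where "F = (\<lambda>s \<xi>. indicator {0..t} s *\<^sub>R (heat_symbol (t - s) \<xi> * Defs.convolution V (h s) \<xi> * \<psi> \<xi>))"
  have mF[measurable]: "(\<lambda>(s, \<xi>). F s \<xi>) \<in> borel_measurable (borel \<Otimes>\<^sub>M borel)" unfolding F_def by measurable
  have i1: "integrable lborel (\<lambda>s::real. complex_of_real (indicator {0..t} s))"
    unfolding complex_of_real_integrable_eq by (rule integrable_indicator_Icc)
  have i2: "integrable lborel (\<lambda>\<xi>. complex_of_real (c * (norm \<xi> powr (- (k - 2)) * norm (\<psi> \<xi>))))"
    unfolding complex_of_real_integrable_eq by (intro integrable_mult_right pc.integrable_powr_schwartz \<psi>)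
  have "integrable (lborel \<Otimes>\<^sub>M lborel) (\<lambda>(s, \<xi>). complex_of_real (indicator {0..t} s) * complex_of_real (c * (norm \<xi> powr (- (k - 2)) * norm (\<psi> \<xi>))) * 1)"
    by (rule integrable_pair_bounded[OF i1 i2]) auto
  then have "integrable (lborel \<Otimes>\<^sub>M lborel) (\<lambda>(s, \<xi>). F s \<xi>)"
  proof (rule Bochner_Integration.integrable_bound)
    show "(\<lambda>(s, \<xi>). F s \<xi>) \<in> borel_measurable (lborel \<Otimes>\<^sub>M lborel)" using mF by simp
    have le: "norm (F s \<xi>) \<le> norm (complex_of_real (indicator {0..t} s) * complex_of_real (c * (norm \<xi> powr (- (k - 2)) * norm (\<psi> \<xi>))) * 1)"
      if "\<xi> \<noteq> 0" for s and \<xi> :: "real^'n"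
    proof (cases "s \<in> {0..t}")
      case True
      have "norm (heat_symbol (t - s) \<xi> * Defs.convolution V (h s) \<xi> * \<psi> \<xi>) \<le> 1 * (c * norm \<xi> powr (- (k - 2))) * norm (\<psi> \<xi>)"
        unfolding norm_mult c_def
        by (intro mult_mono mult_nonneg_nonneg norm_heat_symbol_le convolution_bound[OF V jointly_boundedD(4)[OF h] that])
           (use True powr_boundedD(2)[OF V] jointly_boundedD(2)[OF h] riesz_const_pos in auto)
      then show ?thesis using True c0 by (simp add: F_def norm_mult abs_mult mult_ac)
    qed (simp add: F_def)
    define D where "D = (\<lambda>s \<xi>. complex_of_real (indicator {0..t} s) * complex_of_real (c * (norm (\<xi>::real^'n) powr (- (k - 2)) * norm (\<psi> \<xi>))) * 1)"
    have mD[measurable]: "(\<lambda>(s, \<xi>). D s \<xi>) \<in> borel_measurable (borel \<Otimes>\<^sub>M borel)" unfolding D_def by measurable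
    \<comment> \<open>The pointwise domination fails to be known only at \<xi> = 0, a null set in
      each time slice.\<close>
    have "AE p in lborel \<Otimes>\<^sub>M lborel. norm (F (fst p) (snd p)) \<le> norm (D (fst p) (snd p))"
    proof (rule lborel_pair.AE_pair_measure)
      show "{p \<in> space (lborel \<Otimes>\<^sub>M lborel). norm (F (fst p) (snd p)) \<le> norm (D (fst p) (snd p))} \<in> sets (lborel \<Otimes>\<^sub>M lborel)"
        by measurable
      show "AE s in lborel. AE \<xi> in lborel. norm (F (fst (s, \<xi>)) (snd (s, \<xi>))) \<le> norm (D (fst (s, \<xi>)) (snd (s, \<xi>)))"
      proof (rule AE_I2)
        fix s :: real
        show "AE \<xi> in lborel. norm (F (fst (s, \<xi>)) (snd (s, \<xi>))) \<le> norm (D (fst (s, \<xi>)) (snd (s, \<xi>)))"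
          using AE_lborel_singleton[of "0::real^'n"] unfolding fst_conv snd_conv D_def by eventually_elim (rule le)
      qed
    qed
    then show "AE p in lborel \<Otimes>\<^sub>M lborel. norm (case p of (s, \<xi>) \<Rightarrow> F s \<xi>) \<le> norm (case p of (s, \<xi>) \<Rightarrow> complex_of_real (indicator {0..t} s) * complex_of_real (c * (norm \<xi> powr (- (k - 2)) * norm (\<psi> \<xi>))) * 1)"
      unfolding D_def case_prod_beta' .
  qed
  from lborel_pair.Fubini_integral[OF this]
  have "(LINT s|lborel. (LINT \<xi>|lborel. F s \<xi>)) = (LINT \<xi>|lborel. (LINT s|lborel. F s \<xi>))" by simp
  also have "\<dots> = (LINT \<xi>|lborel. T_op V h t \<xi> * \<psi> \<xi>)"
  proof (rule integral_cong_AE)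
    show "AE \<xi> in lborel. (LINT s|lborel. F s \<xi>) = T_op V h t \<xi> * \<psi> \<xi>"
      using AE_lborel_singleton[of "0::real^'n"]
    proof eventually_elim
      case (elim \<xi>)
      have "F s \<xi> = (indicator {0..t} s *\<^sub>R (heat_symbol (t - s) \<xi> * Defs.convolution V (h s) \<xi>)) * \<psi> \<xi>" for s
        by (simp add: F_def)
      then have "(LINT s|lborel. F s \<xi>) = (LINT s|lborel. indicator {0..t} s *\<^sub>R (heat_symbol (t - s) \<xi> * Defs.convolution V (h s) \<xi>)) * \<psi> \<xi>"
        by (simp only: integral_mult_left_zero)
      then show ?case using elim by (simp only: T_op_def set_lebesgue_integral_def if_False)
    qed
  qed measurable
  finally show ?thesis
    unfolding set_lebesgue_integral_def F_def by (simp add: integral_scaleR_right)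
qed

text \<open>The fixed point on the Fourier side is transported back by \<open>of_hat\<close>; what
  has to be checked is weak continuity and that \<open>L_op\<close>, which is written with the
  chosen representatives, sees the fixed point itself.\<close>

theorem existence:
  fixes u\<^sub>0 V :: "'n dist"
  assumes u0: "u\<^sub>0 \<in> PM k" and V: "V \<in> PM (n - 2)" and small: "PM_norm (n - 2) V < 1 / C_const n k"
  shows "\<exists>u. u \<in> X_space k \<and> solves u\<^sub>0 V u"
proof -
  define v where "v = PM_norm (n - 2) V"
  define M where "M = PM_norm k u\<^sub>0"
  have bV: "powr_bounded (n - 2) v (hat V)" unfolding v_def by (rule PM_hat(2)[OF V])
  have bu: "powr_bounded k M (hat u\<^sub>0)" unfolding M_def by (rule PM_hat(2)[OF u0])
  note [measurable] = powr_boundedD(1)[OF bV] powr_boundedD(1)[OF bu]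
  have q: "C_const n k * v < 1" using small C_pos by (simp add: v_def field_simps)
  \<comment> \<open>A representative of the transform of the data whose bound holds everywhere, as
    \<open>jointly_bounded\<close> requires.\<close>
  define g where "g = (\<lambda>\<xi>. if norm (hat u\<^sub>0 \<xi>) \<le> M * norm \<xi> powr (- k) then hat u\<^sub>0 \<xi> else 0)"
  have [measurable]: "g \<in> borel_measurable borel" unfolding g_def by measurable
  have M0: "0 \<le> M" by (rule powr_boundedD(2)[OF bu])
  have gb: "norm (g \<xi>) \<le> M * norm \<xi> powr (- k)" for \<xi> using M0 by (simp add: g_def)
  have ag: "AE \<xi> in lborel. g \<xi> = hat u\<^sub>0 \<xi>"
    using powr_boundedD(3)[OF bu] by eventually_elim (simp add: g_def)
  \<comment> \<open>Set to 0 at negative times, where the heat symbol exceeds 1 away from the origin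
    and the bound could fail.\<close>
  define h0 where "h0 = (\<lambda>t \<xi>. if 0 \<le> t then heat_symbol t \<xi> * g \<xi> else 0)"
  have h0: "jointly_bounded M h0"
    unfolding jointly_bounded_def
  proof (intro conjI allI M0)
    show "(\<lambda>(t, \<xi>). h0 t \<xi>) \<in> borel_measurable (borel \<Otimes>\<^sub>M borel)" unfolding h0_def by measurable
    show "norm (h0 t \<xi>) \<le> M * norm \<xi> powr (- k)" for t \<xi>
    proof (cases "0 \<le> t")
      case True
      have "norm (heat_symbol t \<xi>) * norm (g \<xi>) \<le> 1 * (M * norm \<xi> powr (- k))"
        by (intro mult_mono norm_heat_symbol_le True gb) auto
      then show ?thesis using True by (simp add: h0_def norm_mult)
    qed (simp add: h0_def M0)
  qed
  obtain h M' where h: "jointly_bounded M' h" "\<And>t \<xi>. h t \<xi> = h0 t \<xi> + T_op (hat V) h t \<xi>"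
    by (rule neumann_series[OF bV q h0]) (rule that)
  have hb: "powr_bounded k M' (h t)" for t by (rule jointly_boundedD(4)[OF h(1)])
  define u where "u = (\<lambda>t::real. if t < 0 then 0 else of_hat (h t))"
  have ut: "u t = of_hat (h t)" if "0 \<le> t" for t using that by (simp add: u_def)
  have X: "u \<in> X_space k"
    unfolding X_space_def
  proof (intro CollectI conjI allI impI ballI)
    show "u t \<in> PM k" if "0 \<le> t" for t using pk.of_hat_PM(1)[OF hb[of t]] that by (simp add: ut)
    show "\<exists>B. \<forall>t\<ge>0. PM_norm k (u t) \<le> B" using pk.of_hat_PM(2)[OF hb] by (auto simp: ut)
    show "u t = 0" if "t < 0" for t using that by (simp add: u_def)
    fix \<phi> :: "real^'n \<Rightarrow> complex" assume \<phi>: "\<phi> \<in> schwartz"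
    define \<psi> where "\<psi> = fourier_inv \<phi>"
    have \<psi>: "\<psi> \<in> schwartz" unfolding \<psi>_def by (rule fourier_inv_schwartz[OF \<phi>])
    note [measurable] = schwartz_measurable[OF \<psi>] jointly_boundedD(1)[OF h(1)]
    have "continuous_on {0..} (\<lambda>t. LINT \<xi>|lborel. h t \<xi> * \<psi> \<xi>)"
      unfolding continuous_on_sequentially
    proof (intro allI ballI impI)
      fix x :: "nat \<Rightarrow> real" and a assume a: "a \<in> {0..}" and x: "(\<forall>n. x n \<in> {0..}) \<and> x \<longlonglongrightarrow> a"
      have "(\<lambda>j. LINT \<xi>|lborel. h (x j) \<xi> * \<psi> \<xi>) \<longlonglongrightarrow> (LINT \<xi>|lborel. h a \<xi> * \<psi> \<xi>)"
      proof (rule integral_dominated_convergence)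
        show "integrable lborel (\<lambda>\<xi>. M' * (norm \<xi> powr (- k) * norm (\<psi> \<xi>)))"
          by (intro integrable_mult_right pk.integrable_powr_schwartz \<psi>)
        show "AE \<xi> in lborel. (\<lambda>j. h (x j) \<xi> * \<psi> \<xi>) \<longlonglongrightarrow> h a \<xi> * \<psi> \<xi>"
        proof (intro AE_I2 tendsto_mult tendsto_const)
          fix \<xi> :: "real^'n"
          have "(\<lambda>j. heat_symbol (x j) \<xi> * g \<xi> + T_op (hat V) h (x j) \<xi>) \<longlonglongrightarrow> heat_symbol a \<xi> * g \<xi> + T_op (hat V) h a \<xi>"
          proof (intro tendsto_add tendsto_mult tendsto_const)
            show "(\<lambda>j. heat_symbol (x j) \<xi>) \<longlonglongrightarrow> heat_symbol a \<xi>"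
              unfolding heat_symbol_def using x by (intro tendsto_intros) auto
            show "(\<lambda>j. T_op (hat V) h (x j) \<xi>) \<longlonglongrightarrow> T_op (hat V) h a \<xi>"
              using T_op_continuous[OF bV h(1), of \<xi>] a x unfolding continuous_on_sequentially by (auto simp: o_def)
          qed
          moreover have "h t \<xi> = heat_symbol t \<xi> * g \<xi> + T_op (hat V) h t \<xi>" if "0 \<le> t" for t
            using h(2)[of t \<xi>] that by (simp add: h0_def)
          ultimately show "(\<lambda>j. h (x j) \<xi>) \<longlonglongrightarrow> h a \<xi>" using a x by simp
        qed
        show "AE \<xi> in lborel. norm (h (x j) \<xi> * \<psi> \<xi>) \<le> M' * (norm \<xi> powr (- k) * norm (\<psi> \<xi>))" for j
        proof (intro AE_I2)
          fix \<xi> :: "real^'n"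
          show "norm (h (x j) \<xi> * \<psi> \<xi>) \<le> M' * (norm \<xi> powr (- k) * norm (\<psi> \<xi>))"
            using mult_right_mono[OF jointly_boundedD(3)[OF h(1), of "x j" \<xi>], of "norm (\<psi> \<xi>)"] by (simp add: norm_mult mult.assoc)
        qed
      qed measurable
      then show "((\<lambda>t. LINT \<xi>|lborel. h t \<xi> * \<psi> \<xi>) \<circ> x) \<longlonglongrightarrow> (LINT \<xi>|lborel. h a \<xi> * \<psi> \<xi>)" by (simp add: o_def)
    qed
    then show "continuous_on {0..} (\<lambda>t. u t \<phi>)"
      by (rule continuous_on_cong[THEN iffD1, rotated -1]) (auto simp: ut of_hat_eq \<phi> \<psi>_def)
  qed
  have "solves u\<^sub>0 V u"
    unfolding solves_def
  proof (intro allI impI ext)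
    fix t :: real and \<phi> :: "real^'n \<Rightarrow> complex" assume t: "0 \<le> t"
    show "u t \<phi> = (heat_op t u\<^sub>0 + L_op V u t) \<phi>"
    proof (cases "\<phi> \<in> schwartz")
      case True
      define \<psi> where "\<psi> = fourier_inv \<phi>"
      have \<psi>: "\<psi> \<in> schwartz" unfolding \<psi>_def by (rule fourier_inv_schwartz[OF True])
      have \<phi>: "\<phi> = fourier \<psi>" unfolding \<psi>_def by (rule fourier_fourier_inv[OF True, symmetric])
      note [measurable] = schwartz_measurable[OF \<psi>] jointly_boundedD(1)[OF h(1)] jointly_boundedD(1)[OF h0]
      have "L_hat V u t \<psi> = (LINT s:{0..t}|lborel. (LINT \<xi>|lborel. heat_symbol (t - s) \<xi> * Defs.convolution (hat V) (h s) \<xi> * \<psi> \<xi>))"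
      proof -
        \<comment> \<open>The chosen \<open>hat (u s)\<close> equals \<open>h s\<close> almost
          everywhere for each s, so the two convolutions agree at every \<xi> and the jointly
          measurable function may replace the choices.\<close>
        have "Defs.convolution (hat V) (hat (u s)) \<xi> = Defs.convolution (hat V) (h s) \<xi>" if s: "0 \<le> s" for s \<xi>
        proof -
          have ae: "AE \<eta> in lborel. hat (u s) \<eta> = h s \<eta>" unfolding ut[OF s] by (rule pk.of_hat_PM(3)[OF hb])
          have [measurable]: "hat (u s) \<in> borel_measurable borel" "h s \<in> borel_measurable borel"
            using powr_boundedD(1)[OF PM_hat(2)[OF pk.of_hat_PM(1)[OF hb[of s]]]] powr_boundedD(1)[OF hb[of s]] by (auto simp: ut[OF s])
          show ?thesis unfolding Defs.convolution_def
          proof (rule integral_cong_AE)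
            show "AE \<eta> in lborel. hat V (\<xi> - \<eta>) * hat (u s) \<eta> = hat V (\<xi> - \<eta>) * h s \<eta>"
              using ae by eventually_elim simp
          qed measurable
        qed
        then show ?thesis using \<psi> unfolding L_hat_def
          by (auto intro!: set_lebesgue_integral_cong)
      qed
      also have "\<dots> = (LINT \<xi>|lborel. T_op (hat V) h t \<xi> * \<psi> \<xi>)" by (rule T_op_fubini[OF bV h(1) \<psi>])
      finally have L: "L_op V u t \<phi> = (LINT \<xi>|lborel. T_op (hat V) h t \<xi> * \<psi> \<xi>)"
        unfolding \<phi> L_op_fourier[OF \<psi>] .
      have G: "heat_op t u\<^sub>0 \<phi> = (LINT \<xi>|lborel. h0 t \<xi> * \<psi> \<xi>)"
        unfolding \<phi> heat_op_fourier[OF u0 t \<psi>]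
      proof (rule integral_cong_AE)
        show "AE \<xi> in lborel. hat u\<^sub>0 \<xi> * (heat_symbol t \<xi> * \<psi> \<xi>) = h0 t \<xi> * \<psi> \<xi>"
          using ag by eventually_elim (use t in \<open>simp add: h0_def\<close>)
      qed measurable
      have i: "integrable lborel (\<lambda>\<xi>. h0 t \<xi> * \<psi> \<xi>)" "integrable lborel (\<lambda>\<xi>. T_op (hat V) h t \<xi> * \<psi> \<xi>)"
        by (rule pk.powr_bounded_schwartz[OF jointly_boundedD(4)[OF h0] \<psi>],
            rule pk.powr_bounded_schwartz[OF jointly_boundedD(4)[OF T_op_jointly_bounded[OF bV h(1)]] \<psi>])
      have "u t \<phi> = (LINT \<xi>|lborel. h t \<xi> * \<psi> \<xi>)" using True by (simp add: ut[OF t] of_hat_eq \<psi>_def)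
      also have "\<dots> = (LINT \<xi>|lborel. h0 t \<xi> * \<psi> \<xi> + T_op (hat V) h t \<xi> * \<psi> \<xi>)"
        by (subst h(2)) (simp add: distrib_right)
      also have "\<dots> = heat_op t u\<^sub>0 \<phi> + L_op V u t \<phi>" unfolding G L by (rule Bochner_Integration.integral_add[OF i])
      finally show ?thesis by simp
    next
      case False
      then show ?thesis by (simp add: ut[OF t] of_hat_outside heat_op_def L_op_def dist_fourier_inv_def)
    qed
  qed
  then show ?thesis using X by blast
qed

section \<open>The Hardy threshold and the final statement\<close>

lemma hardy_small_iff:
  "PM_norm (n - 2) (hardy c :: 'n dist) < 1 / C_const n k \<longleftrightarrow> \<bar>c\<bar> < (k - 2) * (n - k)"
proof -
  have nu: "0 < pi * nu (n - 2)" using k2 kn by (intro mult_pos_pos nu_pos) auto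
  have "PM_norm (n - 2) (hardy c :: 'n dist) = \<bar>c\<bar> * (pi * nu (n - 2))"
    unfolding n using hardy_PM(2)[OF n3, of c] by simp
  moreover have "1 / C_const n k = (k - 2) * (n - k) * (pi * nu (n - 2))"
    unfolding C_const_eq[OF k2 kn] by simp
  ultimately show ?thesis using nu by (simp only: mult_less_cancel_right_pos)
qed

lemma unique_solution:
  fixes u\<^sub>0 V :: "'n dist"
  assumes "u\<^sub>0 \<in> PM k" "V \<in> PM (n - 2)" "PM_norm (n - 2) V < 1 / C_const n k"
  shows "\<exists>!u. u \<in> X_space k \<and> solves u\<^sub>0 V u"
  using existence[OF assms] uniqueness[OF assms] by blast

end

text \<open>The setting is instantiated at two exponents: the given k, and the maximiser 1 + n/2,
  which the solvability claim for the Hardy potential uses independently of k.\<close>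

theorem theorem1p1:
  fixes n :: nat and k :: real
  assumes "CARD('n::finite) = n" and "n \<ge> 3" and "2 < k" and "k < real n"
  shows
    "(\<comment> \<open>(i)\<close>
      \<forall>V \<in> (PM (real n - 2) :: 'n dist set). \<forall>u\<^sub>0 \<in> PM k.
        PM_norm (real n - 2) V < 1 / C_const n k \<longrightarrow>
        (\<exists>!u. u \<in> X_space k \<and> solves u\<^sub>0 V u))
   \<and> (\<comment> \<open>(ii)\<close>
      (\<forall>c::real. (hardy c :: 'n dist) \<in> PM (real n - 2) \<and>
        (PM_norm (real n - 2) (hardy c :: 'n dist) < 1 / C_const n k \<longleftrightarrow>
         \<bar>c\<bar> < (k - 2) * (real n - k))) \<and>
      ((real n + 2) / 2 \<in> {2<..<real n} \<and>
       ((real n + 2) / 2 - 2) * (real n - (real n + 2) / 2) = (real n - 2)\<^sup>2 / 4 \<and>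
       (\<forall>\<kappa>\<in>{2<..<real n}. (\<kappa> - 2) * (real n - \<kappa>) \<le> (real n - 2)\<^sup>2 / 4)) \<and>
      (\<forall>u\<^sub>0 \<in> (PM (1 + real n / 2) :: 'n dist set). \<forall>c::real.
        0 \<le> \<bar>c\<bar> \<and> \<bar>c\<bar> < (real n - 2)\<^sup>2 / 4 \<longrightarrow>
        (\<exists>!u. u \<in> X_space (1 + real n / 2) \<and> solves u\<^sub>0 (hardy c) u)))
   \<and> (\<comment> \<open>(iii)\<close>
      \<forall>u\<^sub>0 \<in> (PM k :: 'n dist set). \<forall>v\<^sub>0 \<in> PM k.
      \<forall>V \<in> PM (real n - 2). \<forall>W \<in> PM (real n - 2).
        PM_norm (real n - 2) V < 1 / C_const n k \<longrightarrow>
        PM_norm (real n - 2) W < 1 / C_const n k \<longrightarrow>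
        (\<forall>u \<in> X_space k. \<forall>v \<in> X_space k. solves u\<^sub>0 V u \<longrightarrow> solves v\<^sub>0 W v \<longrightarrow>
          X_norm k (u - v) \<le>
            1 / (1 - C_const n k * PM_norm (real n - 2) V) *
            (PM_norm k (u\<^sub>0 - v\<^sub>0) +
             C_const n k * PM_norm k v\<^sub>0 / (1 - C_const n k * PM_norm (real n - 2) W) *
             PM_norm (real n - 2) (V - W))))"
proof -
  have n3: "3 \<le> CARD('n)" and n: "real n = real CARD('n)" using assms by auto
  interpret E: equation k "real n" "TYPE('n)" by standard (use assms n3 n in auto)
  interpret H: equation "1 + real n / 2" "real n" "TYPE('n)" by standard (use assms n3 n in auto)
  have hardy: "(hardy c :: 'n dist) \<in> PM (real n - 2)" for c
    unfolding n by (rule hardy_PM(1)[OF n3])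
  have top: "(1 + real n / 2 - 2) * (real n - (1 + real n / 2)) = (real n - 2)\<^sup>2 / 4"
    by (simp add: power2_eq_square field_simps)
  have max: "(\<kappa> - 2) * (real n - \<kappa>) \<le> (real n - 2)\<^sup>2 / 4" for \<kappa> :: real
  proof -
    \<comment> \<open>A quarter of this square is the difference between (n - 2)^2 / 4 and (\<kappa>
      - 2)(n - \<kappa>).\<close>
    have "0 \<le> (2 * \<kappa> - (real n + 2))\<^sup>2" by simp
    then show ?thesis by (simp add: power2_eq_square algebra_simps)
  qed
  show ?thesis
  proof (intro conjI)
    show "\<forall>V \<in> (PM (real n - 2) :: 'n dist set). \<forall>u\<^sub>0 \<in> PM k.
        PM_norm (real n - 2) V < 1 / C_const n k \<longrightarrow> (\<exists>!u. u \<in> X_space k \<and> solves u\<^sub>0 V u)"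
      using E.unique_solution by blast
    show "\<forall>c::real. (hardy c :: 'n dist) \<in> PM (real n - 2) \<and>
        (PM_norm (real n - 2) (hardy c :: 'n dist) < 1 / C_const n k \<longleftrightarrow> \<bar>c\<bar> < (k - 2) * (real n - k))"
      using hardy E.hardy_small_iff by blast
    show "(real n + 2) / 2 \<in> {2<..<real n}" using assms by auto
    show "((real n + 2) / 2 - 2) * (real n - (real n + 2) / 2) = (real n - 2)\<^sup>2 / 4"
      by (simp add: power2_eq_square field_simps)
    show "\<forall>\<kappa>\<in>{2<..<real n}. (\<kappa> - 2) * (real n - \<kappa>) \<le> (real n - 2)\<^sup>2 / 4" using max by blast
    show "\<forall>u\<^sub>0 \<in> (PM (1 + real n / 2) :: 'n dist set). \<forall>c::real.
        0 \<le> \<bar>c\<bar> \<and> \<bar>c\<bar> < (real n - 2)\<^sup>2 / 4 \<longrightarrow>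
        (\<exists>!u. u \<in> X_space (1 + real n / 2) \<and> solves u\<^sub>0 (hardy c) u)"
    proof (intro ballI allI impI)
      fix u\<^sub>0 :: "'n dist" and c :: real
      assume "u\<^sub>0 \<in> PM (1 + real n / 2)" "0 \<le> \<bar>c\<bar> \<and> \<bar>c\<bar> < (real n - 2)\<^sup>2 / 4"
      then show "\<exists>!u. u \<in> X_space (1 + real n / 2) \<and> solves u\<^sub>0 (hardy c) u"
        by (intro H.unique_solution hardy) (simp_all only: H.hardy_small_iff top)
    qed
    show "\<forall>u\<^sub>0 \<in> (PM k :: 'n dist set). \<forall>v\<^sub>0 \<in> PM k.
      \<forall>V \<in> PM (real n - 2). \<forall>W \<in> PM (real n - 2).
        PM_norm (real n - 2) V < 1 / C_const n k \<longrightarrow>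
        PM_norm (real n - 2) W < 1 / C_const n k \<longrightarrow>
        (\<forall>u \<in> X_space k. \<forall>v \<in> X_space k. solves u\<^sub>0 V u \<longrightarrow> solves v\<^sub>0 W v \<longrightarrow>
          X_norm k (u - v) \<le>
            1 / (1 - C_const n k * PM_norm (real n - 2) V) *
            (PM_norm k (u\<^sub>0 - v\<^sub>0) +
             C_const n k * PM_norm k v\<^sub>0 / (1 - C_const n k * PM_norm (real n - 2) W) *
             PM_norm (real n - 2) (V - W)))"
      by (intro ballI impI E.continuous_dependence)
  qed
qed

end
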